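(* Assume $V$ satisfies (V1)–(V3) and that $\mu_V$ has an $L^\infty$ density. For any $n$ and any distinct points $x_1,\dots,x_n\in\mathbb{R}^d$ (identified with points of $\mathbb{R}^d\times\{0\}$), with $h'_{n,\eta}$ the truncated blown-up potential defined in the context, one has in the Riesz case $$H_n(x_1,\dots,x_n)=n^2\mathcal{E}(\mu_V)+2n\sum_{i=1}^n\zeta(x_i)+n^{1+\frac sd}\lim_{\eta\to0}\frac1{c_{d,s}}\Big(\frac1n\int_{\mathbb{R}^{d+k}}|y|^\gamma|\nabla h'_{n,\eta}|^2-c_{d,s}\,g(\eta)\Big),$$ and in the logarithmic cases $$H_n(x_1,\dots,x_n)=n^2\mathcal{E}(\mu_V)+2n\sum_{i=1}^n\zeta(x_i)-\frac nd\log n+n\lim_{\eta\to0}\frac1{c_{d,s}}\Big(\frac1n\int_{\mathbb{R}^{d+k}}|y|^\gamma|\nabla h'_{n,\eta}|^2-c_{d,s}\,g(\eta)\Big).$$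
   Context: **Kernel.** $d\ge1$; either (Riesz case) $g(x)=|x|^{-s}$ with $\max(0,d-2)<s<d$, or $d\ge3$ and $s=d-2$; or (logarithmic cases) $g(x)=-\log|x|$ with $d=1$ or $d=2$, where by convention $s=0$. **Energies.** $H_n(x_1,\dots,x_n)=\sum_{i\ne j}g(x_i-x_j)+n\sum_iV(x_i)$; $\mathcal{E}(\mu)=\iint g(x-y)\,d\mu(x)d\mu(y)+\int V\,d\mu$. **Assumptions on $V$.** (V1) $V$ is l.s.c. and bounded below; (V2) $\{V<\infty\}$ has positive $g$-capacity (it carries a compactly supported probability measure of finite energy $\iint g(x-y)d\mu d\mu$); (V3) $V(x)\to+\infty$ as $|x|\to\infty$ in the Riesz case, resp. $\frac{V(x)}2-\log|x|\to+\infty$ in the logarithmic cases. Then $\mathcal{E}$ has a unique minimizer $\mu_V$ among probability measures, with compact support $\Sigma$. With $h^{\mu_V}=g*\mu_V$ and $c=\mathcal{E}(\mu_V)-\int\frac V2d\mu_V$, set $\zeta=h^{\mu_V}+\frac V2-c$; one has $\zeta\ge0$ quasi-everywhere and $\zeta=0$ quasi-everywhere on $\Sigma$. **Extension.** $k=1$, $\gamma=s-d+1$ if $\max(0,d-2)<s<d$; $k=1,\gamma=0$ for $g=-\log|x|$, $d=1$; $k=0,\gamma=0$ if $s=d-2,d\ge3$ or $g=-\log|x|$, $d=2$. Points of $\mathbb{R}^{d+k}$ are $X=(x,y)$; $\mathbb{R}^d\cong\mathbb{R}^d\times\{0\}$; $g(X)$ is the same function of $|X|$, and $g(\eta)$ is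 its value at $|X|=\eta$. $c_{d,s}>0$ is defined by $-\mathrm{div}(|y|^\gamma\nabla g)=c_{d,s}\delta_0$ in $\mathbb{R}^{d+k}$. When $k=0$, $|y|^\gamma$ means $1$. **Potentials.** $h_n(X)=\int g(X-(x,0))\,d\big(\sum_{i=1}^n\delta_{x_i}-n\mu_V\big)(x)$; $x_i'=n^{1/d}x_i$; $h_n'(X')=n^{-s/d}h_n(n^{-1/d}X')$; for $0<\eta<1$, $f_\eta(X)=(g(X)-g(\eta))_+$ and $h'_{n,\eta}(X)=h_n'(X)-\sum_{i=1}^nf_\eta(X-(x_i',0))$. *)

theory Defs
  imports "HOL-Probability.Probability"
begin

text \<open>
  Euclidean space of dimension \<open>d\<close> is a type \<open>'a::euclidean_space\<close> with \<open>d = DIM('a)\<close>. The extended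
  space is \<open>'a\<close> itself when \<open>k = 0\<close> and \<open>'a \<times> real\<close> when \<open>k = 1\<close>; notions that live on
  it take a type \<open>'e\<close>, the embedding \<open>\<iota> :: 'a \<Rightarrow> 'e\<close> and the weight
  \<open>w :: 'e \<Rightarrow> real\<close> standing for \<open>|y|^\<gamma>\<close>. The logarithmic kernel is \<open>s = 0\<close>, a value that no
  Riesz case takes.
\<close>

definition admissible_exponent :: "nat \<Rightarrow> real \<Rightarrow> bool" where
  "admissible_exponent d s \<longleftrightarrow>
     (max 0 (real d - 2) < s \<and> s < real d) \<or>
     (d \<ge> 3 \<and> s = real d - 2) \<or>
     (s = 0 \<and> (d = 1 \<or> d = 2))"

definition ext_dim :: "nat \<Rightarrow> real \<Rightarrow> nat" where
  "ext_dim d s =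
     (if (max 0 (real d - 2) < s \<and> s < real d) \<or> (s = 0 \<and> d = 1) then 1 else 0)"

text \<open>For \<open>d = 1\<close>, \<open>s = 0\<close> the first branch gives the required value \<open>0\<close>.\<close>

definition ext_weight_exponent :: "nat \<Rightarrow> real \<Rightarrow> real" where
  "ext_weight_exponent d s = (if ext_dim d s = 1 then s - real d + 1 else 0)"

section \<open>Kernel and energies\<close>

text \<open>The kernel as a function of the radius; only its values at \<open>r > 0\<close> are meaningful.\<close>

definition kernel_radial :: "real \<Rightarrow> real \<Rightarrow> real" where
  "kernel_radial s r = (if s = 0 then - ln r else r powr (- s))"

text \<open>In energies the kernel must be \<open>\<infinity>\<close> at the origin, so that measures with atoms have infinite
  energy.\<close>

definition kernel :: "real \<Rightarrow> 'a::euclidean_space \<Rightarrow> ereal" where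
  "kernel s z = (if z = 0 then \<infinity> else ereal (kernel_radial s (norm z)))"

text \<open>Integral of an extended real function as the difference of the integrals of its positive and
  negative parts. On \<^typ>\<open>ereal\<close> one has \<open>\<infinity> - \<infinity> = \<infinity>\<close> and \<open>-\<infinity> + \<infinity> = \<infinity>\<close>, so an undefined
  energy counts as \<open>\<infinity>\<close>; this can only concern logarithmic kernels and measures
  with infinite logarithmic moment, hence does not affect the minimizer.\<close>

definition ext_integral :: "'b measure \<Rightarrow> ('b \<Rightarrow> ereal) \<Rightarrow> ereal" where
  "ext_integral M f =
     enn2ereal (\<integral>\<^sup>+ z. e2ennreal (f z) \<partial>M) - enn2ereal (\<integral>\<^sup>+ z. e2ennreal (- f z) \<partial>M)"

definition borel_probability :: "'a::euclidean_space measure \<Rightarrow> bool" where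
  "borel_probability \<nu> \<longleftrightarrow> prob_space \<nu> \<and> sets \<nu> = sets borel"

definition interaction_energy :: "real \<Rightarrow> 'a::euclidean_space measure \<Rightarrow> ereal" where
  "interaction_energy s \<nu> = ext_integral (\<nu> \<Otimes>\<^sub>M \<nu>) (\<lambda>(z, z'). kernel s (z - z'))"

definition mean_field_energy :: "real \<Rightarrow> ('a::euclidean_space \<Rightarrow> ereal) \<Rightarrow> 'a measure \<Rightarrow> ereal" where
  "mean_field_energy s V \<nu> = interaction_energy s \<nu> + ext_integral \<nu> V"

definition hamiltonian ::
    "real \<Rightarrow> ('a::euclidean_space \<Rightarrow> ereal) \<Rightarrow> nat \<Rightarrow> (nat \<Rightarrow> 'a) \<Rightarrow> ereal" where
  "hamiltonian s V n x =
     (\<Sum>i\<in>{1..n}. \<Sum>j\<in>{1..n} - {i}. kernel s (x i - x j)) + ereal (real n) * (\<Sum>i\<in>{1..n}. V (x i))"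

section \<open>Assumptions on the external field\<close>

definition V1 :: "('a::euclidean_space \<Rightarrow> ereal) \<Rightarrow> bool" where
  "V1 V \<longleftrightarrow> (\<forall>a. open {z. a < V z}) \<and> (\<exists>m::real. \<forall>z. ereal m \<le> V z)"

definition V2 :: "real \<Rightarrow> ('a::euclidean_space \<Rightarrow> ereal) \<Rightarrow> bool" where
  "V2 s V \<longleftrightarrow>
     (\<exists>\<nu> K. borel_probability \<nu> \<and> compact K \<and> (AE z in \<nu>. z \<in> K \<and> V z < \<infinity>) \<and>
            interaction_energy s \<nu> < \<infinity>)"

definition V3 :: "real \<Rightarrow> ('a::euclidean_space \<Rightarrow> ereal) \<Rightarrow> bool" where
  "V3 s V \<longleftrightarrow>
     (if s = 0 then ((\<lambda>z. V z / 2 - ereal (ln (norm z))) \<longlongrightarrow> \<infinity>) at_infinity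
      else (V \<longlongrightarrow> \<infinity>) at_infinity)"

section \<open>Equilibrium measure\<close>

definition equilibrium_measure ::
    "real \<Rightarrow> ('a::euclidean_space \<Rightarrow> ereal) \<Rightarrow> 'a measure \<Rightarrow> bool" where
  "equilibrium_measure s V \<mu> \<longleftrightarrow>
     borel_probability \<mu> \<and>
     (\<forall>\<nu>. borel_probability \<nu> \<longrightarrow> mean_field_energy s V \<mu> \<le> mean_field_energy s V \<nu>)"

definition has_bounded_density :: "'a::euclidean_space measure \<Rightarrow> bool" where
  "has_bounded_density \<mu> \<longleftrightarrow>
     (\<exists>\<rho> \<in> borel_measurable borel. \<exists>M::real. (AE z in lborel. 0 \<le> \<rho> z \<and> \<rho> z \<le> M) \<and>
        \<mu> = density lborel (\<lambda>z. ennreal (\<rho> z)))"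

definition eq_potential :: "real \<Rightarrow> 'a::euclidean_space measure \<Rightarrow> 'a \<Rightarrow> ereal" where
  "eq_potential s \<mu> z = ext_integral \<mu> (\<lambda>z'. kernel s (z - z'))"

definition eq_constant :: "real \<Rightarrow> ('a::euclidean_space \<Rightarrow> ereal) \<Rightarrow> 'a measure \<Rightarrow> ereal" where
  "eq_constant s V \<mu> = mean_field_energy s V \<mu> - ext_integral \<mu> (\<lambda>z. V z / 2)"

definition eq_zeta :: "real \<Rightarrow> ('a::euclidean_space \<Rightarrow> ereal) \<Rightarrow> 'a measure \<Rightarrow> 'a \<Rightarrow> ereal" where
  "eq_zeta s V \<mu> z = eq_potential s \<mu> z + V z / 2 - eq_constant s V \<mu>"

section \<open>The constant $c_{d,s}$\<close>

text \<open>The pointwise gradient; its value where \<open>f\<close> is not differentiable is irrelevant, because the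
  functions below are differentiable almost everywhere and their distributional gradients are given
  by the pointwise ones.\<close>

definition grad :: "('e::euclidean_space \<Rightarrow> real) \<Rightarrow> 'e \<Rightarrow> 'e" where
  "grad f X = (THE D. GDERIV f X :> D)"

primrec times_cont_diff :: "nat \<Rightarrow> ('e::euclidean_space \<Rightarrow> real) \<Rightarrow> bool" where
  "times_cont_diff 0 f \<longleftrightarrow> continuous_on UNIV f"
| "times_cont_diff (Suc m) f \<longleftrightarrow>
     (\<forall>X. f differentiable at X) \<and>
     (\<forall>b\<in>Basis. times_cont_diff m (\<lambda>X. frechet_derivative f (at X) b))"

definition test_function :: "('e::euclidean_space \<Rightarrow> real) \<Rightarrow> bool" where
  "test_function \<phi> \<longleftrightarrow> (\<forall>m. times_cont_diff m \<phi>) \<and> compact (closure {X. \<phi> X \<noteq> 0})"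

text \<open>The constant \<open>c\<close> in \<open>- div (w \<nabla>g) = c \<delta>\<^sub>0\<close>, read in the sense of distributions.\<close>

definition flux_constant :: "('e::euclidean_space \<Rightarrow> real) \<Rightarrow> real \<Rightarrow> real" where
  "flux_constant w s =
     (THE c. \<forall>\<phi>. test_function \<phi> \<longrightarrow>
        (\<integral>X. w X * (grad (\<lambda>Y. kernel_radial s (norm Y)) X \<bullet> grad \<phi> X) \<partial>lebesgue) = c * \<phi> 0)"

definition c_const :: "'a::euclidean_space itself \<Rightarrow> real \<Rightarrow> real" where
  "c_const _ s =
     (if ext_dim DIM('a) s = 1
      then flux_constant (\<lambda>X::'a \<times> real. \<bar>snd X\<bar> powr ext_weight_exponent DIM('a) s) s
      else flux_constant (\<lambda>X::'a. 1) s)"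

section \<open>Truncated blown-up potentials\<close>

definition fluct_potential ::
    "('a::euclidean_space \<Rightarrow> 'e::euclidean_space) \<Rightarrow> real \<Rightarrow> 'a measure \<Rightarrow> nat \<Rightarrow> (nat \<Rightarrow> 'a) \<Rightarrow> 'e \<Rightarrow> real"
  where
  "fluct_potential \<iota> s \<mu> n x X =
     (\<Sum>i\<in>{1..n}. kernel_radial s (norm (X - \<iota> (x i))))
     - real n * (\<integral>z. kernel_radial s (norm (X - \<iota> z)) \<partial>\<mu>)"

definition blown_up_potential ::
    "('a::euclidean_space \<Rightarrow> 'e::euclidean_space) \<Rightarrow> real \<Rightarrow> 'a measure \<Rightarrow> nat \<Rightarrow> (nat \<Rightarrow> 'a) \<Rightarrow> 'e \<Rightarrow> real"
  where
  "blown_up_potential \<iota> s \<mu> n x X =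
     real n powr (- s / real DIM('a)) *
     fluct_potential \<iota> s \<mu> n x ((real n powr (- 1 / real DIM('a))) *\<^sub>R X)"

definition trunc_kernel :: "real \<Rightarrow> real \<Rightarrow> 'e::euclidean_space \<Rightarrow> real" where
  "trunc_kernel s \<eta> X = max 0 (kernel_radial s (norm X) - kernel_radial s \<eta>)"

definition trunc_potential ::
    "('a::euclidean_space \<Rightarrow> 'e::euclidean_space) \<Rightarrow> real \<Rightarrow> 'a measure \<Rightarrow> nat \<Rightarrow> (nat \<Rightarrow> 'a) \<Rightarrow>
     real \<Rightarrow> 'e \<Rightarrow> real" where
  "trunc_potential \<iota> s \<mu> n x \<eta> X =
     blown_up_potential \<iota> s \<mu> n x X
     - (\<Sum>i\<in>{1..n}. trunc_kernel s \<eta> (X - \<iota> ((real n powr (1 / real DIM('a))) *\<^sub>R x i)))"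

definition dirichlet_energy :: "('e::euclidean_space \<Rightarrow> real) \<Rightarrow> ('e \<Rightarrow> real) \<Rightarrow> ennreal" where
  "dirichlet_energy w h = (\<integral>\<^sup>+ X. ennreal (w X * (norm (grad h X))\<^sup>2) \<partial>lebesgue)"

definition trunc_energy ::
    "real \<Rightarrow> 'a::euclidean_space measure \<Rightarrow> nat \<Rightarrow> (nat \<Rightarrow> 'a) \<Rightarrow> real \<Rightarrow> ennreal" where
  "trunc_energy s \<mu> n x \<eta> =
     (if ext_dim DIM('a) s = 1
      then dirichlet_energy (\<lambda>X::'a \<times> real. \<bar>snd X\<bar> powr ext_weight_exponent DIM('a) s)
             (trunc_potential (\<lambda>z. (z, 0)) s \<mu> n x \<eta>)
      else dirichlet_energy (\<lambda>X::'a. 1) (trunc_potential (\<lambda>z. z) s \<mu> n x \<eta>))"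

end

theory Submission
  imports Defs
begin

text \<open>
  Up to a constant, the weighted flux density of the kernel in radial direction is
  \<open>K(X) = w(X) |X| powr (- s - 2)\<close>, which is homogeneous of degree minus the dimension of the extended
  space. Writing a decaying function as \<open>u(\<eta> X / |X|) = - \<integral> X \<bullet> \<nabla>u(t X) dt\<close> over \<open>t > \<eta> / |X|\<close>, averaging over
  the annulus \<open>1 < |X| \<le> 2\<close> with density \<open>K\<close> and substituting \<open>Y = t X\<close> shows that the integral of
  \<open>w \<nabla>g(\<sqdot> - a) \<bullet> \<nabla>u\<close> over \<open>|X - a| > \<eta>\<close> is a constant times the mean of \<open>u\<close> over the sphere of radius
  \<open>\<eta>\<close> about \<open>a\<close>. With \<open>\<eta> = 0\<close> and a test function \<open>u\<close> this identifies the constant as \<open>c\<^sub>d\<^sub>,\<^sub>s\<close>. With \<open>u\<close>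
  the truncated potential itself it turns the energy into the sum of the means of \<open>u\<close> around the points
  minus \<open>n\<close> times the integral of \<open>u\<close> against the equilibrium measure, and the limit \<open>\<eta> \<rightarrow> 0\<close> follows from
  the continuity of potentials of bounded densities. No integration by parts is needed. The decay of
  \<open>u\<close> uses that the equilibrium measure has compact support, which follows from its minimality.
\<close>

section \<open>The kernel and its gradient\<close>

text \<open>The obstacle is regularity. If k = 1, the gradient of the background potential may blow
  up on y = 0, exactly where all charges sit, and the truncated potential has kinks on the spheres
  of radius \<eta> about the points. But a ray issuing from a point of R^d either lies in y = 0 or
  meets it only at its origin, and it crosses the spheres finitely often. So the fundamental theorem
  of calculus on almost every ray asks only for continuity across the bad sets, and since the weight
  is invariant under translations along R^d, every charge can serve as the origin of the rays.
  Neutrality (n points against n times a probability measure) enters twice. It gains one power of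
  decay over a single kernel, which the logarithmic case cannot spare, and it cancels the additive
  constants that rescaling a logarithm produces inside the potential. The blow-up is carried out on
  the measure and the points themselves, so that the core argument contains no factor
  n^(1/d).\<close>

definition kernel_slope :: "real \<Rightarrow> real" where
  "kernel_slope s = (if s = 0 then 1 else s)"

definition kernel_grad :: "real \<Rightarrow> 'e::euclidean_space \<Rightarrow> 'e" where
  "kernel_grad s X = (- kernel_slope s * norm X powr (- s - 2)) *\<^sub>R X"

lemma kernel_slope_pos: "s \<ge> 0 \<Longrightarrow> kernel_slope s > 0"
  by (simp add: kernel_slope_def)

lemma kernel_radial_measurable [measurable]: "kernel_radial s \<in> borel_measurable borel"
  unfolding kernel_radial_def by measurable

lemma kernel_grad_measurable [measurable]:
  "kernel_grad s \<in> borel_measurable (borel :: 'e::euclidean_space measure)"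
  unfolding kernel_grad_def by measurable

text \<open>\<open>kernel_slope s\<close> is minus the derivative of the kernel at radius 1; with it
  one formula serves powers and the logarithm.\<close>

lemma kernel_radial_deriv:
  assumes "r > 0"
  shows "(kernel_radial s has_real_derivative - kernel_slope s * r powr (- s - 1)) (at r)"
proof (cases "s = 0")
  case True
  have "((\<lambda>r. - ln r) has_real_derivative - (1 / r)) (at r)"
    using assms by (auto intro!: derivative_eq_intros)
  moreover have "kernel_radial s = (\<lambda>r. - ln r)"
    by (auto simp: kernel_radial_def True)
  ultimately show ?thesis
    using assms by (simp add: True kernel_slope_def powr_minus_divide)
next
  case False
  have "((\<lambda>r. r powr (- s)) has_real_derivative - s * r powr (- s - 1)) (at r)"
    using has_real_derivative_powr[of r "- s"] assms by simp
  moreover have "kernel_radial s = (\<lambda>r. r powr (- s))"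
    by (auto simp: kernel_radial_def False)
  ultimately show ?thesis
    by (simp add: False kernel_slope_def)
qed

lemma kernel_radial_antimono:
  assumes "s \<ge> 0" "0 < p" "p \<le> q"
  shows "kernel_radial s q \<le> kernel_radial s p"
proof -
  have "- ln q \<le> - ln p" using assms by simp
  moreover have "q powr (- s) \<le> p powr (- s)" using assms by (intro powr_mono2') auto
  ultimately show ?thesis by (simp add: kernel_radial_def)
qed

lemma kernel_radial_diff_le:
  assumes "s \<ge> 0" "0 < m" "m \<le> p" "m \<le> q"
  shows "\<bar>kernel_radial s p - kernel_radial s q\<bar> \<le> kernel_slope s * m powr (- s - 1) * \<bar>p - q\<bar>"
proof -
  have "norm (kernel_radial s p - kernel_radial s q)
      \<le> (kernel_slope s * m powr (- s - 1)) * norm (p - q)"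
  proof (rule field_differentiable_bound[where S="{m..}"
        and f'="\<lambda>r. - kernel_slope s * r powr (- s - 1)"])
    fix r assume r: "r \<in> {m..}"
    show "(kernel_radial s has_real_derivative - kernel_slope s * r powr (- s - 1))
        (at r within {m..})"
      using r assms by (intro DERIV_subset[OF kernel_radial_deriv]) auto
    have "r powr (- s - 1) \<le> m powr (- s - 1)"
      using r assms by (intro powr_mono2') auto
    then show "norm (- kernel_slope s * r powr (- s - 1)) \<le> kernel_slope s * m powr (- s - 1)"
      using kernel_slope_pos[OF \<open>s \<ge> 0\<close>] by (simp add: abs_mult)
  qed (use assms in auto)
  then show ?thesis by simp
qed

lemma norm_kernel_grad:
  assumes "s \<ge> 0"
  shows "norm (kernel_grad s X) = kernel_slope s * norm X powr (- s - 1)"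
proof (cases "X = 0")
  case False
  have e: "- s - 1 = (- s - 2) + 1" by simp
  have "norm X powr (- s - 2) * norm X = norm X powr (- s - 1)"
    unfolding e powr_add using False by simp
  then show ?thesis
    using kernel_slope_pos[OF assms] by (simp add: kernel_grad_def)
qed (simp add: kernel_grad_def)

lemma kernel_grad_deriv:
  assumes "X \<noteq> (0 :: 'e::euclidean_space)"
  shows "GDERIV (\<lambda>Y. kernel_radial s (norm Y)) X :> kernel_grad s X"
proof -
  have "GDERIV norm X :> sgn X"
    using has_derivative_norm[OF assms] by (simp add: gderiv_def inner_commute sgn_div_norm)
  then have "GDERIV (\<lambda>Y. kernel_radial s (norm Y)) X :>
      (- kernel_slope s * norm X powr (- s - 1)) *\<^sub>R sgn X"
    using assms by (intro GDERIV_DERIV_compose kernel_radial_deriv) auto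
  moreover have e: "- s - 2 = (- s - 1) - 1" by simp
  have "norm X powr (- s - 1) / norm X = norm X powr (- s - 2)"
    unfolding e powr_diff using assms by simp
  then have "(- kernel_slope s * norm X powr (- s - 1)) *\<^sub>R sgn X = kernel_grad s X"
    by (simp add: kernel_grad_def sgn_div_norm divide_inverse mult.assoc)
  ultimately show ?thesis by simp
qed

lemma GDERIV_unique:
  assumes "GDERIV f X :> (D::'e::euclidean_space)" "GDERIV f X :> E"
  shows "D = E"
proof -
  have "(\<lambda>h. h \<bullet> D) = (\<lambda>h. h \<bullet> E)"
    using has_derivative_unique assms unfolding gderiv_def by blast
  then have "(D - E) \<bullet> D = (D - E) \<bullet> E" by metis
  then have "(D - E) \<bullet> (D - E) = 0" by (simp add: inner_diff_right)
  then show ?thesis by simp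
qed

lemma grad_eq: "GDERIV f X :> D \<Longrightarrow> grad f X = (D::'e::euclidean_space)"
  unfolding grad_def using GDERIV_unique by blast

lemma GDERIV_translate:
  assumes "GDERIV f (X - a) :> (D::'e::euclidean_space)"
  shows "GDERIV (\<lambda>Y. f (Y - a)) X :> D"
proof -
  have "((\<lambda>Y. Y - a) has_derivative (\<lambda>h. h)) (at X)"
    by (auto intro!: derivative_eq_intros)
  from has_derivative_compose[OF this] show ?thesis
    using assms unfolding gderiv_def by auto
qed

text \<open>Taking \<open>B\<close> as the shorter vector lets its length compensate exactly the
  extra inverse power from the mean value theorem. The constant s + 3 is 1 from the difference of
  the vectors plus s + 2 from the difference of the powers.\<close>

lemma kernel_grad_diff_le_aux:
  fixes A B :: "'e::euclidean_space"
  assumes s: "s \<ge> 0" and r: "0 < r" and AB: "r \<le> norm B" "norm B \<le> norm A"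
  shows "norm (kernel_grad s A - kernel_grad s B)
    \<le> kernel_slope s * (s + 3) * r powr (- s - 2) * norm (A - B)"
proof -
  define m where "m = norm B"
  have m: "m > 0" using r AB unfolding m_def by linarith
  have mean: "norm (norm A powr (- s - 2) - norm B powr (- s - 2))
      \<le> ((s + 2) * m powr (- s - 3)) * norm (norm A - norm B)"
  proof (rule field_differentiable_bound[where S="{m..}" and f'="\<lambda>r. (- s - 2) * r powr (- s - 2 - 1)"])
    fix t assume t: "t \<in> {m..}"
    show "((\<lambda>r. r powr (- s - 2)) has_real_derivative (- s - 2) * t powr (- s - 2 - 1)) (at t within {m..})"
      using t m by (intro DERIV_subset[OF has_real_derivative_powr]) auto
    have "t powr (- s - 3) \<le> m powr (- s - 3)"
      using t m s by (intro powr_mono2') auto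
    moreover have e: "- s - 2 - 1 = - s - 3" by simp
    have "norm ((- s - 2) * t powr (- s - 2 - 1)) = (s + 2) * t powr (- s - 3)"
      unfolding e using s by (simp add: abs_mult)
    ultimately show "norm ((- s - 2) * t powr (- s - 2 - 1)) \<le> (s + 2) * m powr (- s - 3)"
      using s by simp
  qed (use AB m_def in auto)
  have e: "- s - 2 = (- s - 3) + 1" by simp
  have pw: "m powr (- s - 3) * m = m powr (- s - 2)"
    unfolding e powr_add using m by simp
  have mr: "m powr (- s - 2) \<le> r powr (- s - 2)"
    using r AB s by (intro powr_mono2') (auto simp: m_def)
  have Ar: "norm A powr (- s - 2) \<le> r powr (- s - 2)"
    using r AB s by (intro powr_mono2') auto
  have "norm A powr (- s - 2) *\<^sub>R A - norm B powr (- s - 2) *\<^sub>R B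
      = norm A powr (- s - 2) *\<^sub>R (A - B) + (norm A powr (- s - 2) - norm B powr (- s - 2)) *\<^sub>R B"
    by (simp add: algebra_simps)
  then have "norm (norm A powr (- s - 2) *\<^sub>R A - norm B powr (- s - 2) *\<^sub>R B)
      \<le> norm A powr (- s - 2) * norm (A - B)
        + \<bar>norm A powr (- s - 2) - norm B powr (- s - 2)\<bar> * m"
    using norm_triangle_ineq[of "norm A powr (- s - 2) *\<^sub>R (A - B)"
      "(norm A powr (- s - 2) - norm B powr (- s - 2)) *\<^sub>R B"] by (simp add: m_def)
  also have "\<dots> \<le> r powr (- s - 2) * norm (A - B)
      + ((s + 2) * m powr (- s - 3) * norm (A - B)) * m"
  proof (intro add_mono mult_right_mono Ar)
    have "\<bar>norm A - norm B\<bar> \<le> norm (A - B)" by (rule norm_triangle_ineq3)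
    then have "(s + 2) * m powr (- s - 3) * \<bar>norm A - norm B\<bar> \<le> (s + 2) * m powr (- s - 3) * norm (A - B)"
      using s by (intro mult_left_mono) auto
    then show "\<bar>norm A powr (- s - 2) - norm B powr (- s - 2)\<bar> \<le> (s + 2) * m powr (- s - 3) * norm (A - B)"
      using mean by simp
  qed (use m in auto)
  also have "\<dots> = r powr (- s - 2) * norm (A - B) + (s + 2) * m powr (- s - 2) * norm (A - B)"
    by (simp add: pw[symmetric])
  also have "\<dots> \<le> r powr (- s - 2) * norm (A - B) + (s + 2) * r powr (- s - 2) * norm (A - B)"
    using mr s by (intro add_left_mono mult_right_mono mult_left_mono) auto
  also have "\<dots> = (s + 3) * r powr (- s - 2) * norm (A - B)"
    by (simp add: algebra_simps)
  finally have *: "norm (norm A powr (- s - 2) *\<^sub>R A - norm B powr (- s - 2) *\<^sub>R B)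
      \<le> (s + 3) * r powr (- s - 2) * norm (A - B)" .
  have "kernel_grad s A - kernel_grad s B
      = (- kernel_slope s) *\<^sub>R (norm A powr (- s - 2) *\<^sub>R A - norm B powr (- s - 2) *\<^sub>R B)"
    by (simp add: kernel_grad_def algebra_simps)
  then have "norm (kernel_grad s A - kernel_grad s B)
      = kernel_slope s * norm (norm A powr (- s - 2) *\<^sub>R A - norm B powr (- s - 2) *\<^sub>R B)"
    using kernel_slope_pos[OF s] by (metis norm_scaleR abs_minus_cancel abs_of_pos)
  also have "\<dots> \<le> kernel_slope s * ((s + 3) * r powr (- s - 2) * norm (A - B))"
    using kernel_slope_pos[OF s] * by (intro mult_left_mono) auto
  finally show ?thesis by (simp add: mult.assoc)
qed

lemma kernel_grad_diff_le:
  fixes A B :: "'e::euclidean_space"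
  assumes "s \<ge> 0" "0 < r" "r \<le> norm A" "r \<le> norm B"
  shows "norm (kernel_grad s A - kernel_grad s B)
    \<le> kernel_slope s * (s + 3) * r powr (- s - 2) * norm (A - B)"
  using kernel_grad_diff_le_aux[of s r B A] kernel_grad_diff_le_aux[of s r A B] assms
  by (cases "norm B \<le> norm A") (auto simp: norm_minus_commute)

text \<open>A power with exponent below the dimension that dominates the kernel near the origin.\<close>

definition kernel_order :: "real \<Rightarrow> real" where
  "kernel_order s = (if s = 0 then 1 / 2 else s)"

text \<open>For the logarithm, ln t \<le> t - 1 at t = r^(-1/2) suffices; the factor 2 undoes the
  square root, and the exponent 1/2 lies below every dimension.\<close>

lemma kernel_radial_le_powr:
  assumes "s \<ge> 0" "0 < r" "r \<le> 1"
  shows "0 \<le> kernel_radial s r" "kernel_radial s r \<le> 2 * r powr (- kernel_order s)"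
proof -
  show "0 \<le> kernel_radial s r" using assms by (simp add: kernel_radial_def)
  show "kernel_radial s r \<le> 2 * r powr (- kernel_order s)"
  proof (cases "s = 0")
    case True
    have "ln (r powr (- (1/2))) \<le> r powr (- (1/2)) - 1"
      using assms by (intro ln_le_minus_one) auto
    then have "- ln r \<le> 2 * r powr (- (1/2)) - 2" using assms by (simp add: ln_powr)
    then show ?thesis by (simp add: kernel_radial_def kernel_order_def True)
  qed (simp add: kernel_radial_def kernel_order_def)
qed

lemma kernel_radial_abs_le:
  assumes "s \<ge> 0" "0 < r"
  shows "\<bar>kernel_radial s r\<bar> \<le> 2 * r powr (- kernel_order s) + 1 + r"
proof (cases "r \<le> 1")
  case True
  then show ?thesis using kernel_radial_le_powr[OF assms True] assms by simp
next
  case False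
  then have "\<bar>kernel_radial s r\<bar> \<le> 1 + r"
  proof (cases "s = 0")
    case True
    then show ?thesis using False ln_le_minus_one[of r] by (simp add: kernel_radial_def)
  next
    case s: False
    have "r powr (- s) \<le> r powr 0" using False assms by (intro powr_mono) auto
    then show ?thesis using s False by (simp add: kernel_radial_def)
  qed
  then show ?thesis by (smt (verit) powr_ge_zero)
qed

text \<open>At r = 0 both powers are 0 by convention and the rule survives, whereas
  \<open>ln 0 = 0\<close> would break it; hence the condition on r.\<close>

lemma kernel_radial_scale:
  assumes "t > 0" "r > 0 \<or> s \<noteq> 0" "r \<ge> 0"
  shows "kernel_radial s (t * r) =
    (if s = 0 then kernel_radial s r - ln t else t powr (- s) * kernel_radial s r)"
  using assms by (auto simp: kernel_radial_def ln_mult powr_mult)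

text \<open>Because the kernel decreases, subtracting the truncation freezes it at radius \<eta>.
  The centre is excluded since \<open>kernel_radial\<close> has only a default value at 0.\<close>

lemma trunc_kernel_max:
  assumes "s \<ge> 0" "\<eta> > 0" "X \<noteq> 0"
  shows "kernel_radial s (norm X) - trunc_kernel s \<eta> X = kernel_radial s (max \<eta> (norm X))"
  using kernel_radial_antimono[of s \<eta> "norm X"] kernel_radial_antimono[of s "norm X" \<eta>] assms
  by (cases "norm X \<le> \<eta>") (auto simp: trunc_kernel_def max_def)

section \<open>Homogeneous weights\<close>

lemma ball_borel [measurable]: "ball a r \<in> sets borel"
  by simp

lemma nn_integral_lborel_scaleR:
  fixes f :: "'e::euclidean_space \<Rightarrow> ennreal"
  assumes [measurable]: "f \<in> borel_measurable borel" and c: "c > 0"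
  shows "(\<integral>\<^sup>+ X. f (c *\<^sub>R X) \<partial>lborel) = ennreal (c powr (- real DIM('e))) * (\<integral>\<^sup>+ X. f X \<partial>lborel)"
proof -
  have "(\<integral>\<^sup>+ X. f X \<partial>lborel)
      = (\<integral>\<^sup>+ X. f X \<partial>density (distr lborel borel (\<lambda>x. 0 + c *\<^sub>R x)) (\<lambda>_. \<bar>c\<bar>^DIM('e)))"
    using c by (subst lborel_affine[of c 0]) auto
  also have "\<dots> = ennreal (c ^ DIM('e)) * (\<integral>\<^sup>+ X. f (c *\<^sub>R X) \<partial>lborel)"
    using c by (simp add: nn_integral_density nn_integral_distr nn_integral_cmult)
  finally have "ennreal (c powr (- real DIM('e))) * (\<integral>\<^sup>+ X. f X \<partial>lborel)
      = ennreal (c powr (- real DIM('e)) * c ^ DIM('e)) * (\<integral>\<^sup>+ X. f (c *\<^sub>R X) \<partial>lborel)"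
    using c by (simp add: ennreal_mult mult.assoc)
  also have "c powr (- real DIM('e)) * c ^ DIM('e) = 1"
    using c by (simp add: powr_minus powr_realpow)
  finally show ?thesis by simp
qed

lemma lborel_integral_scaleR:
  fixes f :: "'e::euclidean_space \<Rightarrow> real"
  assumes [measurable]: "f \<in> borel_measurable borel" and c: "c > 0"
  shows "(\<integral> X. f (c *\<^sub>R X) \<partial>lborel) = c powr (- real DIM('e)) * (\<integral> X. f X \<partial>lborel)"
proof -
  have "(\<integral> X. f X \<partial>lborel)
      = (\<integral> X. f X \<partial>density (distr lborel borel (\<lambda>x. 0 + c *\<^sub>R x)) (\<lambda>_. \<bar>c\<bar>^DIM('e)))"
    using c by (subst lborel_affine[of c 0]) auto
  also have "\<dots> = c ^ DIM('e) * (\<integral> X. f (c *\<^sub>R X) \<partial>lborel)"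
    using c by (simp add: integral_real_density integral_distr)
  finally show ?thesis
    using c by (simp add: powr_minus powr_realpow)
qed

lemma nn_integral_lborel_translate:
  fixes f :: "'e::euclidean_space \<Rightarrow> ennreal"
  assumes [measurable]: "f \<in> borel_measurable borel"
  shows "(\<integral>\<^sup>+ X. f (X + a) \<partial>lborel) = (\<integral>\<^sup>+ X. f X \<partial>lborel)"
proof -
  have "(\<integral>\<^sup>+ X. f X \<partial>lborel) = (\<integral>\<^sup>+ X. f X \<partial>distr lborel borel ((+) a))"
    by (simp add: lborel_distr_plus)
  then show ?thesis by (simp add: nn_integral_distr add.commute)
qed

lemma lborel_integral_translate:
  fixes f :: "'e::euclidean_space \<Rightarrow> real"
  assumes [measurable]: "f \<in> borel_measurable borel"
  shows "(\<integral> X. f (X + a) \<partial>lborel) = (\<integral> X. f X \<partial>lborel)"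
proof -
  have "(\<integral> X. f X \<partial>lborel) = (\<integral> X. f X \<partial>distr lborel borel ((+) a))"
    by (simp add: lborel_distr_plus)
  then show ?thesis by (simp add: integral_distr add.commute)
qed

lemma lborel_integrable_translate:
  fixes f :: "'e::euclidean_space \<Rightarrow> real"
  assumes "integrable lborel f"
  shows "integrable lborel (\<lambda>X. f (X + a))"
proof -
  have [measurable]: "f \<in> borel_measurable borel"
    using borel_measurable_integrable[OF assms] by simp
  have "integrable (distr lborel borel ((+) a)) f"
    using assms by (simp add: lborel_distr_plus)
  then show ?thesis by (simp add: integrable_distr_eq add.commute)
qed

section \<open>Integrals of powers against homogeneous weights\<close>

lemma nn_integral_powr_from_0:
  assumes "a > - 1" "c \<ge> 0"
  shows "(\<integral>\<^sup>+ r. ennreal (indicator {0<..c} r * r powr a) \<partial>lborel) < \<infinity>"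
proof -
  have "(\<integral>\<^sup>+ r. ennreal (indicator {0<..c} r * r powr a) \<partial>lborel)
     \<le> (\<integral>\<^sup>+ r. ennreal (indicator {0..c} r * r powr a) \<partial>lborel)"
    by (intro nn_integral_mono ennreal_leI) (auto simp: indicator_def)
  also have "\<dots> = ennreal (c powr (a + 1) / (a + 1))"
    using nn_integral_has_integral_lebesgue[OF _ has_integral_powr_from_0[OF assms]] by simp
  finally show ?thesis by (rule order.strict_trans1) simp
qed

lemma nn_integral_powr_to_inf:
  assumes "a < - 1" "c > 0"
  shows "(\<integral>\<^sup>+ r. ennreal (indicator {c<..} r * r powr a) \<partial>lborel) < \<infinity>"
proof -
  have "(\<integral>\<^sup>+ r. ennreal (indicator {c<..} r * r powr a) \<partial>lborel)
     \<le> (\<integral>\<^sup>+ r. ennreal (indicator {c..} r * r powr a) \<partial>lborel)"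
    by (intro nn_integral_mono ennreal_leI) (auto simp: indicator_def)
  also have "\<dots> = ennreal (- (c powr (a + 1)) / (a + 1))"
    using nn_integral_has_integral_lebesgue[OF _ has_integral_powr_to_inf[OF assms]] by simp
  finally show ?thesis by (rule order.strict_trans1) simp
qed

text \<open>Covers the constant weight and the powers of the height at once. Positivity almost
  everywhere makes the annulus mass positive and allows division by the flux density along almost
  every ray.\<close>

locale homogeneous_weight =
  fixes w :: "'e::euclidean_space \<Rightarrow> real" and p :: real
  assumes w_measurable [measurable]: "w \<in> borel_measurable borel"
    and w_nonneg: "0 \<le> w X"
    and w_scale: "t > 0 \<Longrightarrow> w (t *\<^sub>R X) = t powr p * w X"
    and w_ball: "(\<integral>\<^sup>+ X. ennreal (w X) * indicator (ball 0 1) X \<partial>lborel) < \<infinity>"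
    and w_pos: "AE X in lborel. 0 < w X"
begin

text \<open>The dimension seen by integration against \<open>w\<close>: balls about 0 have weight
  proportional to \<open>r powr hdim\<close>.\<close>

definition hdim :: real where
  "hdim = p + real DIM('e)"

lemma nn_integral_weight_ball:
  assumes "r > 0"
  shows "(\<integral>\<^sup>+ X. ennreal (w X) * indicator (ball 0 r) X \<partial>lborel)
    = ennreal (r powr hdim) * (\<integral>\<^sup>+ X. ennreal (w X) * indicator (ball 0 1) X \<partial>lborel)"
proof -
  have eq: "ennreal (w (r *\<^sub>R X)) * indicator (ball 0 r) (r *\<^sub>R X)
      = ennreal (r powr p) * (ennreal (w X) * indicator (ball 0 1) X)" for X
    using assms by (auto simp: w_scale ennreal_mult w_nonneg indicator_def dist_norm)
  have "ennreal (r powr (- real DIM('e))) * (\<integral>\<^sup>+ X. ennreal (w X) * indicator (ball 0 r) X \<partial>lborel)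
      = (\<integral>\<^sup>+ X. ennreal (w (r *\<^sub>R X)) * indicator (ball 0 r) (r *\<^sub>R X) \<partial>lborel)"
    using assms by (intro nn_integral_lborel_scaleR[symmetric]) measurable
  also have "\<dots> = ennreal (r powr p) * (\<integral>\<^sup>+ X. ennreal (w X) * indicator (ball 0 1) X \<partial>lborel)"
    unfolding eq by (intro nn_integral_cmult) auto
  finally have "ennreal (r powr real DIM('e)) * (ennreal (r powr (- real DIM('e))) *
        (\<integral>\<^sup>+ X. ennreal (w X) * indicator (ball 0 r) X \<partial>lborel))
      = ennreal (r powr real DIM('e)) * (ennreal (r powr p) *
        (\<integral>\<^sup>+ X. ennreal (w X) * indicator (ball 0 1) X \<partial>lborel))"
    by simp
  then show ?thesis
    using assms by (simp add: mult.assoc[symmetric] ennreal_mult[symmetric] powr_add[symmetric] hdim_def add.commute)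
qed

text \<open>A substitute for polar coordinates: \<rho>^(-\<alpha>) is dominated by a multiple of the
  integral of r^(-\<alpha>-1) over \<rho> < r \<le> 2 \<rho>. After exchanging the integrals, the
  inner one is the weight of a ball, which homogeneity gives exactly. \<open>J\<close> only has to
  contain these intervals for all radii in \<open>I\<close>.\<close>

lemma nn_integral_weight_powr_le:
  assumes \<alpha>: "\<alpha> \<ge> 0" and I: "I \<subseteq> {0<..}" "I \<in> sets borel" and J: "J \<subseteq> {0<..}" "J \<in> sets borel"
    and IJ: "\<And>\<rho> r. \<rho> \<in> I \<Longrightarrow> \<rho> < r \<Longrightarrow> r \<le> 2 * \<rho> \<Longrightarrow> r \<in> J"
  shows "(\<integral>\<^sup>+ X. ennreal (w X * norm X powr (- \<alpha>)) * indicator I (norm X) \<partial>lborel)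
    \<le> ennreal (2 powr (\<alpha> + 1)) * (\<integral>\<^sup>+ X. ennreal (w X) * indicator (ball 0 1) X \<partial>lborel)
      * (\<integral>\<^sup>+ r. ennreal (indicator J r * r powr (hdim - \<alpha> - 1)) \<partial>lborel)"
    (is "?L \<le> ennreal ?c * ?W * ?K")
proof -
  note [measurable] = I(2) J(2)
  have pointwise: "ennreal (norm X powr (- \<alpha>)) * indicator I (norm X)
      \<le> ennreal ?c * (\<integral>\<^sup>+ r. ennreal (indicator J r * r powr (- \<alpha> - 1)) * indicator (ball 0 r) X \<partial>lborel)"
    for X :: 'e
  proof (cases "norm X \<in> I")
    case True
    define \<rho> where "\<rho> = norm X"
    have \<rho>: "\<rho> > 0" "\<rho> \<in> I" using True I by (auto simp: \<rho>_def)
    \<comment> \<open>The integrand is smallest at r = 2 \<rho> and the interval has length \<rho>;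
      the constant 2^(\<alpha>+1) makes up for that smallest value.\<close>
    have "ennreal (\<rho> powr (- \<alpha>)) = ennreal ?c * ennreal ((2 * \<rho>) powr (- \<alpha> - 1) * \<rho>)"
    proof -
      have "(2 * \<rho>) powr (- \<alpha> - 1) = 2 powr (- (\<alpha> + 1)) * \<rho> powr (- \<alpha> - 1)"
        using \<rho> by (simp add: powr_mult)
      moreover have "2 powr (\<alpha> + 1) * 2 powr (- (\<alpha> + 1)) = (1::real)"
        by (simp add: powr_add[symmetric] del: minus_add_distrib)
      moreover have "\<rho> powr (- \<alpha>) = \<rho> powr (- \<alpha> - 1) * \<rho>"
        using powr_add[of \<rho> "- \<alpha> - 1" 1] \<rho> by simp
      ultimately have "?c * ((2 * \<rho>) powr (- \<alpha> - 1) * \<rho>) = \<rho> powr (- \<alpha>)"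
        by (metis mult.assoc mult_1)
      then show ?thesis using \<rho> by (simp add: ennreal_mult[symmetric])
    qed
    also have "ennreal ((2 * \<rho>) powr (- \<alpha> - 1) * \<rho>)
        = (\<integral>\<^sup>+ r. ennreal ((2 * \<rho>) powr (- \<alpha> - 1)) * indicator {\<rho><..2 * \<rho>} r \<partial>lborel)"
      using \<rho> by (subst nn_integral_cmult_indicator) (auto simp: ennreal_mult)
    also have "\<dots> \<le> (\<integral>\<^sup>+ r. ennreal (indicator J r * r powr (- \<alpha> - 1)) * indicator (ball 0 r) X \<partial>lborel)"
    proof (rule nn_integral_mono)
      fix r
      show "ennreal ((2 * \<rho>) powr (- \<alpha> - 1)) * indicator {\<rho><..2 * \<rho>} r
          \<le> ennreal (indicator J r * r powr (- \<alpha> - 1)) * indicator (ball 0 r) X"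
      proof (cases "r \<in> {\<rho><..2 * \<rho>}")
        case r: True
        then have "(2 * \<rho>) powr (- \<alpha> - 1) \<le> r powr (- \<alpha> - 1)"
          using \<rho> \<alpha> by (intro powr_mono2') auto
        moreover have "r \<in> J" using IJ[of \<rho> r] r \<rho> by auto
        ultimately show ?thesis using r by (auto simp: \<rho>_def intro!: ennreal_leI)
      qed auto
    qed
    finally show ?thesis using \<rho> by (simp add: \<rho>_def mult_left_mono)
  qed auto
  have "?L = (\<integral>\<^sup>+ X. ennreal (w X) * (ennreal (norm X powr (- \<alpha>)) * indicator I (norm X)) \<partial>lborel)"
    by (simp add: ennreal_mult w_nonneg mult.assoc)
  also have "\<dots> \<le> (\<integral>\<^sup>+ X. ennreal (w X) * (ennreal ?c * (\<integral>\<^sup>+ r. ennreal (indicator J r * r powr (- \<alpha> - 1))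
      * indicator (ball 0 r) X \<partial>lborel)) \<partial>lborel)"
    by (intro nn_integral_mono mult_left_mono pointwise) auto
  also have "\<dots> = (\<integral>\<^sup>+ X. (\<integral>\<^sup>+ r. ennreal ?c * ennreal (w X) * (ennreal (indicator J r * r powr (- \<alpha> - 1))
      * indicator {0<..} (r - norm X)) \<partial>lborel) \<partial>lborel)"
  proof (rule nn_integral_cong)
    fix X :: 'e
    have *: "indicator (ball 0 r) X = (indicator {0<..} (r - norm X) :: ennreal)" for r
      by (simp add: indicator_def)
    have "(\<integral>\<^sup>+ r. ennreal ?c * ennreal (w X) * (ennreal (indicator J r * r powr (- \<alpha> - 1))
        * indicator {0<..} (r - norm X)) \<partial>lborel) = ennreal ?c * ennreal (w X) *
        (\<integral>\<^sup>+ r. ennreal (indicator J r * r powr (- \<alpha> - 1)) * indicator {0<..} (r - norm X) \<partial>lborel)"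
      by (rule nn_integral_cmult) measurable
    then show "ennreal (w X) * (ennreal ?c * (\<integral>\<^sup>+ r. ennreal (indicator J r * r powr (- \<alpha> - 1))
        * indicator (ball 0 r) X \<partial>lborel))
      = (\<integral>\<^sup>+ r. ennreal ?c * ennreal (w X) * (ennreal (indicator J r * r powr (- \<alpha> - 1))
        * indicator {0<..} (r - norm X)) \<partial>lborel)"
      unfolding * by (simp only: mult_ac)
  qed
  also have "\<dots> = (\<integral>\<^sup>+ r. (\<integral>\<^sup>+ X. ennreal ?c * ennreal (w X) * (ennreal (indicator J r * r powr (- \<alpha> - 1))
      * indicator {0<..} (r - norm X)) \<partial>lborel) \<partial>lborel)"
    by (rule lborel_pair.Fubini') measurable
  also have "\<dots> = (\<integral>\<^sup>+ r. ennreal ?c * ?W * ennreal (indicator J r * r powr (hdim - \<alpha> - 1)) \<partial>lborel)"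
  proof (rule nn_integral_cong)
    fix r :: real
    show "(\<integral>\<^sup>+ X. ennreal ?c * ennreal (w X) * (ennreal (indicator J r * r powr (- \<alpha> - 1))
      * indicator {0<..} (r - norm X)) \<partial>lborel) = ennreal ?c * ?W * ennreal (indicator J r * r powr (hdim - \<alpha> - 1))"
    proof (cases "r \<in> J")
      case True
      then have r: "r > 0" using J by auto
      have "(\<integral>\<^sup>+ X. ennreal ?c * ennreal (w X) * (ennreal (indicator J r * r powr (- \<alpha> - 1))
          * indicator {0<..} (r - norm X)) \<partial>lborel)
        = (\<integral>\<^sup>+ X. ennreal ?c * ennreal (r powr (- \<alpha> - 1)) * (ennreal (w X) * indicator (ball 0 r) X) \<partial>lborel)"
        using True by (intro nn_integral_cong) (auto simp: indicator_def mult_ac)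
      also have "\<dots> = ennreal ?c * ennreal (r powr (- \<alpha> - 1)) * (ennreal (r powr hdim) * ?W)"
        unfolding nn_integral_weight_ball[OF r, symmetric] by (rule nn_integral_cmult) measurable
      also have "\<dots> = ennreal ?c * ?W * ennreal (r powr (- \<alpha> - 1) * r powr hdim)"
        by (simp add: ennreal_mult mult_ac)
      also have "r powr (- \<alpha> - 1) * r powr hdim = r powr (hdim - \<alpha> - 1)"
        by (simp add: powr_add[symmetric] algebra_simps)
      finally show ?thesis using True by simp
    qed simp
  qed
  also have "\<dots> = ennreal ?c * ?W * ?K"
    by (intro nn_integral_cmult) measurable
  finally show ?thesis .
qed

lemma weight_powr_small:
  assumes "0 \<le> \<alpha>" "\<alpha> < hdim" "R > 0"
  shows "(\<integral>\<^sup>+ X. ennreal (w X * norm X powr (- \<alpha>)) * indicator (ball 0 R) X \<partial>lborel) < \<infinity>"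
proof -
  have "(\<integral>\<^sup>+ X. ennreal (w X * norm X powr (- \<alpha>)) * indicator (ball 0 R) X \<partial>lborel)
      = (\<integral>\<^sup>+ X. ennreal (w X * norm X powr (- \<alpha>)) * indicator {0<..<R} (norm X) \<partial>lborel)"
    by (intro nn_integral_cong) (auto simp: indicator_def)
  also have "\<dots> \<le> ennreal (2 powr (\<alpha> + 1)) * (\<integral>\<^sup>+ X. ennreal (w X) * indicator (ball 0 1) X \<partial>lborel)
      * (\<integral>\<^sup>+ r. ennreal (indicator {0<..2 * R} r * r powr (hdim - \<alpha> - 1)) \<partial>lborel)"
    using assms by (intro nn_integral_weight_powr_le) auto
  also have "\<dots> < \<infinity>"
    using nn_integral_powr_from_0[of "hdim - \<alpha> - 1" "2 * R"] assms w_ball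
    by (auto simp: ennreal_mult_less_top)
  finally show ?thesis .
qed

lemma weight_powr_large:
  assumes "0 \<le> \<alpha>" "hdim < \<alpha>" "R > 0"
  shows "(\<integral>\<^sup>+ X. ennreal (w X * norm X powr (- \<alpha>)) * indicator (- ball 0 R) X \<partial>lborel) < \<infinity>"
proof -
  have "(\<integral>\<^sup>+ X. ennreal (w X * norm X powr (- \<alpha>)) * indicator (- ball 0 R) X \<partial>lborel)
      = (\<integral>\<^sup>+ X. ennreal (w X * norm X powr (- \<alpha>)) * indicator {R..} (norm X) \<partial>lborel)"
    by (intro nn_integral_cong) (auto simp: indicator_def)
  also have "\<dots> \<le> ennreal (2 powr (\<alpha> + 1)) * (\<integral>\<^sup>+ X. ennreal (w X) * indicator (ball 0 1) X \<partial>lborel)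
      * (\<integral>\<^sup>+ r. ennreal (indicator {R<..} r * r powr (hdim - \<alpha> - 1)) \<partial>lborel)"
    using assms by (intro nn_integral_weight_powr_le) auto
  also have "\<dots> < \<infinity>"
    using nn_integral_powr_to_inf[of "hdim - \<alpha> - 1" "R"] assms w_ball
    by (auto simp: ennreal_mult_less_top)
  finally show ?thesis .
qed

end

lemma homogeneous_weight_1: "homogeneous_weight (\<lambda>X::'e::euclidean_space. 1) 0"
proof
  have "emeasure lborel (ball 0 1 :: 'e set) < \<infinity>"
    by (rule emeasure_bounded_finite) simp
  then show "(\<integral>\<^sup>+ X. ennreal 1 * indicator (ball 0 1) (X::'e) \<partial>lborel) < \<infinity>"
    by simp
qed auto

section \<open>The flux identity\<close>

text \<open>Exhaustion by compact intervals and dominated convergence. At the left end only a limit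
  of \<open>F\<close> is asked for, because \<open>f\<close> may be singular there when the ray
  starts at a charge.\<close>

lemma integral_Ioi_FTC:
  fixes F f :: "real \<Rightarrow> real"
  assumes int: "integrable lborel (\<lambda>t. indicator {a<..} t * f t)"
    and ftc: "\<And>p q. a < p \<Longrightarrow> p \<le> q \<Longrightarrow> (f has_integral (F q - F p)) {p..q}"
    and A: "(F \<longlongrightarrow> A) (at_right a)" and B: "(F \<longlongrightarrow> B) at_top"
  shows "(\<integral>t. indicator {a<..} t * f t \<partial>lborel) = B - A"
proof -
  define p where "p k = a + 1 / real (Suc k)" for k
  define q where "q k = a + 1 + real k" for k
  have pq: "a < p k" "p k \<le> q k" for k
    by (auto simp: p_def q_def field_simps)
  have eq: "(\<integral>t. indicator {p k..q k} t * f t \<partial>lborel) = F (q k) - F (p k)" for k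
  proof -
    have "integrable lborel (\<lambda>t. indicator {p k..q k} t *\<^sub>R (indicator {a<..} t * f t))"
      by (intro integrable_mult_indicator int) simp
    moreover have "(\<lambda>t. indicator {p k..q k} t *\<^sub>R (indicator {a<..} t * f t))
        = (\<lambda>t. indicator {p k..q k} t *\<^sub>R f t)"
      using pq[of k] by (auto simp: indicator_def fun_eq_iff)
    ultimately have "set_integrable lborel {p k..q k} f"
      by (simp add: set_integrable_def)
    from set_borel_integral_eq_integral(2)[OF this] show ?thesis
      using integral_unique[OF ftc[OF pq, of k]] by (simp add: set_lebesgue_integral_def)
  qed
  have p_lim: "filterlim p (at_right a) sequentially"
  proof -
    have "p \<longlonglongrightarrow> a + 0"
      unfolding p_def by (intro tendsto_intros LIMSEQ_Suc[OF lim_1_over_n])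
    then show ?thesis
      using pq(1) by (auto simp: filterlim_at intro!: eventuallyI less_imp_neq[symmetric])
  qed
  have q_lim: "filterlim q at_top sequentially"
    unfolding q_def by (intro filterlim_tendsto_add_at_top[OF tendsto_const] filterlim_real_sequentially)
  have "(\<lambda>k. \<integral>t. indicator {p k..q k} t * f t \<partial>lborel)
      \<longlonglongrightarrow> (\<integral>t. indicator {a<..} t * f t \<partial>lborel)"
  proof (rule integral_dominated_convergence[where w="\<lambda>t. \<bar>indicator {a<..} t * f t\<bar>"])
    show m: "(\<lambda>t. indicator {a<..} t * f t) \<in> borel_measurable lborel"
      using int by (rule borel_measurable_integrable)
    have "(\<lambda>t. indicator {p k..q k} t * (indicator {a<..} t * f t)) \<in> borel_measurable lborel" for k
      using m by measurable
    moreover have "(\<lambda>t. indicator {p k..q k} t * (indicator {a<..} t * f t))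
        = (\<lambda>t. indicator {p k..q k} t * f t)" for k
      using pq[of k] by (auto simp: indicator_def fun_eq_iff)
    ultimately show "(\<lambda>t. indicator {p k..q k} t * f t) \<in> borel_measurable lborel" for k
      by simp
    show "integrable lborel (\<lambda>t. \<bar>indicator {a<..} t * f t\<bar>)"
      using int by simp
    show "AE t in lborel. norm (indicator {p k..q k} t * f t) \<le> \<bar>indicator {a<..} t * f t\<bar>" for k
      using pq[of k] by (intro AE_I2) (auto simp: indicator_def)
    show "AE t in lborel. (\<lambda>k. indicator {p k..q k} t * f t) \<longlonglongrightarrow> indicator {a<..} t * f t"
    proof (intro AE_I2)
      fix t
      have "\<forall>\<^sub>F k in sequentially. indicator {p k..q k} t = (indicator {a<..} t :: real)"
      proof (cases "a < t")
        case True
        have "\<forall>\<^sub>F k in sequentially. p k < t"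
          using order_tendstoD(2)[OF filterlim_mono[OF p_lim _ order_refl] True] by (simp add: at_within_def)
        moreover have "\<forall>\<^sub>F k in sequentially. t \<le> q k"
          using q_lim by (simp add: filterlim_at_top)
        ultimately show ?thesis
          by eventually_elim (auto simp: True)
      next
        case False
        then have "t \<notin> {p k..q k}" for k using pq[of k] by auto
        then show ?thesis using False by (simp add: indicator_def)
      qed
      then have "\<forall>\<^sub>F k in sequentially. indicator {p k..q k} t * f t = indicator {a<..} t * f t"
        by eventually_elim simp
      then show "(\<lambda>k. indicator {p k..q k} t * f t) \<longlonglongrightarrow> indicator {a<..} t * f t"
        by (rule tendsto_eventually)
    qed
  qed
  moreover have "(\<lambda>k. F (q k) - F (p k)) \<longlonglongrightarrow> B - A"
    by (intro tendsto_diff filterlim_compose[OF A p_lim] filterlim_compose[OF B q_lim])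
  ultimately show ?thesis
    unfolding eq by (rule LIMSEQ_unique)
qed

lemma lborel_integrable_scaleR:
  fixes f :: "'e::euclidean_space \<Rightarrow> real"
  assumes f: "integrable lborel f" and c: "c > 0"
  shows "integrable lborel (\<lambda>X. f (c *\<^sub>R X))"
proof -
  have [measurable]: "f \<in> borel_measurable borel"
    using borel_measurable_integrable[OF f] by simp
  have "(\<integral>\<^sup>+ X. ennreal (norm (f (c *\<^sub>R X))) \<partial>lborel)
      = ennreal (c powr (- real DIM('e))) * (\<integral>\<^sup>+ X. ennreal (norm (f X)) \<partial>lborel)"
    using c by (intro nn_integral_lborel_scaleR[where f="\<lambda>X. ennreal (norm (f X))"]) auto
  also have "\<dots> < \<infinity>"
    using f by (auto simp: integrable_iff_bounded ennreal_mult_less_top)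
  finally show ?thesis
    by (auto simp: integrable_iff_bounded)
qed

context homogeneous_weight
begin

definition flux_density :: "'e \<Rightarrow> real" where
  "flux_density X = w X * norm X powr (- hdim)"

definition unit_annulus :: "'e set" where
  "unit_annulus = {X. 1 < norm X \<and> norm X \<le> 2}"

definition annulus_mass :: real where
  "annulus_mass = (\<integral>X. indicator unit_annulus X * flux_density X \<partial>lborel)"

text \<open>The weight on the sphere is written through the homogeneous density on an annulus, so that no
  surface measure is needed.\<close>

definition sphere_mean :: "real \<Rightarrow> ('e \<Rightarrow> real) \<Rightarrow> 'e \<Rightarrow> real" where
  "sphere_mean \<eta> \<phi> a =
     (\<integral>X. indicator unit_annulus X * flux_density X * \<phi> (a + (\<eta> / norm X) *\<^sub>R X) \<partial>lborel) / annulus_mass"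

lemma flux_density_measurable [measurable]: "flux_density \<in> borel_measurable borel"
  unfolding flux_density_def by measurable

lemma unit_annulus_measurable [measurable]: "unit_annulus \<in> sets borel"
  unfolding unit_annulus_def by measurable

lemma flux_density_nonneg: "0 \<le> flux_density X"
  by (simp add: flux_density_def w_nonneg)

lemma flux_density_scale:
  assumes "t > 0"
  shows "flux_density (t *\<^sub>R X) = t powr (- real DIM('e)) * flux_density X"
proof -
  have "flux_density (t *\<^sub>R X) = (t powr p * t powr (- hdim)) * flux_density X"
    using assms by (simp add: flux_density_def w_scale powr_mult)
  then show ?thesis by (simp add: powr_add[symmetric] hdim_def)
qed

lemma annulus_integrable: "integrable lborel (\<lambda>X. indicator unit_annulus X * flux_density X)"
proof (rule integrableI_bounded)
  have "norm X powr (- hdim) \<le> max 1 (2 powr (- hdim))" if "X \<in> unit_annulus" for X :: 'e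
  proof (cases "hdim \<ge> 0")
    case True
    then have "norm X powr (- hdim) \<le> 1 powr (- hdim)"
      using that by (intro powr_mono2') (auto simp: unit_annulus_def)
    then show ?thesis by simp
  next
    case False
    then have "norm X powr (- hdim) \<le> 2 powr (- hdim)"
      using that by (intro powr_mono2) (auto simp: unit_annulus_def)
    then show ?thesis by simp
  qed
  then have "(\<integral>\<^sup>+ X. ennreal (norm (indicator unit_annulus X * flux_density X)) \<partial>lborel)
      \<le> (\<integral>\<^sup>+ X. ennreal (max 1 (2 powr (- hdim))) * (ennreal (w X) * indicator (ball 0 3) X) \<partial>lborel)"
    by (intro nn_integral_mono)
      (auto simp: unit_annulus_def flux_density_def w_nonneg ennreal_mult[symmetric] mult.commute[of "w _"]
        indicator_def intro!: ennreal_leI mult_right_mono)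
  also have "\<dots> = ennreal (max 1 (2 powr (- hdim))) * (\<integral>\<^sup>+ X. ennreal (w X) * indicator (ball 0 3) X \<partial>lborel)"
    by (rule nn_integral_cmult) measurable
  also have "\<dots> < \<infinity>"
    using nn_integral_weight_ball[of 3] w_ball by (auto simp: ennreal_mult_less_top)
  finally show "(\<integral>\<^sup>+ X. ennreal (norm (indicator unit_annulus X * flux_density X)) \<partial>lborel) < \<infinity>" .
qed measurable

lemma annulus_mass_pos: "annulus_mass > 0"
proof -
  have "annulus_mass \<ge> 0"
    unfolding annulus_mass_def by (intro Bochner_Integration.integral_nonneg) (auto simp: flux_density_nonneg)
  moreover have "annulus_mass \<noteq> 0"
  proof
    assume "annulus_mass = 0"
    then have "AE X in lborel. indicator unit_annulus X * flux_density X = 0"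
      using integral_nonneg_eq_0_iff_AE[OF annulus_integrable] flux_density_nonneg
      by (simp add: annulus_mass_def)
    with w_pos have "AE X in lborel. X \<notin> unit_annulus"
      by eventually_elim (auto simp: flux_density_def unit_annulus_def indicator_def split: if_splits)
    then have null: "emeasure lborel unit_annulus = 0"
      by (subst (asm) AE_iff_measurable[where N=unit_annulus]) auto
    obtain b :: 'e where b: "norm b = 1" using SOME_Basis norm_Basis by blast
    have "ball ((3/2) *\<^sub>R b) (1/2) \<subseteq> unit_annulus"
    proof
      fix X assume X: "X \<in> ball ((3/2) *\<^sub>R b) (1/2)"
      have "\<bar>norm X - norm ((3/2) *\<^sub>R b)\<bar> \<le> norm (X - (3/2) *\<^sub>R b)" by (rule norm_triangle_ineq3)
      then show "X \<in> unit_annulus"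
        using X b unfolding unit_annulus_def by (simp add: dist_norm norm_minus_commute) linarith
    qed
    then have "emeasure lborel (ball ((3/2) *\<^sub>R b) (1/2)) \<le> emeasure lborel unit_annulus"
      by (intro emeasure_mono) auto
    with null have "ball ((3/2) *\<^sub>R b) (1/2) \<in> null_sets lborel"
      by (auto simp: null_sets_def)
    moreover have "ball ((3/2) *\<^sub>R b) (1/2) \<noteq> ({} :: 'e set)" by simp
    ultimately show False
      using open_not_negligible[of "ball ((3/2) *\<^sub>R b) (1/2)"] by (simp add: negligible_iff_null_sets null_sets_completionI)
  qed
  ultimately show ?thesis by simp
qed

text \<open>Serves two purposes: continuity at the centre yields the limit of means over shrinking
  spheres, and \<open>\<eta> = 0\<close> with \<open>e = 0\<close> evaluates the mean as the value
  at the centre.\<close>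

lemma sphere_mean_deviation:
  assumes [measurable]: "\<phi> \<in> borel_measurable borel"
    and "\<eta> \<ge> 0" and \<phi>: "\<And>Y. norm (Y - a) = \<eta> \<Longrightarrow> \<bar>\<phi> Y - l\<bar> \<le> e"
  shows "\<bar>sphere_mean \<eta> \<phi> a - l\<bar> \<le> e"
proof -
  let ?k = "\<lambda>X. indicator unit_annulus X * flux_density X"
  let ?\<phi> = "\<lambda>X. \<phi> (a + (\<eta> / norm X) *\<^sub>R X)"
  have b: "\<bar>?\<phi> X - l\<bar> \<le> e" if "X \<in> unit_annulus" for X
    using that assms by (intro \<phi>) (auto simp: unit_annulus_def)
  have int: "integrable lborel (\<lambda>X. ?k X * (?\<phi> X - l))"
  proof (rule Bochner_Integration.integrable_bound[where f="\<lambda>X. e * ?k X"])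
    show "AE X in lborel. norm (?k X * (?\<phi> X - l)) \<le> norm (e * ?k X)"
    proof (intro AE_I2)
      fix X
      show "norm (?k X * (?\<phi> X - l)) \<le> norm (e * ?k X)"
      proof (cases "X \<in> unit_annulus")
        case True
        then have "flux_density X * \<bar>?\<phi> X - l\<bar> \<le> flux_density X * \<bar>e\<bar>"
          using b[OF True] flux_density_nonneg by (intro mult_left_mono) auto
        then show ?thesis using True flux_density_nonneg[of X] by (simp add: abs_mult mult.commute)
      qed simp
    qed
  qed (use annulus_integrable in auto)
  have "(\<integral>X. ?k X * ?\<phi> X \<partial>lborel) = (\<integral>X. ?k X * (?\<phi> X - l) + l * ?k X \<partial>lborel)"
    by (intro Bochner_Integration.integral_cong) (auto simp: algebra_simps)
  also have "\<dots> = (\<integral>X. ?k X * (?\<phi> X - l) \<partial>lborel) + l * annulus_mass"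
    using int annulus_integrable by (subst Bochner_Integration.integral_add) (auto simp: annulus_mass_def)
  finally have eq: "sphere_mean \<eta> \<phi> a - l = (\<integral>X. ?k X * (?\<phi> X - l) \<partial>lborel) / annulus_mass"
    using annulus_mass_pos by (simp add: sphere_mean_def field_simps)
  have "\<bar>\<integral>X. ?k X * (?\<phi> X - l) \<partial>lborel\<bar> \<le> (\<integral>X. e * ?k X \<partial>lborel)"
  proof (rule order_trans[OF integral_abs_bound], rule integral_mono)
    fix X
    show "\<bar>?k X * (?\<phi> X - l)\<bar> \<le> e * ?k X"
    proof (cases "X \<in> unit_annulus")
      case True
      then have "flux_density X * \<bar>?\<phi> X - l\<bar> \<le> flux_density X * e"
        using b[OF True] flux_density_nonneg by (intro mult_left_mono) auto
      then show ?thesis using True flux_density_nonneg[of X] by (simp add: abs_mult mult.commute)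
    qed simp
  qed (use int annulus_integrable in auto)
  also have "\<dots> = e * annulus_mass" by (simp add: annulus_mass_def)
  finally show ?thesis
    unfolding eq using annulus_mass_pos by (simp add: field_simps)
qed

text \<open>The admissible t fill the interval from r/2 to r with r the norm of \<open>Y\<close>,
  and its mass for dt/t does not depend on r. This is the origin of every ln 2 below.\<close>

lemma annulus_dilation:
  fixes Y :: 'e
  assumes "Y \<noteq> 0"
  shows "has_bochner_integral lborel
    (\<lambda>t. indicator {0<..} t * indicator unit_annulus ((1 / t) *\<^sub>R Y) / t) (ln 2)"
proof -
  define r where "r = norm Y"
  have r: "r > 0" using assms by (simp add: r_def)
  have eq: "indicator {0<..} t * indicator unit_annulus ((1 / t) *\<^sub>R Y) / t
      = indicator {r/2..<r} t * (1 / t)" for t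
    using r by (auto simp: unit_annulus_def indicator_def r_def[symmetric] field_simps)
  have "((\<lambda>t. 1 / t) has_integral (ln r - ln (r / 2))) {r/2..r}"
    using r by (intro fundamental_theorem_of_calculus)
      (auto intro!: derivative_eq_intros simp flip: has_real_derivative_iff_has_vector_derivative)
  then have "((\<lambda>t. 1 / t) has_integral (ln 2)) {r/2..r}"
    using r by (simp add: ln_div)
  then have *: "(\<integral>\<^sup>+ t. ennreal (indicator {r/2..r} t * (1 / t)) \<partial>lborel) = ennreal (ln 2)"
    using r by (intro nn_integral_has_integral_lebesgue) auto
  have "has_bochner_integral lborel (\<lambda>t. indicator {r/2..r} t * (1 / t)) (ln 2)"
    using r by (intro has_bochner_integral_nn_integral *) (auto simp: indicator_def)
  moreover have "AE t in lborel. indicator {r/2..r} t * (1 / t) = indicator {r/2..<r} t * (1 / t)"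
    using AE_lborel_singleton[of r] by eventually_elim (auto simp: indicator_def)
  ultimately show ?thesis
    unfolding eq by (subst has_bochner_integral_cong_AE[symmetric]) auto
qed

lemma flux_at_0:
  fixes G :: "'e \<Rightarrow> 'e" and \<phi> :: "'e \<Rightarrow> real"
  assumes \<eta>: "\<eta> \<ge> 0" and [measurable]: "G \<in> borel_measurable borel" "\<phi> \<in> borel_measurable borel"
    and int: "integrable lborel (\<lambda>X. indicator {X. \<eta> < norm X} X * (flux_density X * (X \<bullet> G X)))"
    and ray: "AE X in lborel. X \<noteq> 0 \<longrightarrow>
      (\<forall>p q. \<eta> / norm X < p \<longrightarrow> p \<le> q \<longrightarrow>
        ((\<lambda>t. X \<bullet> G (t *\<^sub>R X)) has_integral (\<phi> (q *\<^sub>R X) - \<phi> (p *\<^sub>R X))) {p..q}) \<and>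
      ((\<lambda>t. \<phi> (t *\<^sub>R X)) \<longlongrightarrow> \<phi> ((\<eta> / norm X) *\<^sub>R X)) (at_right (\<eta> / norm X)) \<and>
      ((\<lambda>t. \<phi> (t *\<^sub>R X)) \<longlongrightarrow> 0) at_top"
  shows "(\<integral>X. indicator {X. \<eta> < norm X} X * (flux_density X * (X \<bullet> G X)) \<partial>lborel)
    = - (annulus_mass / ln 2) * sphere_mean \<eta> \<phi> 0"
proof -
  define q where "q Y = indicator {X. \<eta> < norm X} Y * (flux_density Y * (Y \<bullet> G Y))" for Y
  have [measurable]: "q \<in> borel_measurable borel" unfolding q_def by measurable
  have q_int: "integrable lborel q" using int by (simp add: q_def[abs_def])
  \<comment> \<open>Inserting \<open>m\<close>, whose integral over t is ln 2, spreads
    \<open>q Y\<close> over all dilations that carry a point of the annulus to \<open>Y\<close>.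
    Integrability is checked in these variables, where it reduces to that of
    \<open>q\<close>.\<close>
  define m where "m Y t = indicator {0<..} t * indicator unit_annulus ((1 / t) *\<^sub>R Y) / t" for Y and t :: real
  have [measurable]: "(\<lambda>(Y, t). m Y t) \<in> borel_measurable (borel \<Otimes>\<^sub>M borel)"
    unfolding m_def by measurable
  have m_0: "m 0 t = 0" for t by (simp add: m_def unit_annulus_def)
  have q_0: "q 0 = 0" by (simp add: q_def)
  define Q where "Q Y t = m Y t * q Y" for Y t
  \<comment> \<open>The image of \<open>Q\<close> under Y = t X for fixed t: the Jacobian, a power
    of t with the dimension as exponent, meets the factor 1/t of \<open>m\<close>.\<close>
  define P where "P X t = indicator {0<..} t * indicator unit_annulus X * t powr (real DIM('e) - 1) * q (t *\<^sub>R X)"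
    for X and t :: real
  have m_meas: "(\<lambda>t. m Y t) \<in> borel_measurable lborel" for Y unfolding m_def by measurable
  have Q_t: "integrable lborel (\<lambda>t. Q Y t)" "(\<integral>t. Q Y t \<partial>lborel) = ln 2 * q Y"
    "(\<integral>t. norm (Q Y t) \<partial>lborel) = ln 2 * \<bar>q Y\<bar>" for Y
  proof -
    have m_int: "has_bochner_integral lborel (m Y) (ln 2)" if "Y \<noteq> 0"
      using annulus_dilation[OF that] by (simp add: m_def[abs_def])
    have m_nonneg: "m Y t \<ge> 0" for t by (simp add: m_def indicator_def)
    show "integrable lborel (\<lambda>t. Q Y t)" "(\<integral>t. Q Y t \<partial>lborel) = ln 2 * q Y"
      "(\<integral>t. norm (Q Y t) \<partial>lborel) = ln 2 * \<bar>q Y\<bar>"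
      using m_int by (cases "Y = 0"; simp add: Q_def m_0 q_0 abs_mult m_nonneg has_bochner_integral_iff)+
  qed
  have PQ: "P X t = t powr real DIM('e) * Q (t *\<^sub>R X) t" if "t > 0" for X t
    using that by (simp add: P_def Q_def m_def powr_diff)
  have P0: "P X t = 0" "Q X t = 0" if "\<not> t > 0" for X t
    using that by (simp_all add: P_def Q_def m_def)
  have Q_int: "integrable (lborel \<Otimes>\<^sub>M lborel) (\<lambda>(Y, t). Q Y t)"
  proof (rule lborel_pair.Fubini_integrable)
    show "(\<lambda>(Y, t). Q Y t) \<in> borel_measurable (lborel \<Otimes>\<^sub>M lborel)"
      unfolding Q_def m_def by measurable
  qed (use Q_t q_int in auto)
  then have Q_int': "integrable (lborel \<Otimes>\<^sub>M lborel) (\<lambda>(t, Y). Q Y t)"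
    using lborel_pair.integrable_product_swap[OF Q_int] by simp
  have Q_Y: "AE t in lborel. integrable lborel (\<lambda>Y. Q Y t)"
    using lborel_pair.AE_integrable_fst'[OF Q_int'] by simp
  have Q_meas: "(\<lambda>Y. Q Y t) \<in> borel_measurable borel" for t
    unfolding Q_def m_def by measurable
  have P_X: "(\<integral>X. P X t \<partial>lborel) = (\<integral>Y. Q Y t \<partial>lborel)"
    "(\<integral>X. norm (P X t) \<partial>lborel) = (\<integral>Y. norm (Q Y t) \<partial>lborel)" for t
  proof -
    show "(\<integral>X. P X t \<partial>lborel) = (\<integral>Y. Q Y t \<partial>lborel)"
    proof (cases "t > 0")
      case True
      then show ?thesis using lborel_integral_scaleR[OF Q_meas True, of t]
        by (simp add: PQ powr_minus)
    qed (simp add: P0)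
    show "(\<integral>X. norm (P X t) \<partial>lborel) = (\<integral>Y. norm (Q Y t) \<partial>lborel)"
    proof (cases "t > 0")
      case True
      have "(\<lambda>Y. norm (Q Y t)) \<in> borel_measurable borel" using Q_meas by measurable
      from lborel_integral_scaleR[OF this True] show ?thesis
        using True by (simp add: PQ powr_minus abs_mult)
    qed (simp add: P0)
  qed
  have P_int: "integrable (lborel \<Otimes>\<^sub>M lborel) (\<lambda>(t, X). P X t)"
  proof (rule lborel_pair.Fubini_integrable)
    show "(\<lambda>(t, X). P X t) \<in> borel_measurable (lborel \<Otimes>\<^sub>M lborel)"
      unfolding P_def by measurable
    have "integrable lborel (\<lambda>t. \<integral>Y. norm (case (t, Y) of (t, Y) \<Rightarrow> Q Y t) \<partial>lborel)"
      using lborel_pair.integrable_fst'[OF integrable_norm[OF Q_int']] by simp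
    then show "integrable lborel (\<lambda>t. \<integral>X. norm (case (t, X) of (t, X) \<Rightarrow> P X t) \<partial>lborel)"
      by (simp only: prod.case P_X(2))
    show "AE t in lborel. integrable lborel (\<lambda>X. case (t, X) of (t, X) \<Rightarrow> P X t)"
      using Q_Y
    proof eventually_elim
      case (elim t)
      then show ?case
        using lborel_integrable_scaleR[OF elim, of t] by (cases "t > 0") (auto simp: PQ P0)
    qed
  qed
  have "ln 2 * (\<integral>Y. q Y \<partial>lborel) = (\<integral>Y. (\<integral>t. Q Y t \<partial>lborel) \<partial>lborel)"
    by (simp add: Q_t)
  also have "\<dots> = (\<integral>t. (\<integral>Y. Q Y t \<partial>lborel) \<partial>lborel)"
    using lborel_pair.Fubini_integral[of "\<lambda>Y t. Q Y t"] Q_int by simp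
  also have "\<dots> = (\<integral>t. (\<integral>X. P X t \<partial>lborel) \<partial>lborel)"
    by (simp add: P_X)
  also have "\<dots> = (\<integral>X. (\<integral>t. P X t \<partial>lborel) \<partial>lborel)"
    using lborel_pair.Fubini_integral[of "\<lambda>t X. P X t"] P_int by simp
  also have "\<dots> = (\<integral>X. - (indicator unit_annulus X * flux_density X * \<phi> (0 + (\<eta> / norm X) *\<^sub>R X)) \<partial>lborel)"
  proof (rule integral_cong_AE)
    show "(\<lambda>X. \<integral>t. P X t \<partial>lborel) \<in> borel_measurable lborel"
      unfolding P_def by measurable
    have P_t: "AE X in lborel. integrable lborel (\<lambda>t. P X t)"
      using lborel_pair.AE_integrable_fst'[of "\<lambda>(X, t). P X t"]
        lborel_pair.integrable_product_swap[OF P_int] by (simp add: case_prod_beta)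
    show AE: "AE X in lborel. (\<integral>t. P X t \<partial>lborel)
      = - (indicator unit_annulus X * flux_density X * \<phi> (0 + (\<eta> / norm X) *\<^sub>R X))"
      using P_t w_pos ray
    proof eventually_elim
      case (elim X)
      show ?case
      proof (cases "X \<in> unit_annulus")
        case True
        then have X: "norm X > 0" "X \<noteq> 0" by (auto simp: unit_annulus_def)
        have K: "flux_density X > 0" using elim(2) X by (simp add: flux_density_def)
        let ?f = "\<lambda>t. indicator {\<eta> / norm X<..} t * (X \<bullet> G (t *\<^sub>R X))"
        have P_eq: "P X t = flux_density X * ?f t" for t
        proof (cases "t > 0")
          case t: True
          \<comment> \<open>All powers of t cancel: those of \<open>P\<close>, the homogeneity of
            the flux density, and the factor t of the vector t X. What is left is the derivative
            along the ray.\<close>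
          have "t powr (real DIM('e) - 1) * (t powr (- real DIM('e)) * t) = 1"
            using t by (simp add: powr_diff powr_minus)
          then have "t powr (real DIM('e) - 1) * (flux_density (t *\<^sub>R X) * (t *\<^sub>R X \<bullet> G (t *\<^sub>R X)))
              = flux_density X * (X \<bullet> G (t *\<^sub>R X))"
            using t by (simp add: flux_density_scale)
          moreover have "\<eta> < norm (t *\<^sub>R X) \<longleftrightarrow> \<eta> / norm X < t"
            using X t by (simp add: field_simps)
          ultimately show ?thesis
            using True t by (simp add: P_def q_def indicator_def)
        next
          case False
          moreover have "\<eta> / norm X \<ge> 0" using \<eta> by simp
          ultimately show ?thesis by (simp add: P_def indicator_def)
        qed
        \<comment> \<open>Integrability along the ray comes from Fubini instead of a bound on
          \<open>G\<close>; the positive flux density at \<open>X\<close> is a constant that can be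
          divided out.\<close>
        have "integrable lborel ?f"
          using elim(1) K unfolding P_eq by simp
        then have "(\<integral>t. ?f t \<partial>lborel) = 0 - \<phi> ((\<eta> / norm X) *\<^sub>R X)"
          using elim(3) X by (intro integral_Ioi_FTC[where F="\<lambda>t. \<phi> (t *\<^sub>R X)"]) auto
        then show ?thesis
          unfolding P_eq using True by simp
      qed (simp add: P_def)
    qed
  next
    show "(\<lambda>X. - (indicator unit_annulus X * flux_density X * \<phi> (0 + (\<eta> / norm X) *\<^sub>R X))) \<in> borel_measurable lborel"
      by measurable
  qed
  also have "\<dots> = - (annulus_mass * sphere_mean \<eta> \<phi> 0)"
    using annulus_mass_pos by (simp add: sphere_mean_def)
  finally show ?thesis
    by (simp add: q_def field_simps)
qed

end

section \<open>Potentials of bounded densities\<close>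

text \<open>On a bounded range of radii the terms 1 + r of \<open>kernel_radial_abs_le\<close> are
  absorbed into the power, since 1 \<le> (L/r)^a for every a \<ge> 0.\<close>

lemma kernel_radial_abs_le_powr:
  assumes "s \<ge> 0" "0 < r" "r \<le> L"
  shows "\<bar>kernel_radial s r\<bar> \<le> (2 + (1 + L) * L powr kernel_order s) * r powr (- kernel_order s)"
proof -
  have o: "kernel_order s \<ge> 0" using assms by (simp add: kernel_order_def)
  have "L powr (- kernel_order s) \<le> r powr (- kernel_order s)"
    using assms o by (intro powr_mono2') auto
  then have "L powr kernel_order s * L powr (- kernel_order s) \<le> L powr kernel_order s * r powr (- kernel_order s)"
    by (intro mult_left_mono) auto
  moreover have "L powr kernel_order s * L powr (- kernel_order s) = 1"
    using assms by (simp add: powr_add[symmetric])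
  ultimately have "1 \<le> L powr kernel_order s * r powr (- kernel_order s)" by simp
  then have "(1 + L) * 1 \<le> (1 + L) * (L powr kernel_order s * r powr (- kernel_order s))"
    using assms by (intro mult_left_mono) auto
  then show ?thesis
    using kernel_radial_abs_le[OF assms(1,2)] assms by (simp add: algebra_simps)
qed

text \<open>The sum of the two powers stands for the power of the smaller radius; in this form each
  summand can be integrated on its own against a bounded density.\<close>

lemma kernel_radial_diff_le_sum:
  fixes A B :: "'e::euclidean_space"
  assumes "s \<ge> 0" "A \<noteq> 0" "B \<noteq> 0"
  shows "\<bar>kernel_radial s (norm A) - kernel_radial s (norm B)\<bar>
    \<le> kernel_slope s * (norm A powr (- s - 1) + norm B powr (- s - 1)) * norm (A - B)"
proof -
  define m where "m = min (norm A) (norm B)"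
  have "\<bar>kernel_radial s (norm A) - kernel_radial s (norm B)\<bar>
      \<le> kernel_slope s * m powr (- s - 1) * \<bar>norm A - norm B\<bar>"
    using assms by (intro kernel_radial_diff_le) (auto simp: m_def)
  also have "\<dots> \<le> kernel_slope s * (norm A powr (- s - 1) + norm B powr (- s - 1)) * norm (A - B)"
    using kernel_slope_pos[OF assms(1)]
    by (intro mult_mono mult_left_mono norm_triangle_ineq3) (auto simp: m_def min_def)
  finally show ?thesis .
qed

text \<open>Replaces dominated convergence when the singularity moves with k, so that no single
  dominating function is at hand: the part on \<open>A\<close> is uniformly small, and off
  \<open>A\<close> the sequence is eventually bounded.\<close>

lemma (in finite_measure) tendsto_integral_near_far:
  fixes F :: "nat \<Rightarrow> 'a \<Rightarrow> real"
  assumes [measurable]: "\<And>k. F k \<in> borel_measurable M"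
    and lim: "AE z in M. (\<lambda>k. F k z) \<longlonglongrightarrow> 0"
    and nf: "\<And>e. e > 0 \<Longrightarrow> \<exists>A\<in>sets M. \<exists>B.
      (\<forall>\<^sub>F k in sequentially. (\<integral>\<^sup>+ z. ennreal \<bar>F k z\<bar> * indicator A z \<partial>M) \<le> ennreal e) \<and>
      (\<forall>\<^sub>F k in sequentially. AE z in M. z \<notin> A \<longrightarrow> \<bar>F k z\<bar> \<le> B)"
  shows "(\<lambda>k. \<integral>z. F k z \<partial>M) \<longlonglongrightarrow> 0"
proof (rule LIMSEQ_I)
  fix e :: real assume "e > 0"
  then have e3: "e / 3 > 0" by simp
  from nf[OF this] obtain A B where A[measurable]: "A \<in> sets M"
    and near: "\<forall>\<^sub>F k in sequentially. (\<integral>\<^sup>+ z. ennreal \<bar>F k z\<bar> * indicator A z \<partial>M) \<le> ennreal (e / 3)"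
    and far: "\<forall>\<^sub>F k in sequentially. AE z in M. z \<notin> A \<longrightarrow> \<bar>F k z\<bar> \<le> B"
    by blast
  from far obtain k0 where k0: "\<And>k. k \<ge> k0 \<Longrightarrow> AE z in M. z \<notin> A \<longrightarrow> \<bar>F k z\<bar> \<le> B"
    by (auto simp: eventually_sequentially)
  have "(\<lambda>k. \<integral>\<^sup>+ z. ennreal (\<bar>F (k + k0) z\<bar> * indicator (- A) z) \<partial>M) \<longlonglongrightarrow> (\<integral>\<^sup>+ z. 0 \<partial>M)"
  proof (rule nn_integral_dominated_convergence[where w="\<lambda>_. ennreal \<bar>B\<bar>"])
    show "AE z in M. ennreal (\<bar>F (k + k0) z\<bar> * indicator (- A) z) \<le> ennreal \<bar>B\<bar>" for k
      using k0[of "k + k0", OF le_add2] by eventually_elim (auto simp: indicator_def intro!: ennreal_leI)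
    show "(\<integral>\<^sup>+ z. ennreal \<bar>B\<bar> \<partial>M) < \<infinity>"
      using emeasure_finite[of "space M"] by (simp add: ennreal_mult_eq_top_iff less_top[symmetric])
    show "AE z in M. (\<lambda>k. ennreal (\<bar>F (k + k0) z\<bar> * indicator (- A) z)) \<longlonglongrightarrow> 0"
      using lim
    proof eventually_elim
      case (elim z)
      have "(\<lambda>k. \<bar>F (k + k0) z\<bar> * indicator (- A) z) \<longlonglongrightarrow> \<bar>0\<bar> * indicator (- A) z"
        by (intro tendsto_intros LIMSEQ_ignore_initial_segment[OF elim])
      then show ?case using tendsto_ennrealI by force
    qed
  qed measurable
  then have "\<forall>\<^sub>F k in sequentially. (\<integral>\<^sup>+ z. ennreal (\<bar>F (k + k0) z\<bar> * indicator (- A) z) \<partial>M) < ennreal (e / 3)"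
    using e3 by (intro order_tendstoD(2)[where y=0]) auto
  then have far': "\<forall>\<^sub>F k in sequentially. (\<integral>\<^sup>+ z. ennreal (\<bar>F k z\<bar> * indicator (- A) z) \<partial>M) < ennreal (e / 3)"
    by (rule eventually_sequentially_seg[THEN iffD1])
  have "\<forall>\<^sub>F k in sequentially. norm (\<integral>z. F k z \<partial>M) < e"
    using near far'
  proof eventually_elim
    case (elim k)
    have "(\<integral>\<^sup>+ z. ennreal (norm (F k z)) \<partial>M)
        = (\<integral>\<^sup>+ z. ennreal \<bar>F k z\<bar> * indicator A z + ennreal (\<bar>F k z\<bar> * indicator (- A) z) \<partial>M)"
      by (intro nn_integral_cong) (auto simp: indicator_def)
    also have "\<dots> = (\<integral>\<^sup>+ z. ennreal \<bar>F k z\<bar> * indicator A z \<partial>M)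
        + (\<integral>\<^sup>+ z. ennreal (\<bar>F k z\<bar> * indicator (- A) z) \<partial>M)"
      by (intro nn_integral_add) measurable
    also have "\<dots> \<le> ennreal (e / 3) + ennreal (e / 3)"
      using elim by (intro add_mono) auto
    also have "\<dots> = ennreal (2 * e / 3)"
      using e3 by (simp add: ennreal_plus[symmetric] del: ennreal_plus)
    finally have bound: "(\<integral>\<^sup>+ z. ennreal (norm (F k z)) \<partial>M) \<le> ennreal (2 * e / 3)" .
    then have "integrable M (F k)"
      by (intro integrableI_bounded) (auto intro: order.strict_trans1)
    then have "ennreal (norm (\<integral>z. F k z \<partial>M)) \<le> ennreal (2 * e / 3)"
      using integral_norm_bound_ennreal bound order_trans by blast
    then have "norm (\<integral>z. F k z \<partial>M) \<le> 2 * e / 3"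
      using e3 by simp
    then show ?case using \<open>e > 0\<close> by simp
  qed
  then show "\<exists>no. \<forall>k\<ge>no. norm ((\<integral>z. F k z \<partial>M) - 0) < e"
    by (simp add: eventually_sequentially)
qed

text \<open>The density enters only through this inequality, which passes to dilated measures
  without computing a transformed density.\<close>

locale bounded_density_measure = prob_space \<mu> for \<mu> :: "'a::euclidean_space measure" +
  fixes M :: real
  assumes sets_mu [simp, measurable_cong]: "sets \<mu> = sets borel"
    and density_le: "\<And>f. f \<in> borel_measurable borel \<Longrightarrow>
      (\<integral>\<^sup>+ z. f z \<partial>\<mu>) \<le> ennreal M * (\<integral>\<^sup>+ z. f z \<partial>lborel)"
begin

lemma space_mu [simp]: "space \<mu> = UNIV"
  using sets_eq_imp_space_eq[OF sets_mu] by simp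

lemma AE_neq: "AE z in \<mu>. z \<noteq> x"
proof -
  have "emeasure \<mu> {x} = (\<integral>\<^sup>+ z. indicator {x} z \<partial>\<mu>)" by simp
  also have "\<dots> \<le> ennreal M * (\<integral>\<^sup>+ z. indicator {x} z \<partial>lborel)" by (intro density_le) simp
  also have "\<dots> = 0" by simp
  finally have "emeasure \<mu> {x} = 0" by simp
  then show ?thesis by (intro AE_I[where N="{x}"]) auto
qed

text \<open>Translation invariance of Lebesgue measure removes x, and scaling makes the integral
  over a ball of radius \<delta> proportional to \<delta>^(d-\<sigma>); hence \<delta> can be chosen
  uniformly in x.\<close>

lemma powr_small_ball:
  assumes "0 \<le> \<sigma>" "\<sigma> < real DIM('a)" "e > 0"
  obtains \<delta> where "\<delta> > 0"
    "\<And>x. (\<integral>\<^sup>+ z. ennreal (norm (x - z) powr (- \<sigma>)) * indicator (ball x \<delta>) z \<partial>\<mu>) \<le> ennreal e"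
proof -
  interpret L: homogeneous_weight "\<lambda>X::'a. 1" 0 by (rule homogeneous_weight_1)
  let ?f = "\<lambda>\<delta> z. ennreal (norm (z::'a) powr (- \<sigma>)) * indicator (ball 0 \<delta>) z"
  define I where "I = enn2real (\<integral>\<^sup>+ z. ?f 1 z \<partial>lborel)"
  have I: "(\<integral>\<^sup>+ z. ?f 1 z \<partial>lborel) = ennreal I" "I \<ge> 0"
    using L.weight_powr_small[of \<sigma> 1] assms by (auto simp: I_def L.hdim_def)
  define \<theta> where "\<theta> = real DIM('a) - \<sigma>"
  have \<theta>: "\<theta> > 0" using assms by (simp add: \<theta>_def)
  have scaled: "(\<integral>\<^sup>+ z. ?f \<delta> z \<partial>lborel) = ennreal (\<delta> powr \<theta> * I)" if \<delta>: "\<delta> > 0" for \<delta>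
  proof -
    have "ennreal (\<delta> powr (- real DIM('a))) * (\<integral>\<^sup>+ z. ?f \<delta> z \<partial>lborel) = (\<integral>\<^sup>+ z. ?f \<delta> (\<delta> *\<^sub>R z) \<partial>lborel)"
      using \<delta> by (intro nn_integral_lborel_scaleR[symmetric]) measurable
    also have "\<dots> = (\<integral>\<^sup>+ z. ennreal (\<delta> powr (- \<sigma>)) * ?f 1 z \<partial>lborel)"
      using \<delta> by (intro nn_integral_cong) (auto simp: indicator_def powr_mult ennreal_mult)
    also have "\<dots> = ennreal (\<delta> powr (- \<sigma>)) * ennreal I"
      unfolding I(1)[symmetric] by (rule nn_integral_cmult) measurable
    finally have "ennreal (\<delta> powr real DIM('a)) * (ennreal (\<delta> powr (- real DIM('a))) * (\<integral>\<^sup>+ z. ?f \<delta> z \<partial>lborel))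
        = ennreal (\<delta> powr real DIM('a)) * (ennreal (\<delta> powr (- \<sigma>)) * ennreal I)" by simp
    then show ?thesis
      using \<delta> I by (simp add: mult.assoc[symmetric] ennreal_mult[symmetric] powr_add[symmetric] \<theta>_def)
  qed
  \<comment> \<open>Solves \<delta>^\<theta> = e / (|M| I + 1); the added 1 avoids a division by
    zero.\<close>
  define \<delta> where "\<delta> = (e / (\<bar>M\<bar> * I + 1)) powr (1 / \<theta>)"
  have D: "\<bar>M\<bar> * I + 1 > 0" using I by (simp add: add_nonneg_pos)
  then have \<delta>: "\<delta> > 0" using assms by (simp add: \<delta>_def)
  have \<delta>_pow: "\<delta> powr \<theta> = e / (\<bar>M\<bar> * I + 1)" using \<theta> D assms by (simp add: \<delta>_def powr_powr)
  have "(\<integral>\<^sup>+ z. ennreal (norm (x - z) powr (- \<sigma>)) * indicator (ball x \<delta>) z \<partial>\<mu>) \<le> ennreal e" for x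
  proof -
    have "(\<integral>\<^sup>+ z. ennreal (norm (x - z) powr (- \<sigma>)) * indicator (ball x \<delta>) z \<partial>\<mu>)
        \<le> ennreal M * (\<integral>\<^sup>+ z. ennreal (norm (x - z) powr (- \<sigma>)) * indicator (ball x \<delta>) z \<partial>lborel)"
      by (intro density_le) measurable
    also have "(\<integral>\<^sup>+ z. ennreal (norm (x - z) powr (- \<sigma>)) * indicator (ball x \<delta>) z \<partial>lborel)
        = (\<integral>\<^sup>+ z. ?f \<delta> (z + (- x)) \<partial>lborel)"
      by (intro nn_integral_cong) (auto simp: indicator_def dist_norm norm_minus_commute)
    also have "\<dots> = (\<integral>\<^sup>+ z. ?f \<delta> z \<partial>lborel)"
      by (intro nn_integral_lborel_translate) measurable
    also have "ennreal M * \<dots> \<le> ennreal \<bar>M\<bar> * ennreal (\<delta> powr \<theta> * I)"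
      unfolding scaled[OF \<delta>] by (intro mult_right_mono ennreal_leI) auto
    also have "\<dots> = ennreal (\<bar>M\<bar> * I * (e / (\<bar>M\<bar> * I + 1)))"
      by (subst ennreal_mult'[symmetric]) (auto simp: \<delta>_pow mult_ac)
    also have "\<dots> \<le> ennreal e"
      using D assms I by (intro ennreal_leI) (simp add: field_simps)
    finally show ?thesis .
  qed
  with \<delta> show thesis by (rule that)
qed

lemma powr_integral_bounded:
  assumes "0 \<le> \<sigma>" "\<sigma> < real DIM('a)"
  obtains C where "C \<ge> 0" "\<And>x. (\<integral>\<^sup>+ z. ennreal (norm (x - z) powr (- \<sigma>)) \<partial>\<mu>) \<le> ennreal C"
proof -
  obtain \<delta> where \<delta>: "\<delta> > 0"
    "\<And>x. (\<integral>\<^sup>+ z. ennreal (norm (x - z) powr (- \<sigma>)) * indicator (ball x \<delta>) z \<partial>\<mu>) \<le> ennreal 1"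
    using powr_small_ball[OF assms, of 1] by auto
  have "(\<integral>\<^sup>+ z. ennreal (norm (x - z) powr (- \<sigma>)) \<partial>\<mu>) \<le> ennreal (1 + \<delta> powr (- \<sigma>))" for x
  proof -
    have "(\<integral>\<^sup>+ z. ennreal (norm (x - z) powr (- \<sigma>)) \<partial>\<mu>)
        \<le> (\<integral>\<^sup>+ z. ennreal (norm (x - z) powr (- \<sigma>)) * indicator (ball x \<delta>) z + ennreal (\<delta> powr (- \<sigma>)) \<partial>\<mu>)"
    proof (rule nn_integral_mono)
      fix z
      have "norm (x - z) powr (- \<sigma>) \<le> \<delta> powr (- \<sigma>)" if "z \<notin> ball x \<delta>"
        using that \<delta>(1) assms by (intro powr_mono2') (auto simp: dist_norm)
      then show "ennreal (norm (x - z) powr (- \<sigma>))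
          \<le> ennreal (norm (x - z) powr (- \<sigma>)) * indicator (ball x \<delta>) z + ennreal (\<delta> powr (- \<sigma>))"
        by (cases "z \<in> ball x \<delta>") (auto intro!: ennreal_leI)
    qed
    also have "\<dots> = (\<integral>\<^sup>+ z. ennreal (norm (x - z) powr (- \<sigma>)) * indicator (ball x \<delta>) z \<partial>\<mu>) + ennreal (\<delta> powr (- \<sigma>))"
      by (subst nn_integral_add) (auto simp: emeasure_space_1[unfolded space_mu])
    also have "\<dots> \<le> ennreal 1 + ennreal (\<delta> powr (- \<sigma>))"
      by (intro add_right_mono \<delta>)
    finally show ?thesis by simp
  qed
  then show thesis by (intro that[of "1 + \<delta> powr (- \<sigma>)"]) auto
qed

text \<open>The dominating function has one pole at x and one that approaches it. Smallness near the
  poles is uniform in their position by \<open>powr_small_ball\<close>.\<close>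

lemma tendsto_integral_dominated_powr:
  fixes F :: "nat \<Rightarrow> 'a \<Rightarrow> real"
  assumes [measurable]: "\<And>k. F k \<in> borel_measurable borel"
    and lim: "AE z in \<mu>. (\<lambda>k. F k z) \<longlonglongrightarrow> 0"
    and x: "y \<longlonglongrightarrow> x" and \<sigma>: "0 \<le> \<sigma>" "\<sigma> < real DIM('a)" and C: "C \<ge> 0"
    and dom: "\<forall>\<^sub>F k in sequentially. AE z in \<mu>. \<bar>F k z\<bar> \<le> C * (norm (y k - z) powr (- \<sigma>) + norm (x - z) powr (- \<sigma>))"
  shows "(\<lambda>k. \<integral>z. F k z \<partial>\<mu>) \<longlonglongrightarrow> 0"
proof (rule tendsto_integral_near_far)
  show "F k \<in> borel_measurable \<mu>" for k by measurable
  show "AE z in \<mu>. (\<lambda>k. F k z) \<longlonglongrightarrow> 0" by (rule lim)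
  fix e :: real assume "e > 0"
  define e' where "e' = e / (2 * C + 1)"
  have e': "e' > 0" using \<open>e > 0\<close> C by (simp add: e'_def)
  obtain \<delta> where \<delta>: "\<delta> > 0"
    "\<And>x. (\<integral>\<^sup>+ z. ennreal (norm (x - z) powr (- \<sigma>)) * indicator (ball x \<delta>) z \<partial>\<mu>) \<le> ennreal e'"
    using powr_small_ball[OF \<sigma> e'] by auto
  have close: "\<forall>\<^sub>F k in sequentially. dist (y k) x < \<delta> / 4"
    using x \<delta>(1) by (intro tendstoD) auto
  show "\<exists>A\<in>sets \<mu>. \<exists>B.
      (\<forall>\<^sub>F k in sequentially. (\<integral>\<^sup>+ z. ennreal \<bar>F k z\<bar> * indicator A z \<partial>\<mu>) \<le> ennreal e) \<and>
      (\<forall>\<^sub>F k in sequentially. AE z in \<mu>. z \<notin> A \<longrightarrow> \<bar>F k z\<bar> \<le> B)"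
  \<comment> \<open>Once \<open>y k\<close> is within \<delta>/4 of x, the ball of radius \<delta>/2
    about x lies in the \<delta>-balls about both poles, while outside it both poles are at distance
    at least \<delta>/4.\<close>
  proof (intro bexI[of _ "ball x (\<delta>/2)"] exI[of _ "C * (2 * (\<delta>/4) powr (- \<sigma>))"] conjI)
    show "\<forall>\<^sub>F k in sequentially. (\<integral>\<^sup>+ z. ennreal \<bar>F k z\<bar> * indicator (ball x (\<delta>/2)) z \<partial>\<mu>) \<le> ennreal e"
      using close dom
    proof eventually_elim
      case (elim k)
      have "(\<integral>\<^sup>+ z. ennreal \<bar>F k z\<bar> * indicator (ball x (\<delta>/2)) z \<partial>\<mu>)
        \<le> (\<integral>\<^sup>+ z. ennreal C * (ennreal (norm (y k - z) powr (- \<sigma>)) * indicator (ball (y k) \<delta>) z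
            + ennreal (norm (x - z) powr (- \<sigma>)) * indicator (ball x \<delta>) z) \<partial>\<mu>)"
      proof (rule nn_integral_mono_AE, use elim(2) in eventually_elim)
        case (elim z)
        show ?case
        proof (cases "z \<in> ball x (\<delta>/2)")
          case True
          then have "z \<in> ball x \<delta>" "z \<in> ball (y k) \<delta>"
            using \<open>dist (y k) x < \<delta>/4\<close> \<delta>(1) dist_triangle[of "y k" z x] by (auto simp: dist_commute)
          then show ?thesis
            using True elim C by (simp add: ennreal_mult[symmetric] ennreal_plus[symmetric] ennreal_leI del: ennreal_plus)
        qed auto
      qed
      also have "\<dots> = ennreal C * ((\<integral>\<^sup>+ z. ennreal (norm (y k - z) powr (- \<sigma>)) * indicator (ball (y k) \<delta>) z \<partial>\<mu>)
            + (\<integral>\<^sup>+ z. ennreal (norm (x - z) powr (- \<sigma>)) * indicator (ball x \<delta>) z \<partial>\<mu>))"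
        by (subst nn_integral_cmult, measurable, subst nn_integral_add) auto
      also have "\<dots> \<le> ennreal C * (ennreal e' + ennreal e')"
        by (intro mult_left_mono add_mono \<delta>) auto
      also have "\<dots> = ennreal (2 * C * e')"
        using C e' by (simp add: ennreal_mult[symmetric] ennreal_plus[symmetric] del: ennreal_plus)
      also have "\<dots> \<le> ennreal e"
        using C \<open>e > 0\<close> by (intro ennreal_leI) (simp add: e'_def field_simps)
      finally show ?case .
    qed
    show "\<forall>\<^sub>F k in sequentially. AE z in \<mu>. z \<notin> ball x (\<delta>/2) \<longrightarrow> \<bar>F k z\<bar> \<le> C * (2 * (\<delta>/4) powr (- \<sigma>))"
      using close dom
    proof eventually_elim
      case (elim k)
      show ?case
      proof (use elim(2) in eventually_elim, intro impI)
        fix z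
        assume b: "\<bar>F k z\<bar> \<le> C * (norm (y k - z) powr (- \<sigma>) + norm (x - z) powr (- \<sigma>))"
          and z: "z \<notin> ball x (\<delta>/2)"
        have "norm (y k - z) \<ge> \<delta>/4" "norm (x - z) \<ge> \<delta>/4"
          using z elim(1) \<delta>(1) dist_triangle[of x z "y k"] by (auto simp: dist_norm norm_minus_commute)
        then have "norm (y k - z) powr (- \<sigma>) \<le> (\<delta>/4) powr (- \<sigma>)" "norm (x - z) powr (- \<sigma>) \<le> (\<delta>/4) powr (- \<sigma>)"
          using \<delta>(1) \<sigma> by (auto intro!: powr_mono2')
        then have "C * (norm (y k - z) powr (- \<sigma>) + norm (x - z) powr (- \<sigma>)) \<le> C * (2 * (\<delta>/4) powr (- \<sigma>))"
          using C by (intro mult_left_mono) auto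
        with b show "\<bar>F k z\<bar> \<le> C * (2 * (\<delta>/4) powr (- \<sigma>))" by linarith
      qed
    qed
  qed simp
qed

end

text \<open>\<open>R0\<close> is at least 1 so that any X of norm at least \<open>2 * R0\<close> is
  farther than any truncation radius below 1 from everything within radius
  \<open>R0\<close>.\<close>

locale compact_density_measure = bounded_density_measure \<mu> M for \<mu> :: "'a::euclidean_space measure" and M +
  fixes R0 :: real
  assumes support: "AE z in \<mu>. norm z \<le> R0"
    and R0_ge_1: "R0 \<ge> 1"

text \<open>The two extensions, \<open>k = 0\<close> and \<open>k = 1\<close>, in a common form. The set \<open>N\<close> is where the gradient of the
  potential of a bounded density may blow up, namely \<open>y = 0\<close> if \<open>k = 1\<close>, and \<open>b\<close> bounds that blow-up.\<close>

locale riesz_extension = homogeneous_weight w p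
  for w :: "'e::euclidean_space \<Rightarrow> real" and p :: real +
  fixes s :: real and \<iota> :: "'a::euclidean_space \<Rightarrow> 'e" and \<pi> :: "'e \<Rightarrow> 'a"
    and b :: "'e \<Rightarrow> real" and \<sigma> :: real and N :: "'e set"
  assumes s_nonneg: "0 \<le> s" and s_less: "s < real DIM('a)"
    and hdim_eq: "p + real DIM('e) = s + 2"
    and linear_emb: "linear \<iota>" and norm_emb: "norm (\<iota> z) = norm z"
    and proj_le: "norm (\<pi> X - z) \<le> norm (X - \<iota> z)"
    and proj_lipschitz: "norm (\<pi> X - \<pi> Y) \<le> norm (X - Y)"
    and w_translate: "w (X + \<iota> z) = w X"
    and b_measurable [measurable]: "b \<in> borel_measurable borel"
    and b_ge_1: "1 \<le> b X" and b_cont: "X \<notin> N \<Longrightarrow> isCont b X"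
    and w_b: "R > 0 \<Longrightarrow> (\<integral>\<^sup>+ X. ennreal (w X * (b X)\<^sup>2) * indicator (ball 0 R) X \<partial>lborel) < \<infinity>"
    and \<sigma>_nonneg: "0 \<le> \<sigma>" and \<sigma>_less: "\<sigma> < real DIM('a)"
    and kernel_dom: "X \<notin> N \<Longrightarrow> z \<noteq> \<pi> X \<Longrightarrow>
      norm (X - \<iota> z) powr (- s - 1) \<le> b X * norm (\<pi> X - z) powr (- \<sigma>)"
    and N_closed: "closed N" and N_null: "AE X in lborel. X \<notin> N"
    and N_ray: "t > 0 \<Longrightarrow> X \<notin> N \<Longrightarrow> \<iota> z + t *\<^sub>R X \<notin> N"
begin

lemma hdim_s: "hdim = s + 2"
  by (simp add: hdim_def hdim_eq)

lemma emb_continuous: "continuous_on UNIV \<iota>"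
  by (rule linear_continuous_on_compose) (auto simp: linear_emb)

lemma emb_measurable [measurable]: "\<iota> \<in> borel_measurable borel"
  by (rule borel_measurable_continuous_onI[OF emb_continuous])

lemma emb_diff: "\<iota> x - \<iota> y = \<iota> (x - y)"
  using linear_diff[OF linear_emb] by simp

lemma emb_neq: "z \<noteq> \<pi> X \<Longrightarrow> X - \<iota> z \<noteq> 0"
  using proj_le[of X z] by auto

lemma proj_tendsto:
  assumes "(Y \<longlongrightarrow> X) F"
  shows "((\<lambda>k. \<pi> (Y k)) \<longlongrightarrow> \<pi> X) F"
proof -
  have "((\<lambda>k. dist (Y k) X) \<longlongrightarrow> 0) F" using assms by (simp add: tendsto_dist_iff[symmetric])
  then have "((\<lambda>k. dist (\<pi> (Y k)) (\<pi> X)) \<longlongrightarrow> 0) F"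
    by (rule tendsto_sandwich[OF _ _ tendsto_const, rotated 2]) (auto simp: dist_norm proj_lipschitz)
  then show ?thesis by (simp add: tendsto_dist_iff[symmetric])
qed

lemma kernel_order_less: "kernel_order s < real DIM('a)" "0 \<le> kernel_order s"
proof -
  have d: "1 \<le> real DIM('a)" by (simp add: Suc_leI)
  have "kernel_order s = 1 / 2 \<or> kernel_order s = s" by (simp add: kernel_order_def)
  then show "kernel_order s < real DIM('a)" "0 \<le> kernel_order s"
    using d s_less s_nonneg by linarith+
qed

end

section \<open>Continuity and gradient of the background potential\<close>

locale riesz_potential = riesz_extension w p s \<iota> \<pi> b \<sigma> N + compact_density_measure \<mu> M R0
  for w :: "'e::euclidean_space \<Rightarrow> real" and p s and \<iota> :: "'a::euclidean_space \<Rightarrow> 'e" and \<pi> b \<sigma> N and \<mu> :: "'a measure" and M R0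
begin

definition H :: "'e \<Rightarrow> real" where
  "H X = (\<integral>z. kernel_radial s (norm (X - \<iota> z)) \<partial>\<mu>)"

text \<open>On the null set \<open>N\<close> the integral may fail to exist; its value is then 0 by
  default.\<close>

definition H_grad :: "'e \<Rightarrow> 'e" where
  "H_grad X = (\<integral>z. kernel_grad s (X - \<iota> z) \<partial>\<mu>)"

lemma H_grad_measurable [measurable]: "H_grad \<in> borel_measurable borel"
  unfolding H_grad_def by measurable

text \<open>Distances in the extended space dominate those of the projections, so integrals of
  powers over R^d control the singularity; the bounded support controls the growth of the
  logarithm.\<close>

lemma kernel_integrable: "integrable \<mu> (\<lambda>z. kernel_radial s (norm (X - \<iota> z)))"
proof (rule integrableI_bounded)
  define L where "L = norm X + R0"
  define C where "C = 2 + (1 + L) * L powr kernel_order s"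
  have C: "C \<ge> 0" using R0_ge_1 by (simp add: C_def L_def add_nonneg_nonneg)
  obtain D where D: "\<And>x. (\<integral>\<^sup>+ z. ennreal (norm (x - z) powr (- kernel_order s)) \<partial>\<mu>) \<le> ennreal D"
    using powr_integral_bounded kernel_order_less by metis
  have "(\<integral>\<^sup>+ z. ennreal (norm (kernel_radial s (norm (X - \<iota> z)))) \<partial>\<mu>)
    \<le> (\<integral>\<^sup>+ z. ennreal C * ennreal (norm (\<pi> X - z) powr (- kernel_order s)) \<partial>\<mu>)"
  proof (rule nn_integral_mono_AE, use AE_neq[of "\<pi> X"] support in eventually_elim)
    case (elim z)
    have "norm (X - \<iota> z) \<le> L"
      using norm_triangle_ineq4[of X "\<iota> z"] elim by (simp add: L_def norm_emb)
    then have "\<bar>kernel_radial s (norm (X - \<iota> z))\<bar> \<le> C * norm (X - \<iota> z) powr (- kernel_order s)"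
      unfolding C_def using elim emb_neq s_nonneg by (intro kernel_radial_abs_le_powr) auto
    also have "\<dots> \<le> C * norm (\<pi> X - z) powr (- kernel_order s)"
      using C kernel_order_less elim by (intro mult_left_mono powr_mono2' proj_le) auto
    finally show ?case using C by (simp add: ennreal_mult[symmetric] ennreal_leI)
  qed
  also have "\<dots> \<le> ennreal C * ennreal D"
    using D by (subst nn_integral_cmult) (auto intro!: mult_left_mono)
  also have "\<dots> < \<infinity>" by (simp add: ennreal_mult_less_top)
  finally show "(\<integral>\<^sup>+ z. ennreal (norm (kernel_radial s (norm (X - \<iota> z)))) \<partial>\<mu>) < \<infinity>" .
qed measurable

text \<open>The exponent s + 1 of the gradient may be as large as d or larger.
  \<open>kernel_dom\<close> puts the excess into \<open>b X\<close> and leaves a power that a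
  bounded density integrates uniformly.\<close>

lemma kernel_grad_bound:
  obtains C where "C \<ge> 1"
    "\<And>X. X \<notin> N \<Longrightarrow> (\<integral>\<^sup>+ z. ennreal (norm (kernel_grad s (X - \<iota> z))) \<partial>\<mu>) \<le> ennreal (C * b X)"
proof -
  obtain D where D: "D \<ge> 0" "\<And>x. (\<integral>\<^sup>+ z. ennreal (norm (x - z) powr (- \<sigma>)) \<partial>\<mu>) \<le> ennreal D"
    using powr_integral_bounded \<sigma>_nonneg \<sigma>_less by metis
  have \<kappa>: "kernel_slope s \<ge> 0" using kernel_slope_pos s_nonneg by (simp add: less_imp_le)
  have "(\<integral>\<^sup>+ z. ennreal (norm (kernel_grad s (X - \<iota> z))) \<partial>\<mu>) \<le> ennreal ((kernel_slope s * D + 1) * b X)"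
    if X: "X \<notin> N" for X
  proof -
    have bX: "0 \<le> b X" using b_ge_1[of X] by simp
    have "(\<integral>\<^sup>+ z. ennreal (norm (kernel_grad s (X - \<iota> z))) \<partial>\<mu>)
      \<le> (\<integral>\<^sup>+ z. ennreal (kernel_slope s * b X) * ennreal (norm (\<pi> X - z) powr (- \<sigma>)) \<partial>\<mu>)"
      using AE_neq[of "\<pi> X"]
      by (intro nn_integral_mono_AE, eventually_elim)
        (use kernel_dom[OF X] \<kappa> bX s_nonneg in \<open>simp add: norm_kernel_grad ennreal_mult[symmetric] ennreal_leI mult.assoc mult_left_mono\<close>)
    also have "\<dots> \<le> ennreal (kernel_slope s * b X) * ennreal D"
      using D by (subst nn_integral_cmult) (auto intro!: mult_left_mono)
    also have "\<dots> = ennreal (kernel_slope s * D * b X)"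
      using \<kappa> bX D by (simp add: ennreal_mult[symmetric] mult_ac)
    also have "\<dots> \<le> ennreal ((kernel_slope s * D + 1) * b X)"
      using bX by (intro ennreal_leI mult_right_mono) auto
    finally show ?thesis .
  qed
  then show thesis using \<kappa> D by (intro that[of "kernel_slope s * D + 1"]) auto
qed

lemma kernel_grad_integrable:
  assumes "X \<notin> N"
  shows "integrable \<mu> (\<lambda>z. kernel_grad s (X - \<iota> z))"
proof (rule integrableI_bounded)
  obtain C where "(\<integral>\<^sup>+ z. ennreal (norm (kernel_grad s (X - \<iota> z))) \<partial>\<mu>) \<le> ennreal (C * b X)"
    using kernel_grad_bound assms by metis
  then show "(\<integral>\<^sup>+ z. ennreal (norm (kernel_grad s (X - \<iota> z))) \<partial>\<mu>) < \<infinity>"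
    by (rule order.strict_trans1) simp
qed measurable

text \<open>Continuity also on \<open>N\<close> is what lets rays start at points of R^d, although
  the gradient may blow up there.\<close>

lemma H_isCont: "isCont H X"
proof -
  have "(\<lambda>k. H (Y k)) \<longlonglongrightarrow> H X" if Y: "Y \<longlonglongrightarrow> X" for Y
  proof -
    define L where "L = norm X + 1 + R0"
    define C where "C = 2 + (1 + L) * L powr kernel_order s"
    have C: "C \<ge> 0" using R0_ge_1 by (simp add: C_def L_def add_nonneg_nonneg)
    have "(\<lambda>k. \<integral>z. kernel_radial s (norm (Y k - \<iota> z)) - kernel_radial s (norm (X - \<iota> z)) \<partial>\<mu>) \<longlonglongrightarrow> 0"
    proof (rule tendsto_integral_dominated_powr[OF _ _ proj_tendsto[OF Y] kernel_order_less(2,1) C])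
      show "AE z in \<mu>. (\<lambda>k. kernel_radial s (norm (Y k - \<iota> z)) - kernel_radial s (norm (X - \<iota> z))) \<longlonglongrightarrow> 0"
        using AE_neq[of "\<pi> X"]
      proof eventually_elim
        case (elim z)
        then have "isCont (kernel_radial s) (norm (X - \<iota> z))"
          using emb_neq[of z X] by (intro DERIV_isCont[OF kernel_radial_deriv]) auto
        then have "(\<lambda>k. kernel_radial s (norm (Y k - \<iota> z))) \<longlonglongrightarrow> kernel_radial s (norm (X - \<iota> z))"
          by (rule isCont_tendsto_compose) (intro tendsto_intros Y)
        then show ?case by (rule LIM_zero)
      qed
      have "\<forall>\<^sub>F k in sequentially. dist (Y k) X < 1" using Y by (intro tendstoD) auto
      then show "\<forall>\<^sub>F k in sequentially. AE z in \<mu>.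
          \<bar>kernel_radial s (norm (Y k - \<iota> z)) - kernel_radial s (norm (X - \<iota> z))\<bar>
          \<le> C * (norm (\<pi> (Y k) - z) powr (- kernel_order s) + norm (\<pi> X - z) powr (- kernel_order s))"
      proof eventually_elim
        case (elim k)
        have *: "\<bar>kernel_radial s (norm (Z - \<iota> z))\<bar> \<le> C * norm (\<pi> Z - z) powr (- kernel_order s)"
          if "dist Z X < 1" "z \<noteq> \<pi> Z" "norm z \<le> R0" for Z z
        proof -
          have "norm (Z - \<iota> z) \<le> L"
            using norm_triangle_ineq4[of Z "\<iota> z"] norm_triangle_ineq2[of Z X] that
            by (simp add: L_def norm_emb dist_norm)
          then have "\<bar>kernel_radial s (norm (Z - \<iota> z))\<bar> \<le> C * norm (Z - \<iota> z) powr (- kernel_order s)"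
            unfolding C_def using that emb_neq s_nonneg by (intro kernel_radial_abs_le_powr) auto
          also have "\<dots> \<le> C * norm (\<pi> Z - z) powr (- kernel_order s)"
            using C kernel_order_less that by (intro mult_left_mono powr_mono2' proj_le) auto
          finally show ?thesis .
        qed
        show ?case
          using AE_neq[of "\<pi> X"] AE_neq[of "\<pi> (Y k)"] support
        proof eventually_elim
          case (elim z)
          then show ?case
            using *[of "Y k" z] *[of X z] \<open>dist (Y k) X < 1\<close> by (simp add: distrib_left)
        qed
      qed
    qed measurable
    then have "(\<lambda>k. H (Y k) - H X) \<longlonglongrightarrow> 0"
      by (simp add: H_def Bochner_Integration.integral_diff[OF kernel_integrable kernel_integrable])
    then show ?thesis by (rule LIM_zero_cancel)
  qed
  then show ?thesis
    by (auto simp: continuous_at_sequentially comp_def)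
qed

lemma H_measurable [measurable]: "H \<in> borel_measurable borel"
  by (intro borel_measurable_continuous_onI continuous_at_imp_continuous_on ballI H_isCont)

text \<open>Differentiation under the integral along sequences. The remainder quotient has poles at
  the projections of both \<open>X\<close> and \<open>Y k\<close>, hence the convergence theorem
  with a moving pole.\<close>

lemma H_deriv:
  assumes X: "X \<notin> N"
  shows "GDERIV H X :> H_grad X"
proof -
  let ?q = "\<lambda>Y. norm (H Y - H X - (Y - X) \<bullet> H_grad X) / norm (Y - X)"
  have "(\<lambda>k. ?q (Y k)) \<longlonglongrightarrow> 0" if Y: "Y \<longlonglongrightarrow> X" and Y_ne: "\<And>k. Y k \<noteq> X" for Y
  proof -
    \<comment> \<open>The term at \<open>Y k\<close> occurs once and the term at \<open>X\<close>
      twice, from the difference quotient and from the gradient; \<open>b X + 1\<close> bounds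
      \<open>b\<close> at both points for large k.\<close>
    define C where "C = kernel_slope s * (2 * (b X + 1))"
    have \<kappa>: "kernel_slope s > 0" using kernel_slope_pos s_nonneg by simp
    have C: "C \<ge> 0" using \<kappa> b_ge_1[of X] by (simp add: C_def)
    let ?F = "\<lambda>k z. (kernel_radial s (norm (Y k - \<iota> z)) - kernel_radial s (norm (X - \<iota> z))
        - (Y k - X) \<bullet> kernel_grad s (X - \<iota> z)) / norm (Y k - X)"
    have "(\<lambda>k. \<integral>z. ?F k z \<partial>\<mu>) \<longlonglongrightarrow> 0"
    proof (rule tendsto_integral_dominated_powr[OF _ _ proj_tendsto[OF Y] \<sigma>_nonneg \<sigma>_less C])
      show "AE z in \<mu>. (\<lambda>k. ?F k z) \<longlonglongrightarrow> 0"
        using AE_neq[of "\<pi> X"]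
      proof eventually_elim
        case (elim z)
        have "GDERIV (\<lambda>Y. kernel_radial s (norm (Y - \<iota> z))) X :> kernel_grad s (X - \<iota> z)"
          using emb_neq[OF elim] by (intro GDERIV_translate kernel_grad_deriv)
        then have "((\<lambda>Y. norm (kernel_radial s (norm (Y - \<iota> z)) - kernel_radial s (norm (X - \<iota> z))
            - (Y - X) \<bullet> kernel_grad s (X - \<iota> z)) / norm (Y - X)) \<longlongrightarrow> 0) (at X)"
          by (simp add: gderiv_def has_derivative_iff_norm)
        then have "(\<lambda>k. norm (?F k z)) \<longlonglongrightarrow> 0"
          using Y Y_ne unfolding tendsto_at_iff_sequentially by (auto simp: comp_def)
        then show ?case by (rule tendsto_norm_zero_cancel)
      qed
      have "open (- N)" using N_closed by (simp add: open_Compl)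
      then have "\<forall>\<^sub>F k in sequentially. Y k \<in> - N"
        using Y X by (intro topological_tendstoD) auto
      moreover have "(\<lambda>k. b (Y k)) \<longlonglongrightarrow> b X"
        using isCont_tendsto_compose[OF b_cont[OF X] Y] .
      then have "\<forall>\<^sub>F k in sequentially. b (Y k) < b X + 1" by (rule order_tendstoD) simp
      ultimately show "\<forall>\<^sub>F k in sequentially. AE z in \<mu>. \<bar>?F k z\<bar>
          \<le> C * (norm (\<pi> (Y k) - z) powr (- \<sigma>) + norm (\<pi> X - z) powr (- \<sigma>))"
      proof eventually_elim
        case (elim k)
        show ?case
          using AE_neq[of "\<pi> X"] AE_neq[of "\<pi> (Y k)"]
        proof eventually_elim
          case z: (elim z)
          let ?A = "Y k - \<iota> z" and ?B = "X - \<iota> z"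
          have d: "norm (Y k - X) > 0" using Y_ne[of k] by simp
          have 1: "\<bar>kernel_radial s (norm ?A) - kernel_radial s (norm ?B)\<bar>
              \<le> kernel_slope s * (norm ?A powr (- s - 1) + norm ?B powr (- s - 1)) * norm (Y k - X)"
            using kernel_radial_diff_le_sum[OF s_nonneg emb_neq[OF z(2)] emb_neq[OF z(1)]] by simp
          have 2: "\<bar>(Y k - X) \<bullet> kernel_grad s ?B\<bar> \<le> norm (Y k - X) * (kernel_slope s * norm ?B powr (- s - 1))"
            using Cauchy_Schwarz_ineq2[of "Y k - X" "kernel_grad s ?B"] by (simp add: norm_kernel_grad s_nonneg)
          have A: "norm ?A powr (- s - 1) \<le> (b X + 1) * norm (\<pi> (Y k) - z) powr (- \<sigma>)"
            using kernel_dom[of "Y k" z] elim z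
            by (smt (verit) ComplD mult_right_mono powr_ge_zero)
          have B: "norm ?B powr (- s - 1) \<le> (b X + 1) * norm (\<pi> X - z) powr (- \<sigma>)"
            using kernel_dom[of X z] X z by (smt (verit) mult_right_mono powr_ge_zero)
          have "\<bar>?F k z\<bar> * norm (Y k - X) \<le> (kernel_slope s * (norm ?A powr (- s - 1) + 2 * norm ?B powr (- s - 1))) * norm (Y k - X)"
            using 1 2 d by (simp add: abs_divide algebra_simps)
          then have "\<bar>?F k z\<bar> \<le> kernel_slope s * (norm ?A powr (- s - 1) + 2 * norm ?B powr (- s - 1))"
            using d mult_le_cancel_right_pos by blast
          also have "\<dots> \<le> kernel_slope s * ((b X + 1) * norm (\<pi> (Y k) - z) powr (- \<sigma>)
              + 2 * ((b X + 1) * norm (\<pi> X - z) powr (- \<sigma>)))"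
            using A B \<kappa> by (intro mult_left_mono add_mono) auto
          also have "\<dots> \<le> C * (norm (\<pi> (Y k) - z) powr (- \<sigma>) + norm (\<pi> X - z) powr (- \<sigma>))"
            using \<kappa> b_ge_1[of X] by (simp add: C_def algebra_simps)
          finally show ?case .
        qed
      qed
    qed measurable
    moreover have eq: "(\<integral>z. ?F k z \<partial>\<mu>) = (H (Y k) - H X - (Y k - X) \<bullet> H_grad X) / norm (Y k - X)" for k
      using kernel_integrable kernel_grad_integrable[OF X]
      by (simp add: H_def H_grad_def Bochner_Integration.integral_diff integral_inner_right)
    ultimately have "(\<lambda>k. (H (Y k) - H X - (Y k - X) \<bullet> H_grad X) / norm (Y k - X)) \<longlonglongrightarrow> 0"
      by (simp only: eq)
    from tendsto_norm_zero[OF this] show ?thesis by simp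
  qed
  then have "(?q \<longlongrightarrow> 0) (at X)"
    unfolding tendsto_at_iff_sequentially by (auto simp: comp_def)
  then show ?thesis
    unfolding gderiv_def has_derivative_iff_norm by (auto intro: bounded_linear_intros)
qed

end

section \<open>The energy of the truncated potential\<close>

lemma half_powr:
  fixes r a :: real
  assumes "r > 0"
  shows "(r / 2) powr (- a) = r powr (- a) * 2 powr a"
proof -
  have "(r / 2) powr (- a) = r powr (- a) / 2 powr (- a)"
    using assms by (simp only: powr_divide less_imp_le zero_le_numeral)
  also have "\<dots> = r powr (- a) * 2 powr a"
    unfolding powr_minus[of 2 a] by (simp only: divide_inverse inverse_inverse_eq)
  finally show ?thesis .
qed

text \<open>The squared norm is a quadratic polynomial in t with nonzero leading coefficient. It is
  used to see that a ray crosses the truncation spheres only finitely often.\<close>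

lemma finite_line_sphere:
  fixes X v :: "'e::euclidean_space"
  assumes "X \<noteq> 0"
  shows "finite {t. norm (t *\<^sub>R X + v) = \<eta>}"
proof -
  let ?P = "[:v \<bullet> v - \<eta>\<^sup>2, 2 * (X \<bullet> v), X \<bullet> X:]"
  have "?P \<noteq> 0" using assms by simp
  then have "finite {t. poly ?P t = 0}" by (rule poly_roots_finite)
  moreover have "poly ?P t = 0" if "norm (t *\<^sub>R X + v) = \<eta>" for t
  proof -
    have "(t *\<^sub>R X + v) \<bullet> (t *\<^sub>R X + v) = \<eta>\<^sup>2"
      using that by (simp only: power2_norm_eq_inner[symmetric])
    moreover have "(t *\<^sub>R X + v) \<bullet> (t *\<^sub>R X + v) = t * (t * (X \<bullet> X)) + 2 * (t * (X \<bullet> v)) + v \<bullet> v"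
      unfolding inner_add_left inner_add_right inner_scaleR_left inner_scaleR_right inner_commute[of v X]
      by (simp only: distrib_left distrib_right mult_2 add.assoc add.commute add.left_commute)
    moreover have "poly ?P t = t * (t * (X \<bullet> X)) + 2 * (t * (X \<bullet> v)) + v \<bullet> v - \<eta>\<^sup>2"
      unfolding poly_pCons poly_0 by (simp only: algebra_simps mult_zero_right add_0_right)
    ultimately show ?thesis by linarith
  qed
  ultimately show ?thesis
    by (elim finite_subset[rotated]) blast
qed

text \<open>Off the origin this is the kernel minus its truncation, by
  \<open>trunc_kernel_max\<close>; in this form it is continuous at the origin as well.\<close>

definition trunc_radial :: "real \<Rightarrow> real \<Rightarrow> 'e::euclidean_space \<Rightarrow> real" where
  "trunc_radial s \<eta> X = kernel_radial s (max \<eta> (norm X))"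

definition trunc_grad :: "real \<Rightarrow> real \<Rightarrow> 'e::euclidean_space \<Rightarrow> 'e" where
  "trunc_grad s \<eta> X = indicator {Y. \<eta> < norm Y} X *\<^sub>R kernel_grad s X"

lemma trunc_radial_measurable [measurable]:
  "trunc_radial s \<eta> \<in> borel_measurable (borel :: 'e::euclidean_space measure)"
  unfolding trunc_radial_def by measurable

lemma trunc_grad_measurable [measurable]:
  "trunc_grad s \<eta> \<in> borel_measurable (borel :: 'e::euclidean_space measure)"
  unfolding trunc_grad_def by measurable

lemma trunc_radial_isCont:
  assumes "\<eta> > 0"
  shows "isCont (trunc_radial s \<eta>) (X::'e::euclidean_space)"
proof -
  have "isCont (kernel_radial s) (max \<eta> (norm X))"
    using assms by (intro DERIV_isCont[OF kernel_radial_deriv]) auto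
  moreover have "isCont (\<lambda>X. max \<eta> (norm X)) X"
    by (intro continuous_intros)
  ultimately show ?thesis
    unfolding trunc_radial_def by (rule isCont_o2[rotated])
qed

lemma trunc_radial_deriv:
  fixes X :: "'e::euclidean_space"
  assumes "\<eta> > 0" "norm X \<noteq> \<eta>"
  shows "GDERIV (trunc_radial s \<eta>) X :> trunc_grad s \<eta> X"
proof (cases "norm X < \<eta>")
  case True
  have "((\<lambda>Y. kernel_radial s \<eta>) has_derivative (\<lambda>h. 0)) (at X)" by simp
  then have "(trunc_radial s \<eta> has_derivative (\<lambda>h. 0)) (at X)"
    by (rule has_derivative_transform_within_open[where s="ball 0 \<eta>"])
      (use True in \<open>auto simp: trunc_radial_def max_def\<close>)
  then show ?thesis using True by (simp add: gderiv_def trunc_grad_def)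
next
  case False
  then have X: "\<eta> < norm X" "X \<noteq> 0" using assms by auto
  have "GDERIV (\<lambda>Y. kernel_radial s (norm Y)) X :> kernel_grad s X"
    by (rule kernel_grad_deriv[OF X(2)])
  then have "(trunc_radial s \<eta> has_derivative (\<lambda>h. h \<bullet> kernel_grad s X)) (at X)"
    unfolding gderiv_def
    by (rule has_derivative_transform_within_open[where s="- cball 0 \<eta>"])
      (use X in \<open>auto simp: trunc_radial_def max_def\<close>)
  then show ?thesis using X by (simp add: gderiv_def trunc_grad_def)
qed

lemma GDERIV_sum:
  assumes "\<And>i. i \<in> I \<Longrightarrow> GDERIV (f i) X :> (D i :: 'e::euclidean_space)"
  shows "GDERIV (\<lambda>Y. \<Sum>i\<in>I. f i Y) X :> (\<Sum>i\<in>I. D i)"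
  using assms unfolding gderiv_def inner_sum_right by (intro has_derivative_sum)

context riesz_extension
begin

text \<open>By homogeneity \<open>annulus_mass / ln 2\<close> is the weighted area of the unit
  sphere, so this is the total flux of minus the kernel gradient. \<open>flux_constant_eq\<close>
  identifies it with the constant of the kernel.\<close>

definition flux_coefficient :: real where
  "flux_coefficient = kernel_slope s * annulus_mass / ln 2"

lemma flux_coefficient_pos: "flux_coefficient > 0"
  using kernel_slope_pos[OF s_nonneg] annulus_mass_pos by (simp add: flux_coefficient_def)

lemma sphere_mean_0:
  assumes [measurable]: "\<phi> \<in> borel_measurable borel"
  shows "sphere_mean 0 \<phi> a = \<phi> a"
  using sphere_mean_deviation[of \<phi> 0 a "\<phi> a" 0] by simp

text \<open>Translation by \<iota> z leaves \<open>w\<close> unchanged, and \<open>hdim_s\<close>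
  turns \<open>w\<close> times the kernel gradient into \<open>- kernel_slope s\<close> times the
  flux density times X, so that \<open>flux_at_0\<close> applies; the two minus signs cancel. The
  finite sets \<open>S X\<close> hold the times at which a ray meets a kink of
  \<open>U\<close>.\<close>

lemma flux_identity:
  fixes U :: "'e \<Rightarrow> real" and UG :: "'e \<Rightarrow> 'e" and z :: 'a
  assumes \<eta>: "\<eta> \<ge> 0" and UG[measurable]: "UG \<in> borel_measurable borel" and U: "\<And>X. isCont U X"
    and U_lim: "(U \<longlongrightarrow> 0) at_infinity"
    and exceptional: "\<And>X. X \<noteq> 0 \<Longrightarrow> finite (S X)"
    and deriv: "\<And>X t. X \<notin> N \<Longrightarrow> X \<noteq> 0 \<Longrightarrow> t > 0 \<Longrightarrow> t \<notin> S X \<Longrightarrow> GDERIV U (\<iota> z + t *\<^sub>R X) :> UG (\<iota> z + t *\<^sub>R X)"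
    and int: "integrable lborel (\<lambda>X. w X * (indicator {Y. \<eta> < norm Y} (X - \<iota> z) *\<^sub>R kernel_grad s (X - \<iota> z) \<bullet> UG X))"
  shows "(\<integral>X. w X * (indicator {Y. \<eta> < norm Y} (X - \<iota> z) *\<^sub>R kernel_grad s (X - \<iota> z) \<bullet> UG X) \<partial>lborel)
    = flux_coefficient * sphere_mean \<eta> U (\<iota> z)"
proof -
  let ?\<kappa> = "kernel_slope s"
  let ?f = "\<lambda>X. w X * (indicator {Y. \<eta> < norm Y} (X - \<iota> z) *\<^sub>R kernel_grad s (X - \<iota> z) \<bullet> UG X)"
  let ?g = "\<lambda>X. indicator {X. \<eta> < norm X} X * (flux_density X * (X \<bullet> UG (X + \<iota> z)))"
  have \<kappa>: "?\<kappa> > 0" by (rule kernel_slope_pos[OF s_nonneg])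
  have [measurable]: "U \<in> borel_measurable borel"
    by (intro borel_measurable_continuous_onI continuous_at_imp_continuous_on ballI U)
  have fg: "?f (X + \<iota> z) = - ?\<kappa> * ?g X" for X
  proof -
    have "norm X powr (- hdim) = norm X powr (- s - 2)" by (simp add: hdim_s)
    then show ?thesis
      by (simp add: w_translate flux_density_def kernel_grad_def)
  qed
  have "integrable lborel (\<lambda>X. ?f (X + \<iota> z))" by (rule lborel_integrable_translate[OF int])
  then have g_int: "integrable lborel ?g"
    unfolding fg using \<kappa> by simp
  have main: "(\<integral>X. ?g X \<partial>lborel) = - (annulus_mass / ln 2) * sphere_mean \<eta> (\<lambda>Y. U (Y + \<iota> z)) 0"
  proof (rule flux_at_0[OF \<eta> _ _ g_int])
    show "AE X in lborel. X \<noteq> 0 \<longrightarrow>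
      (\<forall>p q. \<eta> / norm X < p \<longrightarrow> p \<le> q \<longrightarrow>
        ((\<lambda>t. X \<bullet> UG (t *\<^sub>R X + \<iota> z)) has_integral (U (q *\<^sub>R X + \<iota> z) - U (p *\<^sub>R X + \<iota> z))) {p..q}) \<and>
      ((\<lambda>t. U (t *\<^sub>R X + \<iota> z)) \<longlongrightarrow> U ((\<eta> / norm X) *\<^sub>R X + \<iota> z)) (at_right (\<eta> / norm X)) \<and>
      ((\<lambda>t. U (t *\<^sub>R X + \<iota> z)) \<longlongrightarrow> 0) at_top"
      using N_null
    proof eventually_elim
      case (elim X)
      show ?case
      proof (intro impI conjI allI)
        assume X: "X \<noteq> 0"
        have cont: "isCont (\<lambda>t. U (t *\<^sub>R X + \<iota> z)) t" for t
          by (rule isCont_o2[OF _ U]) (intro continuous_intros)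
        show "((\<lambda>t. U (t *\<^sub>R X + \<iota> z)) \<longlongrightarrow> U ((\<eta> / norm X) *\<^sub>R X + \<iota> z)) (at_right (\<eta> / norm X))"
          using cont[of "\<eta> / norm X"] unfolding isCont_def by (rule tendsto_within_subset) simp
        have "filterlim (\<lambda>t. norm (t *\<^sub>R X + \<iota> z)) at_top at_top"
        proof (rule filterlim_at_top_mono)
          show "filterlim (\<lambda>t. t * norm X + (- norm (\<iota> z))) at_top at_top"
            by (rule filterlim_tendsto_add_at_top[where f="\<lambda>t. - norm (\<iota> z)", unfolded add.commute[of "- norm (\<iota> z)"]])
              (use X in \<open>auto intro!: filterlim_at_top_mult_tendsto_pos[OF tendsto_const] filterlim_ident\<close>)
          show "\<forall>\<^sub>F t in at_top. t * norm X + (- norm (\<iota> z)) \<le> norm (t *\<^sub>R X + \<iota> z)"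
            using eventually_ge_at_top[of 0]
          proof eventually_elim
            case (elim t)
            then show ?case using norm_diff_ineq[of "t *\<^sub>R X" "\<iota> z"] by simp
          qed
        qed
        then have "filterlim (\<lambda>t. t *\<^sub>R X + \<iota> z) at_infinity at_top"
          by (simp add: filterlim_at_infinity_conv_norm_at_top)
        then show "((\<lambda>t. U (t *\<^sub>R X + \<iota> z)) \<longlongrightarrow> 0) at_top"
          by (rule filterlim_compose[OF U_lim])
        fix p q assume p: "\<eta> / norm X < p" and q: "p \<le> q"
        moreover have "0 \<le> \<eta> / norm X" using \<eta> by simp
        \<comment> \<open>Staying at positive times keeps the segment away from \<iota> z, which may
          itself lie in \<open>N\<close>.\<close>
        ultimately have "p > 0" by linarith
        show "((\<lambda>t. X \<bullet> UG (t *\<^sub>R X + \<iota> z)) has_integral (U (q *\<^sub>R X + \<iota> z) - U (p *\<^sub>R X + \<iota> z))) {p..q}"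
        proof (rule fundamental_theorem_of_calculus_interior_strong[OF exceptional[OF X] q])
          show "continuous_on {p..q} (\<lambda>t. U (t *\<^sub>R X + \<iota> z))"
            using cont by (intro continuous_at_imp_continuous_on) auto
          fix t assume t: "t \<in> {p<..<q} - S X"
          have "GDERIV U (\<iota> z + t *\<^sub>R X) :> UG (\<iota> z + t *\<^sub>R X)"
            using t \<open>p > 0\<close> elim X by (intro deriv) auto
          then have D: "(U has_derivative (\<lambda>h. h \<bullet> UG (t *\<^sub>R X + \<iota> z))) (at (t *\<^sub>R X + \<iota> z))"
            by (simp add: gderiv_def add.commute)
          have "((\<lambda>t. t *\<^sub>R X + \<iota> z) has_derivative (\<lambda>h. h *\<^sub>R X)) (at t)"
            by (auto intro!: derivative_eq_intros)
          from has_derivative_compose[OF this D]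
          show "((\<lambda>t. U (t *\<^sub>R X + \<iota> z)) has_vector_derivative X \<bullet> UG (t *\<^sub>R X + \<iota> z)) (at t)"
            by (simp add: has_vector_derivative_def)
        qed
      qed
    qed
  qed measurable
  have "(\<integral>X. ?f X \<partial>lborel) = (\<integral>X. ?f (X + \<iota> z) \<partial>lborel)"
    by (intro lborel_integral_translate[symmetric]) measurable
  also have "\<dots> = - ?\<kappa> * (\<integral>X. ?g X \<partial>lborel)"
    unfolding fg by simp
  also have "\<dots> = flux_coefficient * sphere_mean \<eta> (\<lambda>Y. U (Y + \<iota> z)) 0"
    unfolding main by (simp add: flux_coefficient_def)
  also have "sphere_mean \<eta> (\<lambda>Y. U (Y + \<iota> z)) 0 = sphere_mean \<eta> U (\<iota> z)"
    by (simp add: sphere_mean_def add.commute)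
  finally show ?thesis .
qed

end

section \<open>Decay and gradient bounds of the neutral truncated potential\<close>

locale riesz_configuration = riesz_potential w p s \<iota> \<pi> b \<sigma> N \<mu> M R0
  for w :: "'e::euclidean_space \<Rightarrow> real" and p s and \<iota> :: "'a::euclidean_space \<Rightarrow> 'e" and \<pi> b \<sigma> N
    and \<mu> :: "'a measure" and M R0 +
  fixes n :: nat and x :: "nat \<Rightarrow> 'a"
  assumes n_ge_1: "n \<ge> 1" and x_inj: "inj_on x {1..n}"
    and x_le: "i \<in> {1..n} \<Longrightarrow> norm (x i) \<le> R0"
begin

text \<open>When the measure and the points are the rescaled ones, this agrees with the truncated
  blown-up potential away from the points. The truncation is built into each term, so
  \<open>U\<close> is continuous everywhere.\<close>

definition U :: "real \<Rightarrow> 'e \<Rightarrow> real" where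
  "U \<eta> X = (\<Sum>i\<in>{1..n}. trunc_radial s \<eta> (X - \<iota> (x i))) - real n * H X"

definition U_grad :: "real \<Rightarrow> 'e \<Rightarrow> 'e" where
  "U_grad \<eta> X = (\<Sum>i\<in>{1..n}. trunc_grad s \<eta> (X - \<iota> (x i))) - real n *\<^sub>R H_grad X"

lemma prob_UNIV: "prob UNIV = 1"
  using prob_space by simp

lemma U_grad_measurable [measurable]: "U_grad \<eta> \<in> borel_measurable borel"
  unfolding U_grad_def by measurable

lemma U_isCont: "\<eta> > 0 \<Longrightarrow> isCont (U \<eta>) X"
  unfolding U_def
  by (intro continuous_diff continuous_sum continuous_mult continuous_const H_isCont)
    (rule isCont_o2[OF _ trunc_radial_isCont], intro continuous_intros)

lemma U_measurable [measurable]: "U \<eta> \<in> borel_measurable borel"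
  unfolding U_def by measurable

lemma U_deriv:
  assumes "\<eta> > 0" "X \<notin> N" "\<And>i. i \<in> {1..n} \<Longrightarrow> norm (X - \<iota> (x i)) \<noteq> \<eta>"
  shows "GDERIV (U \<eta>) X :> U_grad \<eta> X"
proof -
  have "GDERIV (\<lambda>Y. \<Sum>i\<in>{1..n}. trunc_radial s \<eta> (Y - \<iota> (x i))) X :> (\<Sum>i\<in>{1..n}. trunc_grad s \<eta> (X - \<iota> (x i)))"
    using assms by (intro GDERIV_sum GDERIV_translate trunc_radial_deriv) auto
  moreover have "GDERIV (\<lambda>Y. real n * H Y) X :> (real n *\<^sub>R H_grad X + H X *\<^sub>R 0)"
    by (rule GDERIV_mult[OF GDERIV_const H_deriv[OF assms(2)], of "real n"])
  ultimately show ?thesis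
    unfolding U_def U_grad_def using GDERIV_diff by fastforce
qed

lemma norm_diff_emb_ge:
  assumes "norm z \<le> R0" "2 * R0 \<le> norm X"
  shows "norm X / 2 \<le> norm (X - \<iota> z)"
  using norm_triangle_ineq2[of X "\<iota> z"] assms by (simp add: norm_emb)

text \<open>Neutrality: the sum pairs each point with one copy of \<mu>, so only differences of
  kernels over a set of bounded diameter remain. For the logarithm this is what makes the potential
  vanish at infinity at all.\<close>

lemma U_at_infinity:
  assumes "0 < \<eta>" "\<eta> \<le> 1"
  shows "(U \<eta> \<longlongrightarrow> 0) at_infinity"
proof -
  \<comment> \<open>The power of 2 comes from evaluating the slope at half the norm of
    \<open>X\<close>, and \<open>2 * R0\<close> bounds the distance between two charges.\<close>
  define C where "C = real n * (kernel_slope s * 2 powr (s + 1) * (2 * R0))"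
  have bound: "\<bar>U \<eta> X\<bar> \<le> C * norm X powr (- s - 1)" if X: "2 * R0 \<le> norm X" for X
  proof -
    have X0: "norm X > 0" using X R0_ge_1 by linarith
    let ?k = "\<lambda>z. kernel_radial s (norm (X - \<iota> z))"
    define B where "B = kernel_slope s * 2 powr (s + 1) * (2 * R0) * norm X powr (- s - 1)"
    have B0: "B \<ge> 0" using kernel_slope_pos[OF s_nonneg] R0_ge_1 by (simp add: B_def)
    have each: "\<bar>trunc_radial s \<eta> (X - \<iota> (x i)) - H X\<bar> \<le> B" if i: "i \<in> {1..n}" for i
    proof -
      have "\<eta> \<le> norm (X - \<iota> (x i))"
        using norm_diff_emb_ge[OF x_le[OF i] X] X R0_ge_1 assms by linarith
      then have "trunc_radial s \<eta> (X - \<iota> (x i)) - H X = ?k (x i) - (\<integral>z. ?k z \<partial>\<mu>)"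
        by (simp add: trunc_radial_def H_def max_def)
      also have "\<dots> = (\<integral>z. ?k (x i) - ?k z \<partial>\<mu>)"
        using kernel_integrable by (subst Bochner_Integration.integral_diff) (auto simp: prob_UNIV)
      finally have eq: "trunc_radial s \<eta> (X - \<iota> (x i)) - H X = (\<integral>z. ?k (x i) - ?k z \<partial>\<mu>)" .
      have "\<bar>\<integral>z. ?k (x i) - ?k z \<partial>\<mu>\<bar> \<le> (\<integral>z. B \<partial>\<mu>)"
      proof (rule order_trans[OF integral_abs_bound], rule integral_mono_AE)
        show "AE z in \<mu>. \<bar>?k (x i) - ?k z\<bar> \<le> B"
          using support
        proof eventually_elim
          case (elim z)
          have "\<bar>?k (x i) - ?k z\<bar> \<le> kernel_slope s * (norm X / 2) powr (- s - 1) * \<bar>norm (X - \<iota> (x i)) - norm (X - \<iota> z)\<bar>"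
            using norm_diff_emb_ge[OF x_le[OF i] X] norm_diff_emb_ge[OF elim X] X0
            by (intro kernel_radial_diff_le s_nonneg) auto
          also have "\<dots> \<le> kernel_slope s * (norm X / 2) powr (- s - 1) * (2 * R0)"
          proof (intro mult_left_mono)
            have "\<bar>norm (X - \<iota> (x i)) - norm (X - \<iota> z)\<bar> \<le> norm (\<iota> z - \<iota> (x i))"
              using norm_triangle_ineq3[of "X - \<iota> (x i)" "X - \<iota> z"] by simp
            also have "\<dots> \<le> norm (\<iota> z) + norm (\<iota> (x i))" by (rule norm_triangle_ineq4)
            also have "\<dots> \<le> 2 * R0" using elim x_le[OF i] by (simp add: norm_emb)
            finally show "\<bar>norm (X - \<iota> (x i)) - norm (X - \<iota> z)\<bar> \<le> 2 * R0" .
          qed (use kernel_slope_pos[OF s_nonneg] in auto)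
          also have "(norm X / 2) powr (- s - 1) = norm X powr (- s - 1) * 2 powr (s + 1)"
            using half_powr[OF X0, of "s + 1"] by simp
          finally show ?case by (simp add: B_def mult_ac)
        qed
      qed (use kernel_integrable in auto)
      then show ?thesis unfolding eq by (simp add: prob_UNIV)
    qed
    have "U \<eta> X = (\<Sum>i\<in>{1..n}. trunc_radial s \<eta> (X - \<iota> (x i)) - H X)"
      by (simp add: U_def sum_subtractf)
    then have "\<bar>U \<eta> X\<bar> \<le> (\<Sum>i\<in>{1..n}. B)"
      using sum_abs[of "\<lambda>i. trunc_radial s \<eta> (X - \<iota> (x i)) - H X" "{1..n}"] sum_mono[OF each]
      by (smt (verit) sum_mono each)
    then show ?thesis by (simp add: C_def B_def mult_ac)
  qed
  have "((\<lambda>X. C * norm X powr (- s - 1)) \<longlongrightarrow> C * 0) (at_infinity :: 'e filter)"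
    using s_nonneg by (intro tendsto_intros tendsto_neg_powr filterlim_at_infinity_imp_norm_at_top filterlim_ident) auto
  then have "((\<lambda>X. C * norm X powr (- s - 1)) \<longlongrightarrow> 0) (at_infinity :: 'e filter)" by simp
  moreover have "\<forall>\<^sub>F X in at_infinity. norm (U \<eta> X) \<le> C * norm X powr (- s - 1)"
    using bound by (auto simp: eventually_at_infinity)
  ultimately show ?thesis by (rule Lim_null_comparison[rotated])
qed

text \<open>The same pairing for gradients gains one power over the decay -s-1 of a single kernel
  gradient. \<open>N\<close> is excluded so that the background integral can be subtracted
  inside.\<close>

lemma U_grad_decay:
  assumes "\<eta> < 1"
  obtains C where "C \<ge> 0"
    "\<And>X. X \<notin> N \<Longrightarrow> 2 * R0 \<le> norm X \<Longrightarrow> norm (U_grad \<eta> X) \<le> C * norm X powr (- s - 2)"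
proof
  define D where "D = kernel_slope s * (s + 3) * 2 powr (s + 2) * (2 * R0)"
  have \<kappa>: "kernel_slope s > 0" by (rule kernel_slope_pos[OF s_nonneg])
  have D0: "D \<ge> 0" using \<kappa> R0_ge_1 s_nonneg by (simp add: D_def)
  then show "real n * D \<ge> 0" by simp
  fix X assume N: "X \<notin> N" and X: "2 * R0 \<le> norm X"
  have X0: "norm X > 0" using X R0_ge_1 by linarith
  let ?k = "\<lambda>z. kernel_grad s (X - \<iota> z)"
  define B where "B = D * norm X powr (- s - 2)"
  have each: "norm (trunc_grad s \<eta> (X - \<iota> (x i)) - H_grad X) \<le> B" if i: "i \<in> {1..n}" for i
  proof -
    have "\<eta> < norm (X - \<iota> (x i))"
      using norm_diff_emb_ge[OF x_le[OF i] X] X R0_ge_1 assms by linarith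
    then have "trunc_grad s \<eta> (X - \<iota> (x i)) - H_grad X = ?k (x i) - (\<integral>z. ?k z \<partial>\<mu>)"
      by (simp add: trunc_grad_def H_grad_def)
    also have "\<dots> = (\<integral>z. ?k (x i) - ?k z \<partial>\<mu>)"
      using kernel_grad_integrable[OF N] by (subst Bochner_Integration.integral_diff) (auto simp: prob_UNIV)
    finally have eq: "trunc_grad s \<eta> (X - \<iota> (x i)) - H_grad X = (\<integral>z. ?k (x i) - ?k z \<partial>\<mu>)" .
    have "norm (\<integral>z. ?k (x i) - ?k z \<partial>\<mu>) \<le> (\<integral>z. B \<partial>\<mu>)"
    proof (rule order_trans[OF integral_norm_bound], rule integral_mono_AE)
      show "AE z in \<mu>. norm (?k (x i) - ?k z) \<le> B"
        using support
      proof eventually_elim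
        case (elim z)
        have "norm (?k (x i) - ?k z) \<le> kernel_slope s * (s + 3) * (norm X / 2) powr (- s - 2)
            * norm ((X - \<iota> (x i)) - (X - \<iota> z))"
          using norm_diff_emb_ge[OF x_le[OF i] X] norm_diff_emb_ge[OF elim X] X0
          by (intro kernel_grad_diff_le s_nonneg) auto
        also have "\<dots> \<le> kernel_slope s * (s + 3) * (norm X / 2) powr (- s - 2) * (2 * R0)"
        proof (intro mult_left_mono)
          have "norm ((X - \<iota> (x i)) - (X - \<iota> z)) \<le> norm (\<iota> z) + norm (\<iota> (x i))"
            using norm_triangle_ineq4[of "\<iota> z" "\<iota> (x i)"] by simp
          also have "\<dots> \<le> 2 * R0" using elim x_le[OF i] by (simp add: norm_emb)
          finally show "norm ((X - \<iota> (x i)) - (X - \<iota> z)) \<le> 2 * R0" .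
        qed (use \<kappa> s_nonneg in auto)
        also have "(norm X / 2) powr (- s - 2) = norm X powr (- s - 2) * 2 powr (s + 2)"
          using half_powr[OF X0, of "s + 2"] by simp
        finally show ?case by (simp add: B_def D_def mult_ac)
      qed
    qed (use kernel_grad_integrable[OF N] in auto)
    then show ?thesis unfolding eq by (simp add: prob_UNIV)
  qed
  have "U_grad \<eta> X = (\<Sum>i\<in>{1..n}. trunc_grad s \<eta> (X - \<iota> (x i)) - H_grad X)"
    by (simp add: U_grad_def sum_subtractf sum_constant_scaleR)
  moreover have "norm (\<Sum>i\<in>{1..n}. trunc_grad s \<eta> (X - \<iota> (x i)) - H_grad X) \<le> (\<Sum>i\<in>{1..n}. B)"
    by (rule order_trans[OF norm_sum], rule sum_mono, rule each)
  ultimately have "norm (U_grad \<eta> X) \<le> (\<Sum>i\<in>{1..n}. B)" by simp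
  then show "norm (U_grad \<eta> X) \<le> real n * D * norm X powr (- s - 2)"
    by (simp add: B_def mult_ac)
qed

lemma trunc_grad_norm_le:
  assumes "\<eta> > 0"
  shows "norm (trunc_grad s \<eta> Y) \<le> kernel_slope s * \<eta> powr (- s - 1)"
proof (cases "\<eta> < norm Y")
  case True
  then have "norm Y powr (- s - 1) \<le> \<eta> powr (- s - 1)"
    using assms s_nonneg by (intro powr_mono2') auto
  then show ?thesis
    using True kernel_slope_pos[OF s_nonneg] by (simp add: trunc_grad_def norm_kernel_grad s_nonneg)
next
  case False
  then show ?thesis using kernel_slope_pos[OF s_nonneg] by (simp add: trunc_grad_def)
qed

section \<open>Integrability of the flux integrands\<close>

lemma norm_H_grad_le:
  "ennreal (norm (H_grad X)) \<le> (\<integral>\<^sup>+ z. ennreal (norm (kernel_grad s (X - \<iota> z))) \<partial>\<mu>)"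
proof (cases "integrable \<mu> (\<lambda>z. kernel_grad s (X - \<iota> z))")
  case True
  then show ?thesis unfolding H_grad_def by (rule integral_norm_bound_ennreal)
qed (simp add: H_grad_def not_integrable_integral_eq)

lemma U_grad_bound:
  assumes "\<eta> > 0"
  obtains C where "C \<ge> 0" "\<And>X. X \<notin> N \<Longrightarrow> norm (U_grad \<eta> X) \<le> C * b X"
proof -
  obtain D where D: "D \<ge> 1"
    "\<And>X. X \<notin> N \<Longrightarrow> (\<integral>\<^sup>+ z. ennreal (norm (kernel_grad s (X - \<iota> z))) \<partial>\<mu>) \<le> ennreal (D * b X)"
    using kernel_grad_bound by metis
  let ?T = "kernel_slope s * \<eta> powr (- s - 1)"
  have T: "?T \<ge> 0" using kernel_slope_pos[OF s_nonneg] by simp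
  have "norm (U_grad \<eta> X) \<le> (real n * ?T + real n * D) * b X" if X: "X \<notin> N" for X
  proof -
    have b1: "1 \<le> b X" by (rule b_ge_1)
    have "norm (H_grad X) \<le> D * b X"
      using order_trans[OF norm_H_grad_le D(2)[OF X]] D(1) b1 by simp
    then have "norm (real n *\<^sub>R H_grad X) \<le> real n * (D * b X)"
      by (simp add: mult_left_mono)
    moreover have "norm (\<Sum>i\<in>{1..n}. trunc_grad s \<eta> (X - \<iota> (x i))) \<le> real n * ?T"
      by (rule order_trans[OF sum_norm_bound[of _ _ ?T]]) (auto simp: trunc_grad_norm_le[OF assms])
    moreover have "real n * ?T * 1 \<le> real n * ?T * b X"
      using T b1 by (intro mult_left_mono) auto
    ultimately show ?thesis
      using norm_triangle_ineq4[of "\<Sum>i\<in>{1..n}. trunc_grad s \<eta> (X - \<iota> (x i))" "real n *\<^sub>R H_grad X"]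
      unfolding U_grad_def by (simp add: algebra_simps)
  qed
  then show thesis using T D by (intro that[of "real n * ?T + real n * D"]) auto
qed

text \<open>Here f stands for the gradient of a charge that is not neutralised, of decay -s-1. With
  the decay -s-2 of \<open>U_grad\<close> the total exponent 2s+3 exceeds hdim = s+2; two single
  gradients would give 2s+2, which fails for s = 0. Near the origin, the bound by \<open>b\<close>
  squared is integrable by \<open>w_b\<close>.\<close>

lemma weighted_product_finite:
  fixes f :: "'e \<Rightarrow> real"
  assumes \<eta>: "0 < \<eta>" "\<eta> < 1" and f[measurable]: "f \<in> borel_measurable borel" and f0: "\<And>X. 0 \<le> f X"
    and C: "C \<ge> 0" and near: "\<And>X. X \<notin> N \<Longrightarrow> f X \<le> C * b X"
    and far: "\<And>X. X \<notin> N \<Longrightarrow> 2 * R0 \<le> norm X \<Longrightarrow> f X \<le> C * norm X powr (- s - 1)"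
  shows "(\<integral>\<^sup>+ X. ennreal (w X * f X * norm (U_grad \<eta> X)) \<partial>lborel) < \<infinity>"
proof -
  obtain D where D: "D \<ge> 0" "\<And>X. X \<notin> N \<Longrightarrow> norm (U_grad \<eta> X) \<le> D * b X"
    using U_grad_bound[OF \<eta>(1)] by metis
  obtain E where E: "E \<ge> 0"
    "\<And>X. X \<notin> N \<Longrightarrow> 2 * R0 \<le> norm X \<Longrightarrow> norm (U_grad \<eta> X) \<le> E * norm X powr (- s - 2)"
    using U_grad_decay[OF \<eta>(2)] by metis
  have R: "2 * R0 > 0" using R0_ge_1 by simp
  let ?near = "\<lambda>X. ennreal (w X * (b X)\<^sup>2) * indicator (ball 0 (2 * R0)) X"
  let ?far = "\<lambda>X. ennreal (w X * norm X powr (- (2 * s + 3))) * indicator (- ball 0 (2 * R0)) X"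
  have "(\<integral>\<^sup>+ X. ennreal (w X * f X * norm (U_grad \<eta> X)) \<partial>lborel)
      \<le> (\<integral>\<^sup>+ X. ennreal (C * D) * ?near X + ennreal (C * E) * ?far X \<partial>lborel)"
  proof (rule nn_integral_mono_AE, use N_null in eventually_elim)
    case (elim X)
    show ?case
    proof (cases "norm X < 2 * R0")
      case True
      have "f X * norm (U_grad \<eta> X) \<le> (C * b X) * (D * b X)"
        using near[OF elim] D(2)[OF elim] C b_ge_1[of X] by (intro mult_mono) auto
      then have "w X * (f X * norm (U_grad \<eta> X)) \<le> w X * ((C * b X) * (D * b X))"
        by (intro mult_left_mono w_nonneg)
      then have "ennreal (w X * f X * norm (U_grad \<eta> X)) \<le> ennreal ((C * D) * (w X * (b X)\<^sup>2))"
        by (intro ennreal_leI) (simp add: power2_eq_square mult_ac)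
      then show ?thesis
        using True C D by (simp add: ennreal_mult' dist_norm)
    next
      case False
      then have X: "2 * R0 \<le> norm X" by simp
      then have X0: "norm X > 0" using R by linarith
      have "f X * norm (U_grad \<eta> X) \<le> (C * norm X powr (- s - 1)) * (E * norm X powr (- s - 2))"
        using far[OF elim X] E(2)[OF elim X] C by (intro mult_mono) auto
      also have "\<dots> = (C * E) * (norm X powr (- s - 1) * norm X powr (- s - 2))"
        by (simp only: mult_ac)
      also have "norm X powr (- s - 1) * norm X powr (- s - 2) = norm X powr (- (2 * s + 3))"
        by (simp add: powr_add[symmetric])
      finally have "w X * (f X * norm (U_grad \<eta> X)) \<le> w X * (C * E * norm X powr (- (2 * s + 3)))"
        by (intro mult_left_mono w_nonneg)
      then have "ennreal (w X * f X * norm (U_grad \<eta> X)) \<le> ennreal ((C * E) * (w X * norm X powr (- (2 * s + 3))))"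
        by (intro ennreal_leI) (simp only: mult_ac)
      then show ?thesis
        using False C E by (simp add: ennreal_mult' dist_norm)
    qed
  qed
  also have "\<dots> = ennreal (C * D) * (\<integral>\<^sup>+ X. ?near X \<partial>lborel) + ennreal (C * E) * (\<integral>\<^sup>+ X. ?far X \<partial>lborel)"
    by (subst nn_integral_add, measurable, subst nn_integral_cmult, measurable, subst nn_integral_cmult, measurable)
  also have "\<dots> < \<infinity>"
    using w_b[OF R] weight_powr_large[of "2 * s + 3" "2 * R0"] R s_nonneg
    by (simp add: ennreal_mult_less_top hdim_s)
  finally show ?thesis .
qed

text \<open>The absolute convergence that allows exchanging the integrals over X and over the
  background in \<open>energy_identity\<close>. The inner integral over z obeys the near and far
  bounds of \<open>weighted_product_finite\<close>.\<close>

lemma kernel_grad_mean_finite: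
  assumes \<eta>: "0 < \<eta>" "\<eta> < 1"
  shows "(\<integral>\<^sup>+ X. (\<integral>\<^sup>+ z. ennreal (w X * norm (kernel_grad s (X - \<iota> z)) * norm (U_grad \<eta> X)) \<partial>\<mu>) \<partial>lborel) < \<infinity>"
proof -
  obtain D where D: "D \<ge> 1"
    "\<And>X. X \<notin> N \<Longrightarrow> (\<integral>\<^sup>+ z. ennreal (norm (kernel_grad s (X - \<iota> z))) \<partial>\<mu>) \<le> ennreal (D * b X)"
    using kernel_grad_bound by metis
  have \<kappa>: "kernel_slope s > 0" by (rule kernel_slope_pos[OF s_nonneg])
  define f where "f X = enn2real (\<integral>\<^sup>+ z. ennreal (norm (kernel_grad s (X - \<iota> z))) \<partial>\<mu>)" for X
  define C where "C = max D (kernel_slope s * 2 powr (s + 1))"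
  have [measurable]: "f \<in> borel_measurable borel" unfolding f_def by measurable
  have f_eq: "(\<integral>\<^sup>+ z. ennreal (norm (kernel_grad s (X - \<iota> z))) \<partial>\<mu>) = ennreal (f X)" if "X \<notin> N" for X
    using D(2)[OF that] unfolding f_def by (intro ennreal_enn2real[symmetric]) (auto intro: order.strict_trans1)
  have "(\<integral>\<^sup>+ X. (\<integral>\<^sup>+ z. ennreal (w X * norm (kernel_grad s (X - \<iota> z)) * norm (U_grad \<eta> X)) \<partial>\<mu>) \<partial>lborel)
      = (\<integral>\<^sup>+ X. ennreal (w X * f X * norm (U_grad \<eta> X)) \<partial>lborel)"
  proof (rule nn_integral_cong_AE, use N_null in eventually_elim)
    case (elim X)
    have "(\<integral>\<^sup>+ z. ennreal (w X * norm (kernel_grad s (X - \<iota> z)) * norm (U_grad \<eta> X)) \<partial>\<mu>)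
        = (\<integral>\<^sup>+ z. ennreal (w X * norm (U_grad \<eta> X)) * ennreal (norm (kernel_grad s (X - \<iota> z))) \<partial>\<mu>)"
      by (intro nn_integral_cong) (simp add: ennreal_mult[symmetric] w_nonneg mult_ac)
    also have "\<dots> = ennreal (w X * norm (U_grad \<eta> X)) * ennreal (f X)"
      by (subst nn_integral_cmult) (auto simp: f_eq[OF elim])
    also have "\<dots> = ennreal (w X * f X * norm (U_grad \<eta> X))"
      by (simp add: ennreal_mult[symmetric] w_nonneg f_def mult_ac)
    finally show ?case .
  qed
  also have "\<dots> < \<infinity>"
  proof (rule weighted_product_finite[OF \<eta>])
    show "C \<ge> 0" using D by (simp add: C_def)
    show "0 \<le> f X" for X by (simp add: f_def)
    show "f X \<le> C * b X" if "X \<notin> N" for X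
    proof -
      have "f X \<le> D * b X"
        using D(2)[OF that] D(1) b_ge_1[of X] f_eq[OF that] by simp
      also have "\<dots> \<le> C * b X" using b_ge_1[of X] by (intro mult_right_mono) (auto simp: C_def)
      finally show ?thesis .
    qed
    show "f X \<le> C * norm X powr (- s - 1)" if N: "X \<notin> N" and X: "2 * R0 \<le> norm X" for X
    proof -
      have X0: "norm X > 0" using X R0_ge_1 by linarith
      let ?c = "kernel_slope s * (norm X powr (- s - 1) * 2 powr (s + 1))"
      have "ennreal (f X) \<le> (\<integral>\<^sup>+ z. ennreal ?c \<partial>\<mu>)"
        unfolding f_eq[OF N, symmetric]
      proof (rule nn_integral_mono_AE, use support in eventually_elim)
        case (elim z)
        have "norm (X - \<iota> z) powr (- s - 1) \<le> (norm X / 2) powr (- s - 1)"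
          using norm_diff_emb_ge[OF elim X] X0 s_nonneg by (intro powr_mono2') auto
        also have "\<dots> = norm X powr (- s - 1) * 2 powr (s + 1)"
          using half_powr[OF X0, of "s + 1"] by simp
        finally show ?case
          using \<kappa> by (intro ennreal_leI) (simp add: norm_kernel_grad s_nonneg)
      qed
      then have "f X \<le> ?c"
        using \<kappa> by (simp add: emeasure_space_1[unfolded space_mu])
      also have "\<dots> = (kernel_slope s * 2 powr (s + 1)) * norm X powr (- s - 1)" by (simp only: mult_ac)
      also have "\<dots> \<le> C * norm X powr (- s - 1)" by (intro mult_right_mono) (auto simp: C_def)
      finally show ?thesis .
    qed
  qed measurable
  finally show ?thesis .
qed

text \<open>The radius r of the test charge is independent of the truncation \<eta> of the
  potential: r = \<eta> is used for the points and r = 0 for the background. The exceptional times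
  are the crossings of the ray with the truncation spheres.\<close>

lemma flux_U:
  assumes \<eta>: "0 < \<eta>" "\<eta> < 1" and r: "r \<ge> 0"
    and int: "integrable lborel (\<lambda>X. w X * (trunc_grad s r (X - \<iota> z) \<bullet> U_grad \<eta> X))"
  shows "(\<integral>X. w X * (trunc_grad s r (X - \<iota> z) \<bullet> U_grad \<eta> X) \<partial>lborel)
    = flux_coefficient * sphere_mean r (U \<eta>) (\<iota> z)"
  unfolding trunc_grad_def
proof (rule flux_identity[OF r U_grad_measurable U_isCont[OF \<eta>(1)] U_at_infinity])
  let ?S = "\<lambda>X. \<Union>i\<in>{1..n}. {t. norm (t *\<^sub>R X + (\<iota> z - \<iota> (x i))) = \<eta>}"
  show "finite (?S X)" if "X \<noteq> 0" for X
    using finite_line_sphere[OF that] by blast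
  show "GDERIV (U \<eta>) (\<iota> z + t *\<^sub>R X) :> U_grad \<eta> (\<iota> z + t *\<^sub>R X)"
    if "X \<notin> N" "X \<noteq> 0" "t > 0" "t \<notin> ?S X" for X t
  proof (rule U_deriv[OF \<eta>(1)])
    show "\<iota> z + t *\<^sub>R X \<notin> N" by (rule N_ray[OF that(3,1)])
    show "norm (\<iota> z + t *\<^sub>R X - \<iota> (x i)) \<noteq> \<eta>" if "i \<in> {1..n}" for i
      using \<open>t \<notin> ?S X\<close> that by (auto simp: algebra_simps)
  qed
  show "integrable lborel (\<lambda>X. w X * (indicator {Y. r < norm Y} (X - \<iota> z) *\<^sub>R kernel_grad s (X - \<iota> z) \<bullet> U_grad \<eta> X))"
    using int by (simp add: trunc_grad_def)
qed (use \<eta> in auto)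

lemma trunc_grad_0: "trunc_grad s 0 X = kernel_grad s X"
  by (auto simp: trunc_grad_def kernel_grad_def)

text \<open>Only one of the two factors of the squared gradient is expanded; every kernel gradient
  in it then pairs with \<open>U_grad\<close> as a flux. The nonnegativity in the second claim is
  needed to read the \<open>ennreal\<close> value as a real number.\<close>

lemma energy_identity:
  assumes \<eta>: "0 < \<eta>" "\<eta> < 1"
  shows "(\<integral>\<^sup>+ X. ennreal (w X * (norm (U_grad \<eta> X))\<^sup>2) \<partial>lborel)
      = ennreal (flux_coefficient * ((\<Sum>i\<in>{1..n}. sphere_mean \<eta> (U \<eta>) (\<iota> (x i))) - real n * (\<integral>z. U \<eta> (\<iota> z) \<partial>\<mu>)))"
    and "0 \<le> flux_coefficient * ((\<Sum>i\<in>{1..n}. sphere_mean \<eta> (U \<eta>) (\<iota> (x i))) - real n * (\<integral>z. U \<eta> (\<iota> z) \<partial>\<mu>))"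
proof -
  interpret P: pair_sigma_finite lborel \<mu> ..
  have \<kappa>: "kernel_slope s > 0" by (rule kernel_slope_pos[OF s_nonneg])
  let ?t = "\<lambda>i X. w X * (trunc_grad s \<eta> (X - \<iota> (x i)) \<bullet> U_grad \<eta> X)"
  let ?k = "\<lambda>X z. w X * (kernel_grad s (X - \<iota> z) \<bullet> U_grad \<eta> X)"
  have t_int: "integrable lborel (?t i)" if i: "i \<in> {1..n}" for i
  proof (rule integrableI_bounded)
    define C where "C = max (kernel_slope s * \<eta> powr (- s - 1)) (kernel_slope s * 2 powr (s + 1))"
    have C: "C \<ge> 0" using \<kappa> by (simp add: C_def le_max_iff_disj)
    have "(\<integral>\<^sup>+ X. ennreal (norm (?t i X)) \<partial>lborel)
        \<le> (\<integral>\<^sup>+ X. ennreal (w X * norm (trunc_grad s \<eta> (X - \<iota> (x i))) * norm (U_grad \<eta> X)) \<partial>lborel)"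
      using Cauchy_Schwarz_ineq2
      by (intro nn_integral_mono ennreal_leI) (auto simp: abs_mult w_nonneg mult.assoc intro!: mult_left_mono)
    also have "\<dots> < \<infinity>"
    proof (rule weighted_product_finite[OF \<eta> _ _ C])
      show "norm (trunc_grad s \<eta> (X - \<iota> (x i))) \<le> C * b X" for X
      proof -
        have "norm (trunc_grad s \<eta> (X - \<iota> (x i))) \<le> C"
          using trunc_grad_norm_le[OF \<eta>(1), of "X - \<iota> (x i)"] by (simp add: C_def)
        also have "C * 1 \<le> C * b X" using C b_ge_1[of X] by (intro mult_left_mono)
        then have "C \<le> C * b X" by simp
        finally show ?thesis .
      qed
      show "norm (trunc_grad s \<eta> (X - \<iota> (x i))) \<le> C * norm X powr (- s - 1)" if X: "2 * R0 \<le> norm X" for X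
      proof -
        have X0: "norm X > 0" using X R0_ge_1 by linarith
        have "norm (X - \<iota> (x i)) powr (- s - 1) \<le> (norm X / 2) powr (- s - 1)"
          using norm_diff_emb_ge[OF x_le[OF i] X] X0 s_nonneg by (intro powr_mono2') auto
        also have "\<dots> = norm X powr (- s - 1) * 2 powr (s + 1)"
          using half_powr[OF X0, of "s + 1"] by simp
        finally have "kernel_slope s * norm (X - \<iota> (x i)) powr (- s - 1)
            \<le> (kernel_slope s * 2 powr (s + 1)) * norm X powr (- s - 1)"
          using \<kappa> by (simp add: mult.assoc mult.commute[of "2 powr _"])
        also have "\<dots> \<le> C * norm X powr (- s - 1)" by (intro mult_right_mono) (auto simp: C_def)
        finally have "norm (kernel_grad s (X - \<iota> (x i))) \<le> C * norm X powr (- s - 1)"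
          by (simp add: norm_kernel_grad s_nonneg)
        moreover have "norm (trunc_grad s \<eta> (X - \<iota> (x i))) \<le> norm (kernel_grad s (X - \<iota> (x i)))"
          by (simp add: trunc_grad_def indicator_def)
        ultimately show ?thesis by linarith
      qed
    qed auto
    finally show "(\<integral>\<^sup>+ X. ennreal (norm (?t i X)) \<partial>lborel) < \<infinity>" .
  qed measurable
  have k_int: "integrable (lborel \<Otimes>\<^sub>M \<mu>) (\<lambda>(X, z). ?k X z)"
  proof (rule integrableI_bounded)
    have "(\<integral>\<^sup>+ p. ennreal (norm (case p of (X, z) \<Rightarrow> ?k X z)) \<partial>(lborel \<Otimes>\<^sub>M \<mu>))
        = (\<integral>\<^sup>+ X. (\<integral>\<^sup>+ z. ennreal (norm (?k X z)) \<partial>\<mu>) \<partial>lborel)"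
      by (subst nn_integral_fst[symmetric]) auto
    also have "\<dots> \<le> (\<integral>\<^sup>+ X. (\<integral>\<^sup>+ z. ennreal (w X * norm (kernel_grad s (X - \<iota> z)) * norm (U_grad \<eta> X)) \<partial>\<mu>) \<partial>lborel)"
      using Cauchy_Schwarz_ineq2
      by (intro nn_integral_mono ennreal_leI) (auto simp: abs_mult w_nonneg mult.assoc intro!: mult_left_mono)
    also have "\<dots> < \<infinity>" by (rule kernel_grad_mean_finite[OF \<eta>])
    finally show "(\<integral>\<^sup>+ p. ennreal (norm (case p of (X, z) \<Rightarrow> ?k X z)) \<partial>(lborel \<Otimes>\<^sub>M \<mu>)) < \<infinity>" .
  qed measurable
  have k_z: "AE z in \<mu>. integrable lborel (\<lambda>X. ?k X z)"
    using P.AE_integrable_snd[OF k_int] .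
  have k_val: "AE z in \<mu>. (\<integral>X. ?k X z \<partial>lborel) = flux_coefficient * U \<eta> (\<iota> z)"
    using k_z
  proof eventually_elim
    case (elim z)
    then show ?case
      using flux_U[OF \<eta>, of 0 z] by (simp add: trunc_grad_0 sphere_mean_0)
  qed
  have k_H: "AE X in lborel. (\<integral>z. ?k X z \<partial>\<mu>) = w X * (H_grad X \<bullet> U_grad \<eta> X)"
    using N_null
  proof eventually_elim
    case (elim X)
    show ?case
      using kernel_grad_integrable[OF elim] by (simp add: H_grad_def integral_inner_left)
  qed
  have H_int: "integrable lborel (\<lambda>X. w X * (H_grad X \<bullet> U_grad \<eta> X))"
    using P.integrable_fst[OF k_int] k_H by (subst (asm) integrable_cong_AE) auto
  have "(\<integral>X. w X * (H_grad X \<bullet> U_grad \<eta> X) \<partial>lborel) = (\<integral>X. (\<integral>z. ?k X z \<partial>\<mu>) \<partial>lborel)"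
    using k_H by (intro integral_cong_AE) auto
  also have "\<dots> = (\<integral>z. (\<integral>X. ?k X z \<partial>lborel) \<partial>\<mu>)"
    by (rule P.Fubini_integral[OF k_int, symmetric])
  also have "\<dots> = (\<integral>z. flux_coefficient * U \<eta> (\<iota> z) \<partial>\<mu>)"
    using k_val by (intro integral_cong_AE) auto
  finally have H_val: "(\<integral>X. w X * (H_grad X \<bullet> U_grad \<eta> X) \<partial>lborel) = flux_coefficient * (\<integral>z. U \<eta> (\<iota> z) \<partial>\<mu>)"
    by simp
  have split: "w X * (norm (U_grad \<eta> X))\<^sup>2
      = (\<Sum>i\<in>{1..n}. ?t i X) - real n * (w X * (H_grad X \<bullet> U_grad \<eta> X))" for X
  proof -
    have "(norm (U_grad \<eta> X))\<^sup>2 = ((\<Sum>i\<in>{1..n}. trunc_grad s \<eta> (X - \<iota> (x i))) - real n *\<^sub>R H_grad X) \<bullet> U_grad \<eta> X"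
      by (simp only: power2_norm_eq_inner U_grad_def)
    then show ?thesis
      by (simp add: inner_diff_left inner_sum_left sum_distrib_left right_diff_distrib)
  qed
  have sq_int: "integrable lborel (\<lambda>X. w X * (norm (U_grad \<eta> X))\<^sup>2)"
    unfolding split
    by (intro Bochner_Integration.integrable_diff Bochner_Integration.integrable_sum integrable_mult_right t_int H_int)
  have val: "(\<integral>X. w X * (norm (U_grad \<eta> X))\<^sup>2 \<partial>lborel)
      = flux_coefficient * ((\<Sum>i\<in>{1..n}. sphere_mean \<eta> (U \<eta>) (\<iota> (x i))) - real n * (\<integral>z. U \<eta> (\<iota> z) \<partial>\<mu>))"
  proof -
    have "(\<integral>X. w X * (norm (U_grad \<eta> X))\<^sup>2 \<partial>lborel)
        = (\<integral>X. (\<Sum>i\<in>{1..n}. ?t i X) \<partial>lborel) - (\<integral>X. real n * (w X * (H_grad X \<bullet> U_grad \<eta> X)) \<partial>lborel)"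
      unfolding split
      by (intro Bochner_Integration.integral_diff Bochner_Integration.integrable_sum integrable_mult_right t_int H_int)
    also have "(\<integral>X. (\<Sum>i\<in>{1..n}. ?t i X) \<partial>lborel) = (\<Sum>i\<in>{1..n}. \<integral>X. ?t i X \<partial>lborel)"
      using t_int by (rule Bochner_Integration.integral_sum)
    also have "\<dots> = (\<Sum>i\<in>{1..n}. flux_coefficient * sphere_mean \<eta> (U \<eta>) (\<iota> (x i)))"
      using \<eta> t_int by (intro sum.cong refl flux_U) auto
    finally show ?thesis
      by (simp add: H_val sum_distrib_left right_diff_distrib)
  qed
  show "(\<integral>\<^sup>+ X. ennreal (w X * (norm (U_grad \<eta> X))\<^sup>2) \<partial>lborel)
      = ennreal (flux_coefficient * ((\<Sum>i\<in>{1..n}. sphere_mean \<eta> (U \<eta>) (\<iota> (x i))) - real n * (\<integral>z. U \<eta> (\<iota> z) \<partial>\<mu>)))"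
    unfolding val[symmetric] by (intro nn_integral_eq_integral sq_int) (simp add: w_nonneg)
  show "0 \<le> flux_coefficient * ((\<Sum>i\<in>{1..n}. sphere_mean \<eta> (U \<eta>) (\<iota> (x i))) - real n * (\<integral>z. U \<eta> (\<iota> z) \<partial>\<mu>))"
    unfolding val[symmetric] by (intro Bochner_Integration.integral_nonneg) (simp add: w_nonneg)
qed

section \<open>The limit of vanishing truncation\<close>

definition renormalized_energy :: real where
  "renormalized_energy = (1 / real n) * ((\<Sum>i\<in>{1..n}. \<Sum>j\<in>{1..n} - {i}. kernel_radial s (norm (x i - x j)))
     - 2 * real n * (\<Sum>i\<in>{1..n}. H (\<iota> (x i))) + (real n)\<^sup>2 * (\<integral>z. H (\<iota> z) \<partial>\<mu>))"

text \<open>On the sphere of radius \<eta> about a point, its own contribution is the constant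
  kernel value at \<eta>, which is subtracted. If \<eta> is below half of all distances to the other
  points, their truncations are inactive on that sphere, and the remaining potential is continuous
  at the centre.\<close>

lemma sphere_mean_limit:
  assumes i: "i \<in> {1..n}"
  shows "((\<lambda>\<eta>. sphere_mean \<eta> (U \<eta>) (\<iota> (x i)) - kernel_radial s \<eta>)
    \<longlongrightarrow> (\<Sum>j\<in>{1..n} - {i}. kernel_radial s (norm (x i - x j))) - real n * H (\<iota> (x i))) (at_right 0)"
proof -
  let ?J = "{1..n} - {i}"
  let ?a = "\<iota> (x i)"
  define \<Psi> where "\<Psi> Y = (\<Sum>j\<in>?J. kernel_radial s (norm (Y - \<iota> (x j)))) - real n * H Y" for Y
  define l where "l = (\<Sum>j\<in>?J. kernel_radial s (norm (x i - x j))) - real n * H ?a"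
  have l_eq: "\<Psi> ?a = l" by (simp add: \<Psi>_def l_def emb_diff norm_emb)
  have ne: "x i \<noteq> x j" if "j \<in> ?J" for j
    using that i x_inj unfolding inj_on_def by blast
  have "isCont \<Psi> ?a"
    unfolding \<Psi>_def
  proof (intro continuous_diff continuous_sum continuous_mult continuous_const H_isCont)
    fix j assume "j \<in> ?J"
    then have "isCont (kernel_radial s) (norm (?a - \<iota> (x j)))"
      using ne by (intro DERIV_isCont[OF kernel_radial_deriv]) (simp add: emb_diff norm_emb)
    moreover have "isCont (\<lambda>Y. norm (Y - \<iota> (x j))) ?a" by (intro continuous_intros)
    ultimately show "isCont (\<lambda>Y. kernel_radial s (norm (Y - \<iota> (x j)))) ?a"
      by (rule isCont_o2[rotated])
  qed
  show ?thesis
    unfolding l_def[symmetric]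
  proof (rule tendstoI)
    fix e :: real assume e: "e > 0"
    obtain \<delta> where \<delta>: "\<delta> > 0" "\<And>Y. dist Y ?a < \<delta> \<Longrightarrow> dist (\<Psi> Y) (\<Psi> ?a) < e / 2"
      using \<open>isCont \<Psi> ?a\<close> e unfolding continuous_at_eps_delta by (metis half_gt_zero)
    have small: "\<forall>\<^sub>F \<eta> in at_right 0. \<eta> < c" if "c > 0" for c :: real
      using that by (auto simp: eventually_at_right_field)
    have "\<forall>\<^sub>F \<eta> in at_right 0. \<forall>j\<in>?J. \<eta> < norm (x i - x j) / 2"
    proof (intro eventually_ball_finite ballI small)
      show "norm (x i - x j) / 2 > 0" if "j \<in> ?J" for j using ne[OF that] by simp
    qed simp
    then show "\<forall>\<^sub>F \<eta> in at_right 0. dist (sphere_mean \<eta> (U \<eta>) ?a - kernel_radial s \<eta>) l < e"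
      using small[OF \<delta>(1)] eventually_at_right_less[of 0]
    proof eventually_elim
      case (elim \<eta>)
      have "\<bar>sphere_mean \<eta> (U \<eta>) ?a - (kernel_radial s \<eta> + l)\<bar> \<le> e / 2"
      proof (rule sphere_mean_deviation)
        fix Y assume Y: "norm (Y - ?a) = \<eta>"
        have "trunc_radial s \<eta> (Y - \<iota> (x j)) = kernel_radial s (norm (Y - \<iota> (x j)))" if j: "j \<in> ?J" for j
        proof -
          have "norm (x i - x j) = norm (?a - \<iota> (x j))" by (simp add: emb_diff norm_emb)
          also have "\<dots> \<le> norm (?a - Y) + norm (Y - \<iota> (x j))"
            using norm_triangle_ineq[of "?a - Y" "Y - \<iota> (x j)"] by simp
          finally have "\<eta> \<le> norm (Y - \<iota> (x j))"
            using elim(1) j Y by (force simp: norm_minus_commute)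
          then show ?thesis by (simp add: trunc_radial_def max_def)
        qed
        moreover have "U \<eta> Y = trunc_radial s \<eta> (Y - ?a) + (\<Sum>j\<in>?J. trunc_radial s \<eta> (Y - \<iota> (x j))) - real n * H Y"
          using i by (simp add: U_def sum.remove)
        ultimately have "U \<eta> Y = kernel_radial s \<eta> + \<Psi> Y"
          using Y by (simp add: \<Psi>_def trunc_radial_def)
        moreover have "\<bar>\<Psi> Y - l\<bar> \<le> e / 2"
          using \<delta>(2)[of Y] Y elim by (simp add: l_eq dist_norm)
        ultimately show "\<bar>U \<eta> Y - (kernel_radial s \<eta> + l)\<bar> \<le> e / 2" by simp
      qed (use elim in auto)
      then have "\<bar>sphere_mean \<eta> (U \<eta>) ?a - kernel_radial s \<eta> - l\<bar> \<le> e / 2"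
        by (simp only: diff_diff_eq)
      then show ?case using e unfolding dist_real_def by linarith
    qed
  qed
qed

text \<open>Truncation only enlarges the radius, so the power of the true distance dominates all
  truncations below 1 at once.\<close>

lemma trunc_kernel_integral_limit:
  assumes \<eta>: "\<eta> \<longlonglongrightarrow> 0" "\<And>k. 0 < \<eta> k" and a: "norm a \<le> R0"
  shows "(\<lambda>k. \<integral>z. trunc_radial s (\<eta> k) (\<iota> z - \<iota> a) \<partial>\<mu>) \<longlonglongrightarrow> H (\<iota> a)"
    and "\<forall>\<^sub>F k in sequentially. integrable \<mu> (\<lambda>z. trunc_radial s (\<eta> k) (\<iota> z - \<iota> a))"
proof -
  define L where "L = 2 * R0"
  define C where "C = 2 + (1 + L) * L powr kernel_order s"
  have C: "C \<ge> 0" using R0_ge_1 by (simp add: C_def L_def add_nonneg_nonneg)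
  have norm_eq: "norm (\<iota> z - \<iota> a) = norm (a - z)" for z by (simp add: emb_diff norm_emb norm_minus_commute)
  have ev: "\<forall>\<^sub>F k in sequentially. \<eta> k < 1" using \<eta>(1) by (rule order_tendstoD) simp
  have bound: "\<bar>kernel_radial s (max h (norm (a - z)))\<bar> \<le> C * norm (a - z) powr (- kernel_order s)"
    if "h < 1" "z \<noteq> a" "norm z \<le> R0" for h z
  proof -
    have "max h (norm (a - z)) \<le> L"
      using norm_triangle_ineq4[of a z] that a R0_ge_1 by (simp add: L_def)
    then have "\<bar>kernel_radial s (max h (norm (a - z)))\<bar> \<le> C * (max h (norm (a - z))) powr (- kernel_order s)"
      unfolding C_def using that s_nonneg by (intro kernel_radial_abs_le_powr) (auto simp: less_max_iff_disj)
    also have "\<dots> \<le> C * norm (a - z) powr (- kernel_order s)"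
      using C kernel_order_less that by (intro mult_left_mono powr_mono2') auto
    finally show ?thesis .
  qed
  have pint: "integrable \<mu> (\<lambda>z. C * norm (a - z) powr (- kernel_order s))"
  proof -
    obtain D where "(\<integral>\<^sup>+ z. ennreal (norm (a - z) powr (- kernel_order s)) \<partial>\<mu>) \<le> ennreal D"
      using powr_integral_bounded kernel_order_less by metis
    then have "integrable \<mu> (\<lambda>z. norm (a - z) powr (- kernel_order s))"
      by (intro integrableI_bounded) (auto intro: order.strict_trans1)
    then show ?thesis by simp
  qed
  show int: "\<forall>\<^sub>F k in sequentially. integrable \<mu> (\<lambda>z. trunc_radial s (\<eta> k) (\<iota> z - \<iota> a))"
    using ev
  proof eventually_elim
    case (elim k)
    show ?case
    proof (rule Bochner_Integration.integrable_bound[OF pint])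
      show "AE z in \<mu>. norm (trunc_radial s (\<eta> k) (\<iota> z - \<iota> a)) \<le> norm (C * norm (a - z) powr (- kernel_order s))"
        using AE_neq[of a] support
        by eventually_elim (use bound[OF elim] C in \<open>simp add: trunc_radial_def norm_eq\<close>)
    qed measurable
  qed
  have lim: "(\<lambda>k. \<integral>z. trunc_radial s (\<eta> k) (\<iota> z - \<iota> a) - kernel_radial s (norm (a - z)) \<partial>\<mu>) \<longlonglongrightarrow> 0"
  proof (rule tendsto_integral_dominated_powr[OF _ _ tendsto_const kernel_order_less(2,1) C])
    show "AE z in \<mu>. (\<lambda>k. trunc_radial s (\<eta> k) (\<iota> z - \<iota> a) - kernel_radial s (norm (a - z))) \<longlonglongrightarrow> 0"
      using AE_neq[of a]
    proof eventually_elim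
      case (elim z)
      have "\<forall>\<^sub>F k in sequentially. \<eta> k < norm (a - z)"
        using elim by (intro order_tendstoD(2)[OF \<eta>(1)]) auto
      then have "\<forall>\<^sub>F k in sequentially. trunc_radial s (\<eta> k) (\<iota> z - \<iota> a) - kernel_radial s (norm (a - z)) = 0"
        by eventually_elim (simp add: trunc_radial_def norm_eq max_def)
      then show ?case by (rule tendsto_eventually)
    qed
    show "\<forall>\<^sub>F k in sequentially. AE z in \<mu>. \<bar>trunc_radial s (\<eta> k) (\<iota> z - \<iota> a) - kernel_radial s (norm (a - z))\<bar>
        \<le> C * (norm (a - z) powr (- kernel_order s) + norm (a - z) powr (- kernel_order s))"
      using ev
    proof eventually_elim
      case (elim k)
      show ?case
        using AE_neq[of a] support
      proof eventually_elim
        case z: (elim z)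
        then show ?case
          using bound[OF elim, of z] bound[of 0 z]
          by (simp add: trunc_radial_def norm_eq distrib_left max_absorb2)
      qed
    qed
  qed measurable
  have kint: "integrable \<mu> (\<lambda>z. kernel_radial s (norm (a - z)))"
    using kernel_integrable[of "\<iota> a"] by (simp add: emb_diff norm_emb)
  have H_eq: "H (\<iota> a) = (\<integral>z. kernel_radial s (norm (a - z)) \<partial>\<mu>)"
    by (simp add: H_def emb_diff norm_emb)
  have "\<forall>\<^sub>F k in sequentially. (\<integral>z. trunc_radial s (\<eta> k) (\<iota> z - \<iota> a) - kernel_radial s (norm (a - z)) \<partial>\<mu>)
      = (\<integral>z. trunc_radial s (\<eta> k) (\<iota> z - \<iota> a) \<partial>\<mu>) - H (\<iota> a)"
    using int by eventually_elim (simp add: H_eq kint)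
  then have "(\<lambda>k. (\<integral>z. trunc_radial s (\<eta> k) (\<iota> z - \<iota> a) \<partial>\<mu>) - H (\<iota> a)) \<longlonglongrightarrow> 0"
    using lim by (rule Lim_transform_eventually[rotated])
  then show "(\<lambda>k. \<integral>z. trunc_radial s (\<eta> k) (\<iota> z - \<iota> a) \<partial>\<mu>) \<longlonglongrightarrow> H (\<iota> a)"
    by (rule LIM_zero_cancel)
qed

lemma H_emb_integrable: "integrable \<mu> (\<lambda>z. H (\<iota> z))"
proof -
  have "continuous_on UNIV (\<lambda>z. H (\<iota> z))"
    by (intro continuous_on_compose2[OF _ emb_continuous, of UNIV H] continuous_at_imp_continuous_on ballI H_isCont) auto
  then have "compact ((\<lambda>z. H (\<iota> z)) ` cball 0 R0)"
    by (intro compact_continuous_image) (auto intro: continuous_on_subset)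
  then have "bounded ((\<lambda>z. H (\<iota> z)) ` cball 0 R0)" by (rule compact_imp_bounded)
  then obtain B where B: "\<And>z. norm z \<le> R0 \<Longrightarrow> norm (H (\<iota> z)) \<le> B"
    unfolding bounded_iff by fastforce
  show ?thesis
    by (rule integrable_const_bound[where B=B]) (use support B in \<open>auto elim: eventually_mono\<close>)
qed

lemma U_integral_limit:
  "((\<lambda>\<eta>. \<integral>z. U \<eta> (\<iota> z) \<partial>\<mu>) \<longlongrightarrow> (\<Sum>i\<in>{1..n}. H (\<iota> (x i))) - real n * (\<integral>z. H (\<iota> z) \<partial>\<mu>)) (at_right 0)"
  unfolding tendsto_at_iff_sequentially comp_def
proof (intro allI impI)
  fix \<eta> :: "nat \<Rightarrow> real" assume pos: "\<forall>k. \<eta> k \<in> {0<..} - {0}" and lim: "\<eta> \<longlonglongrightarrow> 0"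
  have pos': "0 < \<eta> k" for k using pos by auto
  note L = trunc_kernel_integral_limit[OF lim pos' x_le]
  have "\<forall>\<^sub>F k in sequentially. \<forall>i\<in>{1..n}. integrable \<mu> (\<lambda>z. trunc_radial s (\<eta> k) (\<iota> z - \<iota> (x i)))"
    using L(2) by (intro eventually_ball_finite) auto
  then have ev: "\<forall>\<^sub>F k in sequentially. (\<Sum>i\<in>{1..n}. \<integral>z. trunc_radial s (\<eta> k) (\<iota> z - \<iota> (x i)) \<partial>\<mu>) - real n * (\<integral>z. H (\<iota> z) \<partial>\<mu>)
      = (\<integral>z. U (\<eta> k) (\<iota> z) \<partial>\<mu>)"
  proof eventually_elim
    case (elim k)
    have "(\<integral>z. U (\<eta> k) (\<iota> z) \<partial>\<mu>)
        = (\<integral>z. (\<Sum>i\<in>{1..n}. trunc_radial s (\<eta> k) (\<iota> z - \<iota> (x i))) \<partial>\<mu>) - (\<integral>z. real n * H (\<iota> z) \<partial>\<mu>)"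
      unfolding U_def using elim H_emb_integrable by (intro Bochner_Integration.integral_diff) auto
    also have "(\<integral>z. (\<Sum>i\<in>{1..n}. trunc_radial s (\<eta> k) (\<iota> z - \<iota> (x i))) \<partial>\<mu>)
        = (\<Sum>i\<in>{1..n}. \<integral>z. trunc_radial s (\<eta> k) (\<iota> z - \<iota> (x i)) \<partial>\<mu>)"
      using elim by (intro Bochner_Integration.integral_sum) auto
    finally show ?case by simp
  qed
  have "(\<lambda>k. (\<Sum>i\<in>{1..n}. \<integral>z. trunc_radial s (\<eta> k) (\<iota> z - \<iota> (x i)) \<partial>\<mu>) - real n * (\<integral>z. H (\<iota> z) \<partial>\<mu>))
      \<longlonglongrightarrow> (\<Sum>i\<in>{1..n}. H (\<iota> (x i))) - real n * (\<integral>z. H (\<iota> z) \<partial>\<mu>)"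
    using L(1) by (intro tendsto_intros) auto
  then show "(\<lambda>k. \<integral>z. U (\<eta> k) (\<iota> z) \<partial>\<mu>) \<longlonglongrightarrow> (\<Sum>i\<in>{1..n}. H (\<iota> (x i))) - real n * (\<integral>z. H (\<iota> z) \<partial>\<mu>)"
    using ev by (rule Lim_transform_eventually)
qed

text \<open>Each of the n sphere means diverges like the kernel at \<eta>, and division by n turns
  their sum into exactly the subtracted term. \<open>renormalized_energy\<close> is 1/n times the
  interaction, off the diagonal of the point charges, of the signed charge consisting of the points
  minus n times \<mu>.\<close>

lemma energy_limit:
  "((\<lambda>\<eta>. ereal (1 / flux_coefficient) *
      (ereal (1 / real n) * enn2ereal (\<integral>\<^sup>+ X. ennreal (w X * (norm (U_grad \<eta> X))\<^sup>2) \<partial>lborel)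
        - ereal (flux_coefficient * kernel_radial s \<eta>))) \<longlongrightarrow> ereal renormalized_energy) (at_right 0)"
proof -
  let ?m = "\<lambda>\<eta> i. sphere_mean \<eta> (U \<eta>) (\<iota> (x i))"
  let ?r = "\<lambda>\<eta>. (1 / real n) * ((\<Sum>i\<in>{1..n}. ?m \<eta> i - kernel_radial s \<eta>) - real n * (\<integral>z. U \<eta> (\<iota> z) \<partial>\<mu>))"
  have c: "flux_coefficient > 0" by (rule flux_coefficient_pos)
  have n: "real n > 0" using n_ge_1 by simp
  have "(?r \<longlongrightarrow> (1 / real n) * ((\<Sum>i\<in>{1..n}. (\<Sum>j\<in>{1..n} - {i}. kernel_radial s (norm (x i - x j))) - real n * H (\<iota> (x i)))
      - real n * ((\<Sum>i\<in>{1..n}. H (\<iota> (x i))) - real n * (\<integral>z. H (\<iota> z) \<partial>\<mu>)))) (at_right 0)"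
    by (intro tendsto_intros sphere_mean_limit U_integral_limit)
  also have "(1 / real n) * ((\<Sum>i\<in>{1..n}. (\<Sum>j\<in>{1..n} - {i}. kernel_radial s (norm (x i - x j))) - real n * H (\<iota> (x i)))
      - real n * ((\<Sum>i\<in>{1..n}. H (\<iota> (x i))) - real n * (\<integral>z. H (\<iota> z) \<partial>\<mu>))) = renormalized_energy"
    by (simp add: renormalized_energy_def sum_subtractf sum_distrib_left algebra_simps power2_eq_square)
  finally have lim: "((\<lambda>\<eta>. ereal (?r \<eta>)) \<longlongrightarrow> ereal renormalized_energy) (at_right 0)" by simp
  have "\<forall>\<^sub>F \<eta>::real in at_right 0. 0 < \<eta> \<and> \<eta> < 1"
    by (auto simp: eventually_at_right_field intro: exI[of _ 1])
  then have "\<forall>\<^sub>F \<eta> in at_right 0. ereal (?r \<eta>) = ereal (1 / flux_coefficient) *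
      (ereal (1 / real n) * enn2ereal (\<integral>\<^sup>+ X. ennreal (w X * (norm (U_grad \<eta> X))\<^sup>2) \<partial>lborel)
        - ereal (flux_coefficient * kernel_radial s \<eta>))"
  proof eventually_elim
    case (elim \<eta>)
    then have \<eta>: "0 < \<eta>" "\<eta> < 1" by auto
    let ?E = "flux_coefficient * ((\<Sum>i\<in>{1..n}. ?m \<eta> i) - real n * (\<integral>z. U \<eta> (\<iota> z) \<partial>\<mu>))"
    have "?r \<eta> = 1 / flux_coefficient * (1 / real n * ?E - flux_coefficient * kernel_radial s \<eta>)"
      using c n by (simp add: sum_subtractf field_simps)
    moreover have "enn2ereal (\<integral>\<^sup>+ X. ennreal (w X * (norm (U_grad \<eta> X))\<^sup>2) \<partial>lborel) = ereal ?E"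
      unfolding energy_identity(1)[OF \<eta>] by (rule enn2ereal_ennreal[OF energy_identity(2)[OF \<eta>]])
    ultimately show ?case by simp
  qed
  with lim show ?thesis by (rule Lim_transform_eventually)
qed

end

section \<open>The constant of the kernel\<close>

text \<open>The denominators make the family closed under differentiation, which yields smoothness
  of the bump function by induction.\<close>

definition bump_factor :: "nat \<Rightarrow> real \<Rightarrow> real" where
  "bump_factor k t = (if t > 0 then exp (- 1 / t) / t ^ k else 0)"

text \<open>With u = 1/t the quotient is u^(k+1) e^(-u) from the right, so flatness at 0 is the
  decay of the exponential.\<close>

lemma bump_factor_lim_0: "((\<lambda>t. bump_factor k t / t) \<longlongrightarrow> 0) (at 0)"
proof -
  have "((\<lambda>t::real. inverse t ^ Suc k / exp (inverse t)) \<longlongrightarrow> 0) (at_right 0)"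
    by (rule filterlim_compose[OF tendsto_power_div_exp_0 filterlim_inverse_at_top_right])
  moreover have "\<forall>\<^sub>F t in at_right 0. inverse t ^ Suc k / exp (inverse t) = bump_factor k t / t"
    using eventually_at_right_less[of 0]
  proof eventually_elim
    case (elim t)
    then show ?case
      by (simp add: bump_factor_def exp_minus divide_inverse power_inverse mult_ac)
  qed
  ultimately have R: "((\<lambda>t. bump_factor k t / t) \<longlongrightarrow> 0) (at_right 0)"
    by (rule Lim_transform_eventually)
  have "\<forall>\<^sub>F t in at_left 0. t < (0::real)" by (simp add: eventually_at_filter)
  then have "\<forall>\<^sub>F t in at_left 0. 0 = bump_factor k t / t"
    by eventually_elim (simp add: bump_factor_def)
  then have L: "((\<lambda>t. bump_factor k t / t) \<longlongrightarrow> 0) (at_left 0)"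
    by (rule Lim_transform_eventually[OF tendsto_const])
  from R L show ?thesis by (simp add: filterlim_split_at)
qed

lemma bump_factor_deriv:
  "(bump_factor k has_real_derivative - real k * bump_factor (k + 1) t + bump_factor (k + 2) t) (at t)"
proof (cases t "0::real" rule: linorder_cases)
  case less
  have "((\<lambda>t::real. 0::real) has_real_derivative 0) (at t)" by simp
  then have "(bump_factor k has_real_derivative 0) (at t)"
    by (rule has_field_derivative_transform_within_open[where S="{..<0}"])
      (use less in \<open>auto simp: bump_factor_def\<close>)
  then show ?thesis using less by (simp add: bump_factor_def)
next
  case equal
  have "((\<lambda>h. (bump_factor k (0 + h) - bump_factor k 0) / h) \<longlongrightarrow> 0) (at 0)"
    using bump_factor_lim_0[of k] by (simp add: bump_factor_def[of k 0])
  then show ?thesis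
    unfolding DERIV_def equal by (simp add: bump_factor_def[of _ 0])
next
  case greater
  have "((\<lambda>t. exp (- 1 / t) / t ^ k) has_real_derivative
      (exp (- 1 / t) * (1 / t\<^sup>2) * t ^ k - exp (- 1 / t) * (real k * t ^ (k - 1))) / (t ^ k * t ^ k)) (at t)"
    using greater by (auto intro!: derivative_eq_intros simp: power2_eq_square)
  also have "(exp (- 1 / t) * (1 / t\<^sup>2) * t ^ k - exp (- 1 / t) * (real k * t ^ (k - 1))) / (t ^ k * t ^ k)
      = - real k * bump_factor (k + 1) t + bump_factor (k + 2) t"
    using greater by (cases k) (simp_all add: bump_factor_def field_simps power2_eq_square)
  finally show ?thesis
    by (rule has_field_derivative_transform_within_open[where S="{0<..}"])
      (use greater in \<open>auto simp: bump_factor_def\<close>)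
qed

text \<open>A class of functions that is closed under partial derivatives and contains a bump function.\<close>

inductive bump_class :: "('e::euclidean_space \<Rightarrow> real) \<Rightarrow> bool" where
  const: "bump_class (\<lambda>X. c)"
| coordinate: "bump_class (\<lambda>X. X \<bullet> v)"
| factor: "bump_class (\<lambda>X. bump_factor k (1 - X \<bullet> X))"
| add: "bump_class f \<Longrightarrow> bump_class g \<Longrightarrow> bump_class (\<lambda>X. f X + g X)"
| mult: "bump_class f \<Longrightarrow> bump_class g \<Longrightarrow> bump_class (\<lambda>X. f X * g X)"

lemma bump_class_deriv:
  assumes "bump_class f"
  shows "\<exists>D. (\<forall>X. (f has_derivative D X) (at X)) \<and> (\<forall>v. bump_class (\<lambda>X. D X v))"
  using assms
proof induction
  case (const c)
  show ?case by (rule exI[of _ "\<lambda>X h. 0"]) (auto intro: bump_class.const)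
next
  case (coordinate v)
  show ?case
    by (rule exI[of _ "\<lambda>X h. h \<bullet> v"]) (auto intro!: bump_class.const derivative_eq_intros)
next
  case (factor k)
  let ?d = "\<lambda>X::'a. - real k * bump_factor (k + 1) (1 - X \<bullet> X) + bump_factor (k + 2) (1 - X \<bullet> X)"
  show ?case
  proof (intro exI[of _ "\<lambda>X h. (- 2 * (X \<bullet> h)) * ?d X"] conjI allI)
    fix X :: 'a
    have "((\<lambda>X. 1 - X \<bullet> X) has_derivative (\<lambda>h. - 2 * (X \<bullet> h))) (at X)"
      by (auto intro!: derivative_eq_intros simp: inner_commute)
    from has_derivative_compose[OF this bump_factor_deriv[unfolded has_field_derivative_def]]
    show "((\<lambda>X. bump_factor k (1 - X \<bullet> X)) has_derivative (\<lambda>h. (- 2 * (X \<bullet> h)) * ?d X)) (at X)"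
      by (simp add: mult.commute)
  next
    fix v :: 'a
    show "bump_class (\<lambda>X. (- 2 * (X \<bullet> v)) * ?d X)"
      by (intro bump_class.intros)
  qed
next
  case (add f g)
  then obtain D E where D: "\<forall>X. (f has_derivative D X) (at X)" "\<forall>v. bump_class (\<lambda>X. D X v)"
    and E: "\<forall>X. (g has_derivative E X) (at X)" "\<forall>v. bump_class (\<lambda>X. E X v)" by blast
  show ?case
    by (rule exI[of _ "\<lambda>X h. D X h + E X h"]) (use D E in \<open>auto intro: has_derivative_add bump_class.add\<close>)
next
  case (mult f g)
  then obtain D E where D: "\<forall>X. (f has_derivative D X) (at X)" "\<forall>v. bump_class (\<lambda>X. D X v)"
    and E: "\<forall>X. (g has_derivative E X) (at X)" "\<forall>v. bump_class (\<lambda>X. E X v)" by blast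
  show ?case
    by (rule exI[of _ "\<lambda>X h. f X * E X h + D X h * g X"])
      (use D E mult.hyps in \<open>auto intro!: has_derivative_mult bump_class.add bump_class.mult\<close>)
qed

lemma bump_class_times_cont_diff: "bump_class f \<Longrightarrow> times_cont_diff m f"
proof (induction m arbitrary: f)
  case 0
  obtain D where "\<forall>X. (f has_derivative D X) (at X)" using bump_class_deriv[OF 0] by blast
  then show ?case
    by (auto intro!: continuous_at_imp_continuous_on has_derivative_continuous)
next
  case (Suc m)
  obtain D where D: "\<forall>X. (f has_derivative D X) (at X)" "\<forall>v. bump_class (\<lambda>X. D X v)"
    using bump_class_deriv[OF Suc.prems] by blast
  then have "frechet_derivative f (at X) = D X" for X
    by (metis frechet_derivative_at)
  then show ?case using D Suc.IH by (auto simp: differentiable_def)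
qed

text \<open>Supplies a test function that does not vanish at 0, without which the constant of the
  distributional equation would not be determined.\<close>

lemma bump_test_function:
  "test_function (\<lambda>X::'e::euclidean_space. bump_factor 0 (1 - X \<bullet> X))"
proof -
  have "{X::'e. bump_factor 0 (1 - X \<bullet> X) \<noteq> 0} \<subseteq> cball 0 1"
  proof
    fix X :: 'e assume "X \<in> {X. bump_factor 0 (1 - X \<bullet> X) \<noteq> 0}"
    then have "X \<bullet> X < 1" by (auto simp: bump_factor_def split: if_splits)
    then have "(norm X)\<^sup>2 < 1\<^sup>2" by (simp only: power2_norm_eq_inner one_power2)
    then show "X \<in> cball 0 1" by (simp add: power_less_imp_less_base less_imp_le del: one_power2)
  qed
  then have "bounded {X::'e. bump_factor 0 (1 - X \<bullet> X) \<noteq> 0}"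
    using bounded_cball bounded_subset by blast
  then show ?thesis
    unfolding test_function_def using bump_class_times_cont_diff[OF bump_class.factor[of 0]]
    by (auto simp: compact_eq_bounded_closed)
qed

lemma test_function_gradient:
  fixes \<phi> :: "'e::euclidean_space \<Rightarrow> real"
  assumes "test_function \<phi>"
  obtains G R where "continuous_on UNIV G" "\<And>X. GDERIV \<phi> X :> G X" "R > 0"
    "\<And>X. R \<le> norm X \<Longrightarrow> \<phi> X = 0 \<and> G X = 0"
proof -
  have d: "\<forall>X. \<phi> differentiable at X" "\<forall>b\<in>Basis. continuous_on UNIV (\<lambda>X. frechet_derivative \<phi> (at X) b)"
    using assms[unfolded test_function_def, THEN conjunct1, rule_format, of "Suc 0"] by auto
  define G where "G X = (\<Sum>b\<in>Basis. frechet_derivative \<phi> (at X) b *\<^sub>R b)" for X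
  have cont: "continuous_on UNIV G"
    unfolding G_def using d(2) by (intro continuous_intros) auto
  have G: "GDERIV \<phi> X :> G X" for X
  proof -
    have D: "(\<phi> has_derivative frechet_derivative \<phi> (at X)) (at X)"
      using d(1) frechet_derivative_works by blast
    then interpret L: bounded_linear "frechet_derivative \<phi> (at X)" by (rule has_derivative_bounded_linear)
    have "frechet_derivative \<phi> (at X) h = h \<bullet> G X" for h
    proof -
      have "frechet_derivative \<phi> (at X) h = frechet_derivative \<phi> (at X) (\<Sum>b\<in>Basis. (h \<bullet> b) *\<^sub>R b)"
        by (simp add: euclidean_representation)
      also have "\<dots> = h \<bullet> G X"
        by (simp add: L.sum L.scaleR G_def inner_sum_right mult.commute)
      finally show ?thesis .
    qed
    then have "frechet_derivative \<phi> (at X) = (\<lambda>h. h \<bullet> G X)" by blast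
    then show ?thesis using D by (simp add: gderiv_def)
  qed
  have "bounded (closure {X. \<phi> X \<noteq> 0})"
    using assms compact_imp_bounded by (auto simp: test_function_def)
  then obtain R where R: "\<And>X. X \<in> closure {X. \<phi> X \<noteq> 0} \<Longrightarrow> norm X \<le> R"
    by (auto simp: bounded_iff)
  have "\<phi> X = 0 \<and> G X = 0" if "max R 0 + 1 \<le> norm X" for X
  proof
    have X: "X \<in> - closure {X. \<phi> X \<noteq> 0}" using R[of X] that by auto
    have zero: "\<phi> Y = 0" if "Y \<in> - closure {X. \<phi> X \<noteq> 0}" for Y
      using that closure_subset[of "{X. \<phi> X \<noteq> 0}"] by auto
    show "\<phi> X = 0" using zero X .
    have "((\<lambda>Y. 0::real) has_derivative (\<lambda>h. 0)) (at X)" by simp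
    then have "(\<phi> has_derivative (\<lambda>h. 0)) (at X)"
    proof (rule has_derivative_transform_within_open[OF _ _ X])
      show "open (- closure {X. \<phi> X \<noteq> 0})" by (intro open_Compl closed_closure)
      show "0 = \<phi> Y" if "Y \<in> - closure {X. \<phi> X \<noteq> 0}" for Y using zero[OF that] by simp
    qed
    then have "GDERIV \<phi> X :> 0" by (simp add: gderiv_def)
    then show "G X = 0" using G GDERIV_unique by blast
  qed
  then show thesis using cont G by (intro that[of G "max R 0 + 1"]) auto
qed

text \<open>The flux identity at \<eta> = 0 and centre 0. The integrand is integrable because the
  kernel gradient has order s+1, below hdim = s+2, and the test function has compact
  support.\<close>

lemma (in riesz_extension) test_function_flux:
  assumes "test_function \<phi>"
  shows "(\<integral>X. w X * (grad (\<lambda>Y. kernel_radial s (norm Y)) X \<bullet> grad \<phi> X) \<partial>lebesgue) = flux_coefficient * \<phi> 0"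
proof -
  obtain G R where G: "continuous_on UNIV G" "\<And>X. GDERIV \<phi> X :> G X" and R: "R > 0"
    "\<And>X. R \<le> norm X \<Longrightarrow> \<phi> X = 0 \<and> G X = 0"
    using test_function_gradient[OF assms] by metis
  have [measurable]: "G \<in> borel_measurable borel" by (rule borel_measurable_continuous_onI[OF G(1)])
  have \<kappa>: "kernel_slope s > 0" by (rule kernel_slope_pos[OF s_nonneg])
  have "bounded (G ` cball 0 R)"
    by (intro compact_imp_bounded compact_continuous_image continuous_on_subset[OF G(1)]) auto
  then obtain B where B: "\<And>X. norm X \<le> R \<Longrightarrow> norm (G X) \<le> B" unfolding bounded_iff by fastforce
  have "0 \<le> norm (G 0)" by simp
  also have "\<dots> \<le> B" using B[of 0] R by simp
  finally have B0: "B \<ge> 0" .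
  have emb0: "\<iota> 0 = 0" by (rule linear_0[OF linear_emb])
  have bound: "norm (w X * (kernel_grad s X \<bullet> G X))
      \<le> kernel_slope s * B * (w X * norm X powr (- (s + 1))) * indicator (ball 0 R) X" for X
  proof (cases "norm X < R")
    case True
    have "\<bar>kernel_grad s X \<bullet> G X\<bar> \<le> norm (kernel_grad s X) * norm (G X)" by (rule Cauchy_Schwarz_ineq2)
    also have "\<dots> \<le> (kernel_slope s * norm X powr (- s - 1)) * B"
      using B[of X] True \<kappa> by (intro mult_mono) (auto simp: norm_kernel_grad s_nonneg)
    finally have "w X * \<bar>kernel_grad s X \<bullet> G X\<bar> \<le> w X * ((kernel_slope s * norm X powr (- s - 1)) * B)"
      by (intro mult_left_mono w_nonneg)
    then show ?thesis using True by (simp add: abs_mult w_nonneg mult_ac)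
  next
    case False
    then show ?thesis using R(2)[of X] by simp
  qed
  have int: "integrable lborel (\<lambda>X. w X * (kernel_grad s X \<bullet> G X))"
  proof (rule integrableI_bounded)
    have "(\<integral>\<^sup>+ X. ennreal (norm (w X * (kernel_grad s X \<bullet> G X))) \<partial>lborel)
        \<le> (\<integral>\<^sup>+ X. ennreal (kernel_slope s * B) * (ennreal (w X * norm X powr (- (s + 1))) * indicator (ball 0 R) X) \<partial>lborel)"
    proof (rule nn_integral_mono)
      fix X
      have "ennreal (kernel_slope s * B * (w X * norm X powr (- (s + 1))) * indicator (ball 0 R) X)
          = ennreal (kernel_slope s * B) * (ennreal (w X * norm X powr (- (s + 1))) * indicator (ball 0 R) X)"
        using \<kappa> B0 by (auto simp: ennreal_mult' indicator_def)
      then show "ennreal (norm (w X * (kernel_grad s X \<bullet> G X)))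
          \<le> ennreal (kernel_slope s * B) * (ennreal (w X * norm X powr (- (s + 1))) * indicator (ball 0 R) X)"
        using ennreal_leI[OF bound[of X]] by simp
    qed
    also have "\<dots> = ennreal (kernel_slope s * B) * (\<integral>\<^sup>+ X. ennreal (w X * norm X powr (- (s + 1))) * indicator (ball 0 R) X \<partial>lborel)"
      by (rule nn_integral_cmult) measurable
    also have "\<dots> < \<infinity>"
      using weight_powr_small[of "s + 1" R] R s_nonneg by (simp add: ennreal_mult_less_top hdim_s)
    finally show "(\<integral>\<^sup>+ X. ennreal (norm (w X * (kernel_grad s X \<bullet> G X))) \<partial>lborel) < \<infinity>" .
  qed measurable
  have K0: "indicator {Y. 0 < norm Y} X *\<^sub>R kernel_grad s X = kernel_grad s X" for X :: 'e
    by (auto simp: indicator_def kernel_grad_def)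
  have contP: "isCont \<phi> X" for X
    using G(2)[of X] has_derivative_continuous unfolding gderiv_def by blast
  then have [measurable]: "\<phi> \<in> borel_measurable borel"
    by (intro borel_measurable_continuous_onI continuous_at_imp_continuous_on) auto
  have lim: "(\<phi> \<longlongrightarrow> 0) at_infinity"
    using R by (intro tendsto_eventually) (auto simp: eventually_at_infinity)
  have "(\<integral>X. w X * (grad (\<lambda>Y. kernel_radial s (norm Y)) X \<bullet> grad \<phi> X) \<partial>lebesgue)
      = (\<integral>X. w X * (kernel_grad s X \<bullet> G X) \<partial>lebesgue)"
  proof (rule integral_cong_AE)
    have "AE X in lborel. X \<noteq> (0::'e)" by (rule AE_lborel_singleton)
    then have *: "AE X in lebesgue. X \<noteq> (0::'e)" by (rule AE_completion)
    show m: "(\<lambda>X. w X * (kernel_grad s X \<bullet> G X)) \<in> borel_measurable lebesgue"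
      by (intro measurable_completion) measurable
    show ae: "AE X in lebesgue. w X * (grad (\<lambda>Y. kernel_radial s (norm Y)) X \<bullet> grad \<phi> X) = w X * (kernel_grad s X \<bullet> G X)"
      using * by eventually_elim (simp add: grad_eq[OF kernel_grad_deriv] grad_eq[OF G(2)])
    then have ae': "AE X in lebesgue. w X * (kernel_grad s X \<bullet> G X) = w X * (grad (\<lambda>Y. kernel_radial s (norm Y)) X \<bullet> grad \<phi> X)"
      by eventually_elim (rule sym)
    show "(\<lambda>X. w X * (grad (\<lambda>Y. kernel_radial s (norm Y)) X \<bullet> grad \<phi> X)) \<in> borel_measurable lebesgue"
      using m ae' by (rule borel_measurable_AE)
  qed
  also have "\<dots> = (\<integral>X. w X * (kernel_grad s X \<bullet> G X) \<partial>lborel)"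
    by (intro integral_completion) measurable
  also have "\<dots> = flux_coefficient * sphere_mean 0 \<phi> (\<iota> 0)"
    by (rule flux_identity[of 0 G \<phi> "\<lambda>_. {}" 0, unfolded emb0 diff_zero K0, unfolded emb0[symmetric]])
      (use int lim contP G(2) in \<open>auto simp: emb0\<close>)
  also have "\<dots> = flux_coefficient * \<phi> 0"
    by (simp add: sphere_mean_0 emb0)
  finally show ?thesis .
qed

text \<open>\<open>THE\<close> asks for existence, which is \<open>test_function_flux\<close>, and
  uniqueness, which follows by testing with the bump function.\<close>

lemma (in riesz_extension) flux_constant_eq: "flux_constant w s = flux_coefficient"
  unfolding flux_constant_def
proof (rule the_equality)
  show "\<forall>\<phi>. test_function \<phi> \<longrightarrow>
      (\<integral>X. w X * (grad (\<lambda>Y. kernel_radial s (norm Y)) X \<bullet> grad \<phi> X) \<partial>lebesgue) = flux_coefficient * \<phi> 0"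
    using test_function_flux by blast
  fix c assume "\<forall>\<phi>. test_function \<phi> \<longrightarrow>
      (\<integral>X. w X * (grad (\<lambda>Y. kernel_radial s (norm Y)) X \<bullet> grad \<phi> X) \<partial>lebesgue) = c * \<phi> 0"
  from this[rule_format, OF bump_test_function] test_function_flux[OF bump_test_function]
  show "c = flux_coefficient" by (simp add: bump_factor_def)
qed

section \<open>The two extensions\<close>

text \<open>Covers the Coulomb kernels, including the logarithm in dimension 2. Here s + 1 = d - 1
  is already below d, so gradients of potentials stay bounded and \<open>N\<close> is empty.\<close>

lemma riesz_extension_trivial:
  assumes "DIM('a::euclidean_space) \<ge> 2" "s = real DIM('a) - 2"
  shows "riesz_extension (\<lambda>X::'a. 1) 0 s (\<lambda>z. z) (\<lambda>X. X) (\<lambda>X. 1) (s + 1) {}"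
proof -
  interpret W: homogeneous_weight "\<lambda>X::'a. 1" 0 by (rule homogeneous_weight_1)
  show ?thesis
  proof
    fix R :: real
    have "emeasure lborel (ball 0 R :: 'a set) < \<infinity>"
      by (rule emeasure_bounded_finite) simp
    then show "(\<integral>\<^sup>+ X. ennreal (1 * 1\<^sup>2) * indicator (ball 0 R) (X::'a) \<partial>lborel) < \<infinity>"
      by simp
  qed (use assms in \<open>auto simp: linear_iff\<close>)
qed

lemma borel_measurable_snd [measurable]:
  "snd \<in> borel_measurable (borel :: ('a::euclidean_space \<times> real) measure)"
  by (intro borel_measurable_continuous_onI continuous_intros)

text \<open>The ball lies in the product of a ball of R^d and an interval, so everything reduces to
  integrability of a power on a bounded interval.\<close>

lemma height_powr_integrable:
  assumes "a > - 1" "R > 0"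
  shows "(\<integral>\<^sup>+ X. ennreal (\<bar>snd X\<bar> powr a) * indicator (ball 0 R) (X :: 'a::euclidean_space \<times> real) \<partial>lborel) < \<infinity>"
proof -
  interpret W: homogeneous_weight "\<lambda>y::real. 1" 0 by (rule homogeneous_weight_1)
  have one: "(\<integral>\<^sup>+ y. ennreal (\<bar>y\<bar> powr a) * indicator (ball 0 R) y \<partial>lborel) < \<infinity>"
  proof (cases "a \<le> 0")
    case True
    then show ?thesis
      using W.weight_powr_small[of "- a" R] assms by (simp add: W.hdim_def)
  next
    case False
    have "(\<integral>\<^sup>+ y. ennreal (\<bar>y\<bar> powr a) * indicator (ball 0 R) y \<partial>lborel)
        \<le> (\<integral>\<^sup>+ y. ennreal (R powr a) * indicator (ball 0 R) (y::real) \<partial>lborel)"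
      using False by (intro nn_integral_mono) (auto simp: indicator_def intro!: ennreal_leI powr_mono2)
    also have "\<dots> = ennreal (R powr a) * emeasure lborel (ball 0 R :: real set)"
      by (simp add: nn_integral_cmult)
    also have "\<dots> < \<infinity>"
      using emeasure_bounded_finite[of "ball 0 R :: real set"] by (simp add: ennreal_mult_less_top)
    finally show ?thesis .
  qed
  have "(\<integral>\<^sup>+ X. ennreal (\<bar>snd X\<bar> powr a) * indicator (ball 0 R) (X :: 'a \<times> real) \<partial>lborel)
      \<le> (\<integral>\<^sup>+ X. indicator (ball 0 R) (fst X) * (ennreal (\<bar>snd X\<bar> powr a) * indicator (ball 0 R) (snd X)) \<partial>(lborel \<Otimes>\<^sub>M lborel :: ('a \<times> real) measure))"
    unfolding lborel_prod
  proof (rule nn_integral_mono)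
    fix X :: "'a \<times> real"
    show "ennreal (\<bar>snd X\<bar> powr a) * indicator (ball 0 R) X
        \<le> indicator (ball 0 R) (fst X) * (ennreal (\<bar>snd X\<bar> powr a) * indicator (ball 0 R) (snd X))"
      using norm_fst_le[of "fst X" "snd X"] norm_snd_le[of "snd X" "fst X"] by (auto simp: indicator_def)
  qed
  also have "\<dots> = (\<integral>\<^sup>+ z. (\<integral>\<^sup>+ y. indicator (ball 0 R) z * (ennreal (\<bar>y\<bar> powr a) * indicator (ball 0 R) y) \<partial>lborel) \<partial>(lborel :: 'a measure))"
    by (subst lborel.nn_integral_fst[symmetric]) auto
  also have "\<dots> = emeasure lborel (ball 0 R :: 'a set) * (\<integral>\<^sup>+ y. ennreal (\<bar>y\<bar> powr a) * indicator (ball 0 R) y \<partial>lborel)"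
    by (simp add: nn_integral_cmult nn_integral_multc)
  also have "\<dots> < \<infinity>"
    using one emeasure_bounded_finite[of "ball 0 R :: 'a set"] by (simp add: ennreal_mult_less_top)
  finally show ?thesis .
qed

lemma AE_height_nonzero: "AE X in (lborel :: ('a::euclidean_space \<times> real) measure). snd X \<noteq> 0"
proof -
  have eq: "{X :: 'a \<times> real. snd X = 0} = {X. (0, 1) \<bullet> X = 0}" by auto
  have "negligible {X :: 'a \<times> real. snd X = 0}"
    unfolding eq by (rule negligible_hyperplane) (simp add: zero_prod_def)
  moreover have "closed {X :: 'a \<times> real. snd X = 0}"
    unfolding eq by (rule closed_hyperplane)
  ultimately have "{X :: 'a \<times> real. snd X = 0} \<in> null_sets lborel"
    by (auto simp: negligible_iff_null_sets null_sets_def dest: borel_closed)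
  then show ?thesis by (auto dest: AE_not_in)
qed

text \<open>The part \<beta> of the exponent s + 1 is charged to the height. Integrability over R^d
  of the rest requires s + 1 - \<beta> < d, that is \<beta> > \<gamma>, and local integrability of
  the weight times the squared bound requires \<gamma> - 2 \<beta> > -1. Since -1 < \<gamma> < 1,
  the interval from max 0 \<gamma> to (1 + \<gamma>)/2 is nonempty, and \<beta> is its
  midpoint.\<close>

lemma riesz_extension_half_space:
  assumes s: "max 0 (real DIM('a::euclidean_space) - 2) < s \<and> s < real DIM('a) \<or> s = 0 \<and> DIM('a) = 1"
  defines "\<gamma> \<equiv> s - real DIM('a) + 1"
  defines "\<beta> \<equiv> (max 0 \<gamma> + (1 + \<gamma>) / 2) / 2"
  shows "riesz_extension (\<lambda>X::'a \<times> real. \<bar>snd X\<bar> powr \<gamma>) \<gamma> s (\<lambda>z. (z, 0)) fst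
    (\<lambda>X. max 1 (\<bar>snd X\<bar> powr (- \<beta>))) (s + 1 - \<beta>) {X. snd X = 0}"
proof -
  have g: "- 1 < \<gamma>" "\<gamma> < 1" using s by (auto simp: \<gamma>_def)
  define m where "m = max 0 \<gamma>"
  have "0 \<le> m" "\<gamma> \<le> m" "m < (1 + \<gamma>) / 2" using g by (auto simp: m_def max_def)
  moreover have "\<beta> = (m + (1 + \<gamma>) / 2) / 2" by (simp add: \<beta>_def m_def)
  ultimately have b: "0 < \<beta>" "\<gamma> < \<beta>" "\<beta> < (1 + \<gamma>) / 2" "\<beta> < 1"
    using g by (simp_all add: field_simps)
  have s0: "0 \<le> s" "s < real DIM('a)" using s by auto
  have fin: "(\<integral>\<^sup>+ X. ennreal (\<bar>snd X\<bar> powr \<gamma>) * indicator (ball 0 R) (X :: 'a \<times> real) \<partial>lborel) < \<infinity>" if "R > 0" for R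
    using that g by (intro height_powr_integrable) auto
  have pos: "AE X in (lborel :: ('a \<times> real) measure). 0 < \<bar>snd X\<bar> powr \<gamma>"
    using AE_height_nonzero by eventually_elim simp
  interpret W: homogeneous_weight "\<lambda>X::'a \<times> real. \<bar>snd X\<bar> powr \<gamma>" \<gamma>
    by standard (use fin[of 1] pos in \<open>auto simp: abs_mult powr_mult\<close>)
  show ?thesis
  proof (intro riesz_extension.intro riesz_extension_axioms.intro W.homogeneous_weight_axioms)
    show "linear (\<lambda>z::'a. (z, 0::real))" by (auto simp: linear_iff)
    show "norm (fst X - z) \<le> norm (X - (z, 0))" for X :: "'a \<times> real" and z
      using norm_fst_le[of "fst X - z" "snd X"] by (simp add: minus_prod_def)
    show "norm (fst X - fst Y) \<le> norm (X - Y)" for X Y :: "'a \<times> real"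
      using norm_fst_le[of "fst X - fst Y" "snd X - snd Y"] by (simp add: minus_prod_def)
    show "\<gamma> + real DIM('a \<times> real) = s + 2" by (simp add: \<gamma>_def)
    show "isCont (\<lambda>X. max 1 (\<bar>snd X\<bar> powr (- \<beta>))) X" if "X \<notin> {X. snd X = 0}" for X :: "'a \<times> real"
      using that by (intro continuous_intros) auto
    show "closed {X :: 'a \<times> real. snd X = 0}"
      by (intro closed_Collect_eq continuous_intros)
    show "AE X in lborel. X \<notin> {X :: 'a \<times> real. snd X = 0}"
      using AE_height_nonzero by simp
    show "0 \<le> s + 1 - \<beta>" "s + 1 - \<beta> < real DIM('a)" using b s0 by (auto simp: \<gamma>_def)
    show "norm (X - (z, 0)) powr (- s - 1)
        \<le> max 1 (\<bar>snd X\<bar> powr (- \<beta>)) * norm (fst X - z) powr (- (s + 1 - \<beta>))"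
      if "X \<notin> {X. snd X = 0}" "z \<noteq> fst X" for X :: "'a \<times> real" and z
    proof -
      have y: "0 < \<bar>snd X\<bar>" "\<bar>snd X\<bar> \<le> norm (X - (z, 0))"
        using that norm_snd_le[of "snd X" "fst X - z"] by (auto simp: minus_prod_def)
      have z: "0 < norm (fst X - z)" "norm (fst X - z) \<le> norm (X - (z, 0))"
        using that norm_fst_le[of "fst X - z" "snd X"] by (auto simp: minus_prod_def)
      have "norm (X - (z, 0)) powr (- s - 1) = norm (X - (z, 0)) powr (- \<beta>) * norm (X - (z, 0)) powr (- (s + 1 - \<beta>))"
        by (simp add: powr_add[symmetric])
      also have "\<dots> \<le> \<bar>snd X\<bar> powr (- \<beta>) * norm (fst X - z) powr (- (s + 1 - \<beta>))"
        using y z b s0 by (intro mult_mono powr_mono2') auto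
      also have "\<dots> \<le> max 1 (\<bar>snd X\<bar> powr (- \<beta>)) * norm (fst X - z) powr (- (s + 1 - \<beta>))"
        by (intro mult_right_mono) auto
      finally show ?thesis .
    qed
    show "(\<integral>\<^sup>+ X. ennreal (\<bar>snd X\<bar> powr \<gamma> * (max 1 (\<bar>snd X\<bar> powr (- \<beta>)))\<^sup>2) * indicator (ball 0 R) (X :: 'a \<times> real) \<partial>lborel) < \<infinity>"
      if R: "R > 0" for R
    proof -
      have "(\<integral>\<^sup>+ X. ennreal (\<bar>snd X\<bar> powr \<gamma> * (max 1 (\<bar>snd X\<bar> powr (- \<beta>)))\<^sup>2) * indicator (ball 0 R) (X :: 'a \<times> real) \<partial>lborel)
          \<le> (\<integral>\<^sup>+ X. ennreal (\<bar>snd X\<bar> powr \<gamma>) * indicator (ball 0 R) (X :: 'a \<times> real)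
             + ennreal (\<bar>snd X\<bar> powr (\<gamma> - 2 * \<beta>)) * indicator (ball 0 R) X \<partial>lborel)"
      proof (rule nn_integral_mono)
        fix X :: "'a \<times> real"
        let ?y = "\<bar>snd X\<bar>"
        have "?y powr \<gamma> * (?y powr (- \<beta>))\<^sup>2 = ?y powr (\<gamma> - 2 * \<beta>)"
          by (simp add: power2_eq_square powr_add[symmetric])
        then have "?y powr \<gamma> * (max 1 (?y powr (- \<beta>)))\<^sup>2 \<le> ?y powr \<gamma> + ?y powr (\<gamma> - 2 * \<beta>)"
          by (simp add: max_def)
        then show "ennreal (?y powr \<gamma> * (max 1 (?y powr (- \<beta>)))\<^sup>2) * indicator (ball 0 R) X
            \<le> ennreal (?y powr \<gamma>) * indicator (ball 0 R) X + ennreal (?y powr (\<gamma> - 2 * \<beta>)) * indicator (ball 0 R) X"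
          by (auto simp: indicator_def ennreal_plus[symmetric] simp del: ennreal_plus intro!: ennreal_leI)
      qed
      also have "\<dots> = (\<integral>\<^sup>+ X. ennreal (\<bar>snd X\<bar> powr \<gamma>) * indicator (ball 0 R) (X :: 'a \<times> real) \<partial>lborel)
             + (\<integral>\<^sup>+ X. ennreal (\<bar>snd X\<bar> powr (\<gamma> - 2 * \<beta>)) * indicator (ball 0 R) (X :: 'a \<times> real) \<partial>lborel)"
        by (intro nn_integral_add) measurable
      also have "\<dots> < \<infinity>"
        using fin[OF R] height_powr_integrable[of "\<gamma> - 2 * \<beta>" R] R b by simp
      finally show ?thesis .
    qed
  qed (use s0 in \<open>auto simp: norm_Pair\<close>)
qed

section \<open>The equilibrium measure\<close>

lemma ext_integral_eq_integral:
  assumes "integrable M f" and "AE z in M. g z = ereal (f z)"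
  shows "ext_integral M g = ereal (\<integral>z. f z \<partial>M)"
proof -
  have p: "(\<integral>\<^sup>+ z. e2ennreal (g z) \<partial>M) = (\<integral>\<^sup>+ z. ennreal (f z) \<partial>M)"
    by (rule nn_integral_cong_AE, use assms(2) in eventually_elim) simp
  have n: "(\<integral>\<^sup>+ z. e2ennreal (- g z) \<partial>M) = (\<integral>\<^sup>+ z. ennreal (- f z) \<partial>M)"
    by (rule nn_integral_cong_AE, use assms(2) in eventually_elim) simp
  obtain a where a: "a \<ge> 0" "(\<integral>\<^sup>+ z. ennreal (f z) \<partial>M) = ennreal a"
    using assms(1) by (auto simp: real_integrable_def less_top elim: ennreal_cases)
  obtain b where b: "b \<ge> 0" "(\<integral>\<^sup>+ z. ennreal (- f z) \<partial>M) = ennreal b"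
    using assms(1) by (auto simp: real_integrable_def less_top elim: ennreal_cases)
  show ?thesis
    unfolding ext_integral_def p n real_lebesgue_integral_def[OF assms(1)] a(2) b(2)
    using a(1) b(1) by simp
qed

lemma ext_integral_less_top:
  assumes "(\<integral>\<^sup>+ z. e2ennreal (f z) \<partial>M) < \<infinity>"
  shows "ext_integral M f < \<infinity>"
proof -
  obtain a where "a \<ge> 0" "(\<integral>\<^sup>+ z. e2ennreal (f z) \<partial>M) = ennreal a"
    using assms by (auto simp: less_top elim: ennreal_cases)
  then show ?thesis
    unfolding ext_integral_def
    by (cases "enn2ereal (\<integral>\<^sup>+ z. e2ennreal (- f z) \<partial>M)") (auto simp: enn2ereal_ennreal)
qed

text \<open>With the convention that \<infinity> - \<infinity> is \<infinity>, an infinite positive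
  part can never be compensated.\<close>

lemma ext_integral_less_top_iff:
  "ext_integral M f < \<infinity> \<longleftrightarrow> (\<integral>\<^sup>+ z. e2ennreal (f z) \<partial>M) < \<infinity>"
proof
  assume *: "ext_integral M f < \<infinity>"
  show "(\<integral>\<^sup>+ z. e2ennreal (f z) \<partial>M) < \<infinity>"
  proof (rule ccontr)
    assume "\<not> (\<integral>\<^sup>+ z. e2ennreal (f z) \<partial>M) < \<infinity>"
    then have "(\<integral>\<^sup>+ z. e2ennreal (f z) \<partial>M) = \<top>" by (simp add: less_top[symmetric])
    then have "ext_integral M f = \<infinity>"
      unfolding ext_integral_def by simp
    with * show False by simp
  qed
qed (rule ext_integral_less_top)

lemma kernel_measurable [measurable]:
  "(\<lambda>(z, z'). kernel s (z - z')) \<in> borel_measurable (borel \<Otimes>\<^sub>M (borel :: 'a::euclidean_space measure))"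
  unfolding kernel_def by measurable

lemma V1_measurable:
  assumes "V1 V"
  shows "V \<in> borel_measurable borel"
proof (rule borel_measurableI_greater)
  fix a
  have "open {z. a < V z}" using assms by (simp add: V1_def)
  then show "{z \<in> space borel. a < V z} \<in> sets borel" by simp
qed

lemma uniform_measure_pair:
  assumes "prob_space \<nu>" and A: "A \<in> sets \<nu>" and pos: "emeasure \<nu> A \<noteq> 0"
  shows "uniform_measure \<nu> A \<Otimes>\<^sub>M uniform_measure \<nu> A
    = density (\<nu> \<Otimes>\<^sub>M \<nu>) (\<lambda>(x, y). (indicator A x / emeasure \<nu> A) * (indicator A y / emeasure \<nu> A))"
proof -
  interpret prob_space \<nu> by fact
  have "prob_space (uniform_measure \<nu> A)"
    by (intro prob_space_uniform_measure) (use pos in auto)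
  then have "sigma_finite_measure (uniform_measure \<nu> A)"
    using prob_space_imp_sigma_finite by blast
  then show ?thesis
    using A sigma_finite_measure_axioms unfolding uniform_measure_def
    by (intro pair_measure_density) auto
qed

text \<open>The measure from (V2) has finite kernel energy, but V may fail to be integrable for it
  although finite almost everywhere. Conditioning on a sublevel set of V of positive mass bounds V
  and costs only a constant factor in the positive part of the kernel energy.\<close>

lemma finite_energy_measure:
  fixes V :: "'a::euclidean_space \<Rightarrow> ereal"
  assumes V1: "V1 V" and V2: "V2 s V"
  obtains \<nu> where "borel_probability \<nu>" "mean_field_energy s V \<nu> < \<infinity>"
proof -
  obtain \<nu> where \<nu>: "borel_probability \<nu>" "AE z in \<nu>. V z < \<infinity>" "interaction_energy s \<nu> < \<infinity>"
    using V2 unfolding V2_def by (metis (mono_tags, lifting) eventually_mono)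
  interpret prob_space \<nu> using \<nu>(1) by (simp add: borel_probability_def)
  have sets[measurable_cong]: "sets \<nu> = sets borel" using \<nu>(1) by (simp add: borel_probability_def)
  have space: "space \<nu> = UNIV" using sets_eq_imp_space_eq[OF sets] by simp
  have [measurable]: "V \<in> borel_measurable borel" by (rule V1_measurable[OF V1])
  define A where "A m = {z. V z \<le> ereal (real m)}" for m :: nat
  have A: "A m \<in> sets \<nu>" for m
  proof -
    have "A m \<in> sets borel" unfolding A_def by measurable
    then show ?thesis using sets by simp
  qed
  have "\<exists>m. emeasure \<nu> (A m) \<noteq> 0"
  proof (rule ccontr)
    assume "\<not> ?thesis"
    then have "\<And>m. A m \<in> null_sets \<nu>" using A by (auto simp: null_sets_def)
    then have "AE z in \<nu>. z \<notin> A m" for m by (rule AE_not_in)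
    then have "AE z in \<nu>. \<forall>m. z \<notin> A m" by (simp add: AE_all_countable)
    with \<nu>(2) have "AE z in \<nu>. False"
    proof eventually_elim
      case (elim z)
      show ?case
      proof (cases "V z")
        case (real r)
        obtain m :: nat where "r \<le> real m" using real_arch_simple by blast
        then show ?thesis using elim real by (auto simp: A_def)
      next
        case MInf
        then have "z \<in> A 0" by (simp add: A_def)
        then show ?thesis using elim by blast
      qed (use elim in simp)
    qed
    then show False by simp
  qed
  then obtain m where m: "emeasure \<nu> (A m) \<noteq> 0" by blast
  let ?c = "1 / emeasure \<nu> (A m)"
  have c: "?c < \<infinity>" using m by (simp add: ennreal_divide_eq_top_iff less_top[symmetric])
  let ?\<nu> = "uniform_measure \<nu> (A m)"
  have "prob_space ?\<nu>" by (intro prob_space_uniform_measure) (use m in auto)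
  then have prob: "borel_probability ?\<nu>" by (simp add: borel_probability_def sets)
  have "(\<integral>\<^sup>+ p. e2ennreal (case p of (z, z') \<Rightarrow> kernel s (z - z')) \<partial>(?\<nu> \<Otimes>\<^sub>M ?\<nu>))
      \<le> ?c * ?c * (\<integral>\<^sup>+ p. e2ennreal (case p of (z, z') \<Rightarrow> kernel s (z - z')) \<partial>(\<nu> \<Otimes>\<^sub>M \<nu>))"
  proof -
    note [measurable] = A[of m]
    have "(\<integral>\<^sup>+ p. e2ennreal (case p of (z, z') \<Rightarrow> kernel s (z - z')) \<partial>(?\<nu> \<Otimes>\<^sub>M ?\<nu>))
      = (\<integral>\<^sup>+ p. (case p of (z, z') \<Rightarrow> (indicator (A m) z / emeasure \<nu> (A m)) * (indicator (A m) z' / emeasure \<nu> (A m)))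
          * e2ennreal (case p of (z, z') \<Rightarrow> kernel s (z - z')) \<partial>(\<nu> \<Otimes>\<^sub>M \<nu>))"
      unfolding uniform_measure_pair[OF prob_space_axioms A m]
      by (rule nn_integral_density) measurable
    also have "\<dots> \<le> (\<integral>\<^sup>+ p. ?c * ?c * e2ennreal (case p of (z, z') \<Rightarrow> kernel s (z - z')) \<partial>(\<nu> \<Otimes>\<^sub>M \<nu>))"
      by (intro nn_integral_mono) (auto simp: indicator_def)
    also have "\<dots> = ?c * ?c * (\<integral>\<^sup>+ p. e2ennreal (case p of (z, z') \<Rightarrow> kernel s (z - z')) \<partial>(\<nu> \<Otimes>\<^sub>M \<nu>))"
      by (rule nn_integral_cmult) measurable
    finally show ?thesis .
  qed
  also have "\<dots> < \<infinity>"
    using c \<nu>(3)[unfolded interaction_energy_def ext_integral_less_top_iff]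
    by (simp add: ennreal_mult_less_top)
  finally have 1: "interaction_energy s ?\<nu> < \<infinity>"
    unfolding interaction_energy_def ext_integral_less_top_iff .
  have "(\<integral>\<^sup>+ z. e2ennreal (V z) \<partial>?\<nu>) \<le> (\<integral>\<^sup>+ z. ennreal (real m) \<partial>?\<nu>)"
  proof (rule nn_integral_mono_AE)
    show "AE z in ?\<nu>. e2ennreal (V z) \<le> ennreal (real m)"
    proof (rule AE_uniform_measureI[OF A], rule AE_I2, rule impI)
      fix z assume "z \<in> A m"
      then show "e2ennreal (V z) \<le> ennreal (real m)"
        using e2ennreal_mono[of "V z" "ereal (real m)"] by (simp add: A_def)
    qed
  qed
  also have "\<dots> < \<infinity>"
    using prob_space.emeasure_space_1[OF \<open>prob_space ?\<nu>\<close>] by simp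
  finally have 2: "ext_integral ?\<nu> V < \<infinity>"
    unfolding ext_integral_less_top_iff .
  have "mean_field_energy s V ?\<nu> < \<infinity>"
    using 1 2 by (auto simp: mean_field_energy_def)
  with prob show thesis by (rule that)
qed

section \<open>Integrability of the external field and of the kernel\<close>

locale equilibrium = bounded_density_measure \<mu> M for \<mu> :: "'a::euclidean_space measure" and M +
  fixes s :: real and V :: "'a \<Rightarrow> ereal"
  assumes s_nonneg: "0 \<le> s" and s_less: "s < real DIM('a)"
    and V1: "V1 V" and V2: "V2 s V" and V3: "V3 s V" and minimal: "equilibrium_measure s V \<mu>"
begin

text \<open>Where V is infinite the conversion gives 0; that set is null for \<mu> by
  \<open>V_finite_AE\<close>.\<close>

definition Vr :: "'a \<Rightarrow> real" where
  "Vr z = real_of_ereal (V z)"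

lemma V_measurable [measurable]: "V \<in> borel_measurable borel"
  by (rule V1_measurable[OF V1])

lemma Vr_measurable [measurable]: "Vr \<in> borel_measurable borel"
  unfolding Vr_def by measurable

lemma V_lower: obtains m where "m \<le> 0" "\<And>z. ereal m \<le> V z"
proof -
  obtain m where "\<And>z. ereal m \<le> V z" using V1 by (auto simp: V1_def)
  then have "ereal (min m 0) \<le> V z" for z
    by (rule order_trans[rotated]) simp
  then show thesis by (intro that[of "min m 0"]) auto
qed

lemma V_not_MInf: "V z \<noteq> - \<infinity>"
proof -
  obtain m where "ereal m \<le> V z" using V_lower by metis
  then show ?thesis by auto
qed

lemma energy_finite: "mean_field_energy s V \<mu> < \<infinity>"
proof -
  obtain \<nu> where "borel_probability \<nu>" "mean_field_energy s V \<nu> < \<infinity>"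
    using finite_energy_measure[OF V1 V2] by metis
  then show ?thesis using minimal unfolding equilibrium_measure_def by (metis order.strict_trans1)
qed

lemma V_pos_part: "(\<integral>\<^sup>+ z. e2ennreal (V z) \<partial>\<mu>) < \<infinity>"
proof (rule ccontr)
  assume "\<not> ?thesis"
  then have "\<not> ext_integral \<mu> V < \<infinity>" unfolding ext_integral_less_top_iff .
  then have "ext_integral \<mu> V = \<infinity>" by simp
  then show False using energy_finite by (simp add: mean_field_energy_def)
qed

lemma V_finite_AE: "AE z in \<mu>. V z = ereal (Vr z)"
proof -
  have "AE z in \<mu>. e2ennreal (V z) \<noteq> \<infinity>"
    using V_pos_part by (intro nn_integral_PInf_AE) auto
  then show ?thesis
  proof eventually_elim
    case (elim z)
    then show ?case using V_not_MInf[of z] by (cases "V z") (auto simp: Vr_def)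
  qed
qed

lemma Vr_lower: obtains m where "m \<le> 0" "\<And>z. m \<le> Vr z"
proof -
  obtain m where m: "m \<le> 0" "\<And>z. ereal m \<le> V z" using V_lower by metis
  have "m \<le> Vr z" for z using m(1) m(2)[of z] by (cases "V z") (auto simp: Vr_def)
  with m(1) show thesis by (rule that)
qed

lemma Vr_integrable: "integrable \<mu> Vr"
proof (rule integrableI_bounded)
  obtain m where m: "m \<le> 0" "\<And>z. m \<le> Vr z" using Vr_lower by metis
  have "(\<integral>\<^sup>+ z. ennreal (norm (Vr z)) \<partial>\<mu>) \<le> (\<integral>\<^sup>+ z. e2ennreal (V z) + ennreal (- m) \<partial>\<mu>)"
  proof (rule nn_integral_mono_AE, use V_finite_AE in eventually_elim)
    case (elim z)
    have "ennreal \<bar>Vr z\<bar> \<le> ennreal (max 0 (Vr z) + (- m))"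
      using m(1) m(2)[of z] by (intro ennreal_leI) auto
    also have "\<dots> = ennreal (max 0 (Vr z)) + ennreal (- m)"
      using m by (intro ennreal_plus) auto
    also have "ennreal (max 0 (Vr z)) = ennreal (Vr z)" by (simp add: max_def ennreal_neg)
    finally show ?case using elim by simp
  qed
  also have "\<dots> = (\<integral>\<^sup>+ z. e2ennreal (V z) \<partial>\<mu>) + ennreal (- m)"
    by (subst nn_integral_add) (auto simp: emeasure_space_1[unfolded space_mu])
  also have "\<dots> < \<infinity>" using V_pos_part by simp
  finally show "(\<integral>\<^sup>+ z. ennreal (norm (Vr z)) \<partial>\<mu>) < \<infinity>" .
qed measurable

text \<open>The bound |x - y| \<le> (1 + |x|)(1 + |y|) separates the negative part of the
  logarithmic kernel into one such function of each variable; a Riesz kernel is nonnegative and has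
  none.\<close>

definition log_part :: "'a \<Rightarrow> real" where
  "log_part z = (if s = 0 then ln (1 + norm z) else 0)"

lemma log_part_measurable [measurable]: "log_part \<in> borel_measurable borel"
  unfolding log_part_def by measurable

lemma log_part_log: "s = 0 \<Longrightarrow> log_part z = ln (1 + norm z)"
  unfolding log_part_def by simp

lemma log_part_nonneg: "0 \<le> log_part z"
  by (simp add: log_part_def)

lemma confinement:
  obtains R where "\<And>z. R \<le> norm z \<Longrightarrow> V z \<noteq> \<infinity> \<Longrightarrow> K \<le> Vr z / 2 - log_part z"
proof (cases "s = 0")
  case True
  then have "((\<lambda>z. V z / 2 - ereal (ln (norm z))) \<longlongrightarrow> \<infinity>) at_infinity"
    using V3 by (simp add: V3_def)
  then have "\<forall>\<^sub>F z in at_infinity. ereal (K + ln 2) < V z / 2 - ereal (ln (norm z))"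
    by (simp add: tendsto_PInfty)
  then obtain R where R: "\<And>z. R \<le> norm z \<Longrightarrow> ereal (K + ln 2) < V z / 2 - ereal (ln (norm z))"
    by (auto simp: eventually_at_infinity)
  \<comment> \<open>The ln 2 added to K pays for replacing 1 + |z| by 2 |z| once |z| is at least
    1.\<close>
  show thesis
  proof (rule that[of "max R 1"])
    fix z assume z: "max R 1 \<le> norm z" "V z \<noteq> \<infinity>"
    have v: "V z = ereal (Vr z)" using z V_not_MInf[of z] by (cases "V z") (auto simp: Vr_def)
    have "K + ln 2 < Vr z / 2 - ln (norm z)" using R[of z] z by (simp add: v)
    moreover have "ln (1 + norm z) \<le> ln (2 * norm z)" using z by (intro ln_mono) auto
    moreover have "ln (2 * norm z) = ln 2 + ln (norm z)" using z by (subst ln_mult) auto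
    ultimately show "K \<le> Vr z / 2 - log_part z" unfolding log_part_log[OF True] by linarith
  qed
next
  case False
  then have "(V \<longlongrightarrow> \<infinity>) at_infinity" using V3 by (simp add: V3_def)
  then have "\<forall>\<^sub>F z in at_infinity. ereal (2 * K) < V z" by (simp add: tendsto_PInfty)
  then obtain R where R: "\<And>z. R \<le> norm z \<Longrightarrow> ereal (2 * K) < V z"
    by (auto simp: eventually_at_infinity)
  show thesis
  proof (rule that[of R])
    fix z assume z: "R \<le> norm z" "V z \<noteq> \<infinity>"
    have v: "V z = ereal (Vr z)" using z V_not_MInf[of z] by (cases "V z") (auto simp: Vr_def)
    show "K \<le> Vr z / 2 - log_part z" using R[of z] z False by (simp add: v log_part_def)
  qed
qed

lemma confinement_lower:
  obtains C where "C \<ge> 0" "\<And>z. V z \<noteq> \<infinity> \<Longrightarrow> - C \<le> Vr z / 2 - log_part z"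
proof -
  obtain R where R: "\<And>z. R \<le> norm z \<Longrightarrow> V z \<noteq> \<infinity> \<Longrightarrow> 0 \<le> Vr z / 2 - log_part z"
    using confinement by metis
  obtain m where m: "m \<le> 0" "\<And>z. m \<le> Vr z" using Vr_lower by metis
  define C where "C = ln (1 + max R 0) - m"
  have "0 \<le> ln (1 + max R 0)" by simp
  then have C: "C \<ge> 0" using m(1) unfolding C_def by linarith
  have "- C \<le> Vr z / 2 - log_part z" if "V z \<noteq> \<infinity>" for z
  proof (cases "R \<le> norm z")
    case True
    then show ?thesis using R[of z] that C by linarith
  next
    case False
    then have "ln (1 + norm z) \<le> ln (1 + max R 0)" by (intro ln_mono) (auto simp: add_pos_nonneg)
    with \<open>0 \<le> ln (1 + max R 0)\<close> have "log_part z \<le> ln (1 + max R 0)"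
      unfolding log_part_def by (simp split: if_split)
    then show ?thesis using m(1) m(2)[of z] by (simp add: C_def)
  qed
  with C show thesis by (rule that)
qed

text \<open>Confinement bounds the logarithm by V/2 plus a constant, so integrability of V gives
  \<mu> a finite logarithmic moment.\<close>

lemma log_part_integrable: "integrable \<mu> log_part"
proof -
  obtain C where C: "C \<ge> 0" "\<And>z. V z \<noteq> \<infinity> \<Longrightarrow> - C \<le> Vr z / 2 - log_part z"
    using confinement_lower by metis
  show ?thesis
  proof (rule Bochner_Integration.integrable_bound[where f="\<lambda>z. Vr z / 2 + C"])
    show "integrable \<mu> (\<lambda>z. Vr z / 2 + C)" using Vr_integrable by auto
    show "AE z in \<mu>. norm (log_part z) \<le> norm (Vr z / 2 + C)"
      using V_finite_AE
    proof eventually_elim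
      case (elim z)
      then show ?case using C(2)[of z] log_part_nonneg[of z] by simp
    qed
  qed measurable
qed

definition pair_kernel :: "'a \<times> 'a \<Rightarrow> real" where
  "pair_kernel p = kernel_radial s (norm (fst p - snd p))"

lemma pair_kernel_measurable [measurable]: "pair_kernel \<in> borel_measurable (borel \<Otimes>\<^sub>M borel)"
  unfolding pair_kernel_def by measurable

sublocale P: pair_prob_space \<mu> \<mu> ..

lemma kernel_radial_lower: "x \<noteq> y \<Longrightarrow> - (log_part x + log_part y) \<le> kernel_radial s (norm (x - y))"
proof (cases "s = 0")
  case True
  assume "x \<noteq> y"
  have "norm (x - y) \<le> norm x + norm y" by (rule norm_triangle_ineq4)
  also have "\<dots> \<le> (1 + norm x) * (1 + norm y)" by (simp add: algebra_simps)
  finally have "ln (norm (x - y)) \<le> ln ((1 + norm x) * (1 + norm y))"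
    using \<open>x \<noteq> y\<close> by (intro ln_mono) auto
  also have "\<dots> = ln (1 + norm x) + ln (1 + norm y)"
    by (rule ln_mult_pos) (auto simp: add_pos_nonneg)
  finally have "- (ln (1 + norm x) + ln (1 + norm y)) \<le> - ln (norm (x - y))" by simp
  moreover have "kernel_radial s (norm (x - y)) = - ln (norm (x - y))"
    using True by (simp add: kernel_radial_def)
  ultimately show ?thesis unfolding log_part_log[OF True] by simp
qed (simp add: kernel_radial_def log_part_def)

lemma integrable_pair:
  fixes f :: "'a \<Rightarrow> real"
  assumes f: "integrable \<mu> f"
  shows "integrable (\<mu> \<Otimes>\<^sub>M \<mu>) (\<lambda>p. f (fst p))" "(\<integral>p. f (fst p) \<partial>(\<mu> \<Otimes>\<^sub>M \<mu>)) = (\<integral>z. f z \<partial>\<mu>)"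
    "integrable (\<mu> \<Otimes>\<^sub>M \<mu>) (\<lambda>p. f (snd p))" "(\<integral>p. f (snd p) \<partial>(\<mu> \<Otimes>\<^sub>M \<mu>)) = (\<integral>z. f z \<partial>\<mu>)"
proof -
  have prob_UNIV: "prob UNIV = 1" using prob_space by simp
  have [measurable]: "f \<in> borel_measurable borel"
    using borel_measurable_integrable[OF f] by simp
  show 1: "integrable (\<mu> \<Otimes>\<^sub>M \<mu>) (\<lambda>p. f (fst p))"
    using f by (intro P.Fubini_integrable) (auto simp: prob_UNIV)
  show 2: "(\<integral>p. f (fst p) \<partial>(\<mu> \<Otimes>\<^sub>M \<mu>)) = (\<integral>z. f z \<partial>\<mu>)"
    using P.integral_fst'[OF 1] by (simp add: prob_UNIV)
  show "integrable (\<mu> \<Otimes>\<^sub>M \<mu>) (\<lambda>p. f (snd p))"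
    using P.integrable_product_swap[OF 1] by (simp add: case_prod_beta')
  show "(\<integral>p. f (snd p) \<partial>(\<mu> \<Otimes>\<^sub>M \<mu>)) = (\<integral>z. f z \<partial>\<mu>)"
    using P.integral_product_swap[of "\<lambda>p. f (fst p)"] 2 by (simp add: case_prod_beta')
qed

lemma AE_pair:
  "AE p in \<mu> \<Otimes>\<^sub>M \<mu>. fst p \<noteq> snd p \<and> V (fst p) = ereal (Vr (fst p)) \<and> V (snd p) = ereal (Vr (snd p))"
proof (rule P.AE_pair_measure)
  show "{p \<in> space (\<mu> \<Otimes>\<^sub>M \<mu>). fst p \<noteq> snd p \<and> V (fst p) = ereal (Vr (fst p)) \<and> V (snd p) = ereal (Vr (snd p))}
      \<in> sets (\<mu> \<Otimes>\<^sub>M \<mu>)"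
    by measurable
  show "AE x in \<mu>. AE y in \<mu>. fst (x, y) \<noteq> snd (x, y) \<and> V (fst (x, y)) = ereal (Vr (fst (x, y)))
      \<and> V (snd (x, y)) = ereal (Vr (snd (x, y)))"
    using V_finite_AE
  proof eventually_elim
    case (elim x)
    then show ?case
      using AE_neq[of x] V_finite_AE by (auto elim: eventually_elim2)
  qed
qed

text \<open>The singularity is integrable uniformly in one variable because the density is bounded,
  and the logarithmic growth is integrable by the finite logarithmic moment.\<close>

lemma pair_kernel_integrable: "integrable (\<mu> \<Otimes>\<^sub>M \<mu>) pair_kernel"
proof -
  let ?o = "kernel_order s"
  have o: "0 \<le> ?o" "?o < real DIM('a)"
  proof -
    have d: "1 \<le> real DIM('a)" by (simp add: Suc_leI)
    have "?o = 1 / 2 \<or> ?o = s" by (simp add: kernel_order_def)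
    then show "0 \<le> ?o" "?o < real DIM('a)" using d s_less s_nonneg by linarith+
  qed
  obtain C where C: "C \<ge> 0" "\<And>x. (\<integral>\<^sup>+ z. ennreal (norm (x - z) powr (- ?o)) \<partial>\<mu>) \<le> ennreal C"
    using powr_integral_bounded[OF o] by metis
  let ?p = "\<lambda>p. norm (fst p - snd p :: 'a) powr (- ?o)"
  have p_int: "integrable (\<mu> \<Otimes>\<^sub>M \<mu>) ?p"
  proof (rule integrableI_bounded)
    have "(\<integral>\<^sup>+ p. ennreal (norm (?p p)) \<partial>(\<mu> \<Otimes>\<^sub>M \<mu>))
        = (\<integral>\<^sup>+ x. (\<integral>\<^sup>+ z. ennreal (norm (x - z) powr (- ?o)) \<partial>\<mu>) \<partial>\<mu>)"
      by (subst nn_integral_fst[symmetric]) auto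
    also have "\<dots> \<le> (\<integral>\<^sup>+ x. ennreal C \<partial>\<mu>)" by (intro nn_integral_mono C)
    also have "\<dots> < \<infinity>" by (simp add: emeasure_space_1[unfolded space_mu])
    finally show "(\<integral>\<^sup>+ p. ennreal (norm (?p p)) \<partial>(\<mu> \<Otimes>\<^sub>M \<mu>)) < \<infinity>" .
  qed measurable
  show ?thesis
  proof (rule Bochner_Integration.integrable_bound[where f="\<lambda>p. 2 * ?p p + 1 + log_part (fst p) + log_part (snd p)"])
    show "integrable (\<mu> \<Otimes>\<^sub>M \<mu>) (\<lambda>p. 2 * ?p p + 1 + log_part (fst p) + log_part (snd p))"
      using p_int integrable_pair[OF log_part_integrable] by auto
    show "AE p in \<mu> \<Otimes>\<^sub>M \<mu>. norm (pair_kernel p) \<le> norm (2 * ?p p + 1 + log_part (fst p) + log_part (snd p))"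
      using AE_pair
    proof eventually_elim
      case (elim p)
      let ?r = "norm (fst p - snd p)"
      have r: "?r > 0" using elim by simp
      have "kernel_radial s ?r \<le> 2 * ?r powr (- ?o) + 1"
      proof (cases "?r \<le> 1")
        case True
        then show ?thesis using kernel_radial_le_powr(2)[OF s_nonneg r] by simp
      next
        case False
        then have "kernel_radial s ?r \<le> kernel_radial s 1"
          using s_nonneg by (intro kernel_radial_antimono) auto
        also have "\<dots> \<le> 1" by (simp add: kernel_radial_def)
        finally show ?thesis by (simp add: add_increasing)
      qed
      moreover have "0 \<le> ?r powr (- ?o)" by simp
      moreover have "- (log_part (fst p) + log_part (snd p)) \<le> kernel_radial s ?r"
        using kernel_radial_lower elim by blast
      ultimately show ?case
        using log_part_nonneg[of "fst p"] log_part_nonneg[of "snd p"]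
        by (simp add: pair_kernel_def del: powr_ge_zero)
    qed
  qed measurable
qed

section \<open>Compactness of the support from minimality\<close>

definition interaction :: real where
  "interaction = (\<integral>p. pair_kernel p \<partial>(\<mu> \<Otimes>\<^sub>M \<mu>))"

lemma interaction_energy_eq: "interaction_energy s \<mu> = ereal interaction"
  unfolding interaction_energy_def interaction_def
proof (rule ext_integral_eq_integral[OF pair_kernel_integrable])
  show "AE p in \<mu> \<Otimes>\<^sub>M \<mu>. (case p of (z, z') \<Rightarrow> kernel s (z - z')) = ereal (pair_kernel p)"
    using AE_pair by eventually_elim (auto simp: kernel_def pair_kernel_def)
qed

lemma ext_integral_V: "ext_integral \<mu> V = ereal (\<integral>z. Vr z \<partial>\<mu>)"
  by (rule ext_integral_eq_integral[OF Vr_integrable V_finite_AE])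

lemma energy_eq: "mean_field_energy s V \<mu> = ereal (interaction + (\<integral>z. Vr z \<partial>\<mu>))"
  by (simp add: mean_field_energy_def interaction_energy_eq ext_integral_V)

text \<open>Splitting V evenly between the two variables makes the whole energy a single double
  integral. On B \<times> B that integral is the energy of the conditioned measure times the square
  of the mass of B.\<close>

definition pair_energy :: "'a \<times> 'a \<Rightarrow> real" where
  "pair_energy p = pair_kernel p + Vr (fst p) / 2 + Vr (snd p) / 2"

lemma pair_energy_integrable: "integrable (\<mu> \<Otimes>\<^sub>M \<mu>) pair_energy"
  unfolding pair_energy_def using pair_kernel_integrable integrable_pair[OF Vr_integrable] by auto

lemma pair_energy_integral: "(\<integral>p. pair_energy p \<partial>(\<mu> \<Otimes>\<^sub>M \<mu>)) = interaction + (\<integral>z. Vr z \<partial>\<mu>)"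
  unfolding pair_energy_def using pair_kernel_integrable integrable_pair[OF Vr_integrable]
  by (simp add: interaction_def)

text \<open>Minimality tested against \<mu> conditioned on \<open>B\<close>, multiplied by the
  squared mass.\<close>

lemma restricted_energy:
  assumes B: "B \<in> sets borel" and pos: "measure \<mu> B > 0"
  shows "(\<integral>p. pair_energy p \<partial>(\<mu> \<Otimes>\<^sub>M \<mu>)) * (measure \<mu> B)\<^sup>2 \<le> (\<integral>p. indicator (B \<times> B) p * pair_energy p \<partial>(\<mu> \<Otimes>\<^sub>M \<mu>))"
proof -
  note [measurable] = B
  define m where "m = measure \<mu> B"
  have m: "m > 0" "emeasure \<mu> B = ennreal m" using pos by (simp_all add: m_def emeasure_eq_measure)
  then have m0: "emeasure \<mu> B \<noteq> 0" by simp
  let ?\<nu> = "uniform_measure \<mu> B"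
  let ?g = "\<lambda>p. indicator (B \<times> B) p / m\<^sup>2 :: real"
  have "prob_space ?\<nu>" by (intro prob_space_uniform_measure) (use m in auto)
  then have \<nu>: "borel_probability ?\<nu>" by (simp add: borel_probability_def)
  have quot: "indicator B z / emeasure \<mu> B = ennreal (indicator B z / m)" for z
    using m by (auto simp: indicator_def divide_ennreal[symmetric] ennreal_1[symmetric] simp del: ennreal_1)
  have \<nu>_density: "?\<nu> = density \<mu> (\<lambda>z. ennreal (indicator B z / m))"
    unfolding uniform_measure_def quot ..
  have "(\<lambda>(x, y). (indicator B x / emeasure \<mu> B) * (indicator B y / emeasure \<mu> B))
      = (\<lambda>p. ennreal (?g p))"
    unfolding quot using m by (auto simp: fun_eq_iff indicator_def ennreal_mult[symmetric] power2_eq_square)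
  then have \<nu>\<nu>_density: "?\<nu> \<Otimes>\<^sub>M ?\<nu> = density (\<mu> \<Otimes>\<^sub>M \<mu>) (\<lambda>p. ennreal (?g p))"
    using uniform_measure_pair[OF prob_space_axioms _ m0] B by simp
  have BB [measurable]: "B \<times> B \<in> sets (\<mu> \<Otimes>\<^sub>M \<mu>)" using B by simp
  have pair_kernel_ind: "integrable (\<mu> \<Otimes>\<^sub>M \<mu>) (\<lambda>p. indicator (B \<times> B) p * pair_kernel p)"
    using integrable_mult_indicator[OF BB pair_kernel_integrable] by simp
  have Vr_ind: "integrable \<mu> (\<lambda>z. indicator B z * Vr z)"
    using integrable_mult_indicator[OF _ Vr_integrable, of B] by simp
  have I: "interaction_energy s ?\<nu> = ereal (\<integral>p. pair_kernel p \<partial>(?\<nu> \<Otimes>\<^sub>M ?\<nu>))"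
    unfolding interaction_energy_def
  proof (rule ext_integral_eq_integral)
    show "integrable (?\<nu> \<Otimes>\<^sub>M ?\<nu>) pair_kernel"
      unfolding \<nu>\<nu>_density using pair_kernel_ind by (subst integrable_density) auto
    show "AE p in ?\<nu> \<Otimes>\<^sub>M ?\<nu>. (case p of (z, z') \<Rightarrow> kernel s (z - z')) = ereal (pair_kernel p)"
      unfolding \<nu>\<nu>_density using AE_pair
      by (subst AE_density) (auto simp: kernel_def pair_kernel_def elim!: eventually_mono)
  qed
  have I': "(\<integral>p. pair_kernel p \<partial>(?\<nu> \<Otimes>\<^sub>M ?\<nu>)) = (\<integral>p. indicator (B \<times> B) p * pair_kernel p \<partial>(\<mu> \<Otimes>\<^sub>M \<mu>)) / m\<^sup>2"
    unfolding \<nu>\<nu>_density by (subst integral_density) auto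
  have W: "ext_integral ?\<nu> V = ereal (\<integral>z. Vr z \<partial>?\<nu>)"
  proof (rule ext_integral_eq_integral)
    show "integrable ?\<nu> Vr"
      unfolding \<nu>_density using Vr_ind m by (subst integrable_density) auto
    show "AE z in ?\<nu>. V z = ereal (Vr z)"
      unfolding \<nu>_density using V_finite_AE by (subst AE_density) (auto elim!: eventually_mono)
  qed
  have W': "(\<integral>z. Vr z \<partial>?\<nu>) = (\<integral>z. indicator B z * Vr z \<partial>\<mu>) / m"
    unfolding \<nu>_density using m by (subst integral_density) auto
  have "mean_field_energy s V \<mu> \<le> mean_field_energy s V ?\<nu>"
    using minimal \<nu> by (simp add: equilibrium_measure_def)
  then have min: "interaction + (\<integral>z. Vr z \<partial>\<mu>)
      \<le> (\<integral>p. indicator (B \<times> B) p * pair_kernel p \<partial>(\<mu> \<Otimes>\<^sub>M \<mu>)) / m\<^sup>2 + (\<integral>z. indicator B z * Vr z \<partial>\<mu>) / m"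
    unfolding energy_eq mean_field_energy_def[of s V ?\<nu>] I W I' W' by simp
  have f_int: "integrable (\<mu> \<Otimes>\<^sub>M \<mu>) (\<lambda>p. indicator (B \<times> B) p * Vr (fst p))"
    using integrable_mult_indicator[OF BB integrable_pair(1)[OF Vr_integrable]] by simp
  have s_int: "integrable (\<mu> \<Otimes>\<^sub>M \<mu>) (\<lambda>p. indicator (B \<times> B) p * Vr (snd p))"
    using integrable_mult_indicator[OF BB integrable_pair(3)[OF Vr_integrable]] by simp
  have f_val: "(\<integral>p. indicator (B \<times> B) p * Vr (fst p) \<partial>(\<mu> \<Otimes>\<^sub>M \<mu>)) = m * (\<integral>z. indicator B z * Vr z \<partial>\<mu>)"
  proof -
    have "(\<integral>p. indicator (B \<times> B) p * Vr (fst p) \<partial>(\<mu> \<Otimes>\<^sub>M \<mu>))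
        = (\<integral>x. (\<integral>y. (indicator B x * Vr x) * indicator B y \<partial>\<mu>) \<partial>\<mu>)"
      unfolding P.integral_fst'[OF f_int, symmetric] by (simp add: indicator_times mult_ac)
    also have "\<dots> = m * (\<integral>z. indicator B z * Vr z \<partial>\<mu>)"
      by (simp add: m_def mult.commute)
    finally show ?thesis .
  qed
  have s_val: "(\<integral>p. indicator (B \<times> B) p * Vr (snd p) \<partial>(\<mu> \<Otimes>\<^sub>M \<mu>)) = m * (\<integral>z. indicator B z * Vr z \<partial>\<mu>)"
  proof -
    have "(\<integral>p. indicator (B \<times> B) p * Vr (snd p) \<partial>(\<mu> \<Otimes>\<^sub>M \<mu>))
        = (\<integral>p. (case p of (x, y) \<Rightarrow> indicator (B \<times> B) (y, x) * Vr (snd (y, x))) \<partial>(\<mu> \<Otimes>\<^sub>M \<mu>))"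
      by (rule P.integral_product_swap[symmetric]) measurable
    also have "\<dots> = (\<integral>p. indicator (B \<times> B) p * Vr (fst p) \<partial>(\<mu> \<Otimes>\<^sub>M \<mu>))"
      by (intro Bochner_Integration.integral_cong) (auto simp: indicator_def)
    finally show ?thesis using f_val by simp
  qed
  have "(\<integral>p. indicator (B \<times> B) p * pair_energy p \<partial>(\<mu> \<Otimes>\<^sub>M \<mu>))
      = (\<integral>p. indicator (B \<times> B) p * pair_kernel p + (indicator (B \<times> B) p * Vr (fst p)) / 2
          + (indicator (B \<times> B) p * Vr (snd p)) / 2 \<partial>(\<mu> \<Otimes>\<^sub>M \<mu>))"
    by (intro Bochner_Integration.integral_cong) (auto simp: pair_energy_def algebra_simps)
  also have "\<dots> = (\<integral>p. indicator (B \<times> B) p * pair_kernel p \<partial>(\<mu> \<Otimes>\<^sub>M \<mu>)) + m * (\<integral>z. indicator B z * Vr z \<partial>\<mu>)"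
    using pair_kernel_ind f_int s_int by (simp add: f_val s_val)
  also have "\<dots> = ((\<integral>p. indicator (B \<times> B) p * pair_kernel p \<partial>(\<mu> \<Otimes>\<^sub>M \<mu>)) / m\<^sup>2 + (\<integral>z. indicator B z * Vr z \<partial>\<mu>) / m) * m\<^sup>2"
    using m by (simp add: field_simps power2_eq_square)
  finally have "(\<integral>p. indicator (B \<times> B) p * pair_energy p \<partial>(\<mu> \<Otimes>\<^sub>M \<mu>))
      = ((\<integral>p. indicator (B \<times> B) p * pair_kernel p \<partial>(\<mu> \<Otimes>\<^sub>M \<mu>)) / m\<^sup>2 + (\<integral>z. indicator B z * Vr z \<partial>\<mu>) / m) * m\<^sup>2" .
  moreover have "(interaction + (\<integral>z. Vr z \<partial>\<mu>)) * m\<^sup>2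
      \<le> ((\<integral>p. indicator (B \<times> B) p * pair_kernel p \<partial>(\<mu> \<Otimes>\<^sub>M \<mu>)) / m\<^sup>2 + (\<integral>z. indicator B z * Vr z \<partial>\<mu>) / m) * m\<^sup>2"
    by (intro mult_right_mono min) simp
  ultimately show ?thesis by (simp only: pair_energy_integral m_def[symmetric])
qed

text \<open>Off a large ball squared \<open>pair_energy\<close> exceeds the total energy by one, so conditioning \<open>\<mu>\<close> on
  that ball would lower the energy unless the ball already has full measure.\<close>

lemma compact_support:
  obtains R where "AE z in \<mu>. norm z \<le> R"
proof -
  define e where "e = (\<integral>p. pair_energy p \<partial>(\<mu> \<Otimes>\<^sub>M \<mu>))"
  obtain C where C: "C \<ge> 0" "\<And>z. V z \<noteq> \<infinity> \<Longrightarrow> - C \<le> Vr z / 2 - log_part z"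
    using confinement_lower by metis
  \<comment> \<open>The extra C pays for the other variable of the pair, whose half of the
    confinement is only known to be at least -C.\<close>
  obtain R where R: "\<And>z. R \<le> norm z \<Longrightarrow> V z \<noteq> \<infinity> \<Longrightarrow> e + 1 + C \<le> Vr z / 2 - log_part z"
    using confinement by metis
  define B where "B = ball (0::'a) R"
  have [measurable]: "B \<in> sets borel" by (simp add: B_def)
  have BB [measurable]: "B \<times> B \<in> sets (\<mu> \<Otimes>\<^sub>M \<mu>)" by simp
  define m where "m = measure \<mu> B"
  have m01: "0 \<le> m" "m \<le> 1" by (simp_all add: m_def)
  have BB_m: "measure (\<mu> \<Otimes>\<^sub>M \<mu>) (B \<times> B) = m\<^sup>2"
  proof -
    have "emeasure (\<mu> \<Otimes>\<^sub>M \<mu>) (B \<times> B) = emeasure \<mu> B * emeasure \<mu> B"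
      by (intro emeasure_pair_measure_Times) auto
    then show ?thesis
      by (simp add: emeasure_eq_measure P.emeasure_eq_measure m_def ennreal_mult[symmetric] power2_eq_square)
  qed
  have off: "AE p in \<mu> \<Otimes>\<^sub>M \<mu>. (1 - indicator (B \<times> B) p) * (e + 1) \<le> (1 - indicator (B \<times> B) p) * pair_energy p"
    using AE_pair
  proof eventually_elim
    case (elim p)
    show ?case
    proof (cases "p \<in> B \<times> B")
      case False
      then have out: "R \<le> norm (fst p) \<or> R \<le> norm (snd p)"
        by (cases p) (auto simp: B_def not_less)
      have fin: "V (fst p) \<noteq> \<infinity>" "V (snd p) \<noteq> \<infinity>" using elim by auto
      have "- (log_part (fst p) + log_part (snd p)) \<le> pair_kernel p"
        unfolding pair_kernel_def using elim by (intro kernel_radial_lower) auto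
      then have "e + 1 \<le> pair_energy p"
        using out R[OF _ fin(1)] R[OF _ fin(2)] C(2)[OF fin(1)] C(2)[OF fin(2)] by (auto simp: pair_energy_def)
      then show ?thesis using False by simp
    qed simp
  qed
  have ind_int: "integrable (\<mu> \<Otimes>\<^sub>M \<mu>) (\<lambda>p. indicator (B \<times> B) p * pair_energy p)"
    using integrable_mult_indicator[OF BB pair_energy_integrable] by simp
  have BB_int: "integrable (\<mu> \<Otimes>\<^sub>M \<mu>) (indicator (B \<times> B) :: 'a \<times> 'a \<Rightarrow> real)"
    by (intro integrable_real_indicator BB) (simp add: P.emeasure_eq_measure)
  have "(1 - m\<^sup>2) * (e + 1) = (\<integral>p. (1 - indicator (B \<times> B) p) * (e + 1) \<partial>(\<mu> \<Otimes>\<^sub>M \<mu>))"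
  proof -
    have "(\<integral>p. (1 - indicator (B \<times> B) p) \<partial>(\<mu> \<Otimes>\<^sub>M \<mu>)) = 1 - m\<^sup>2"
    proof (subst Bochner_Integration.integral_diff)
      show "(\<integral>p. 1 \<partial>(\<mu> \<Otimes>\<^sub>M \<mu>)) - (\<integral>p. indicator (B \<times> B) p \<partial>(\<mu> \<Otimes>\<^sub>M \<mu>)) = 1 - m\<^sup>2"
        using BB_m P.prob_space by simp
    qed (auto intro: BB_int)
    then show ?thesis by simp
  qed
  also have "\<dots> \<le> (\<integral>p. (1 - indicator (B \<times> B) p) * pair_energy p \<partial>(\<mu> \<Otimes>\<^sub>M \<mu>))"
    using ind_int pair_energy_integrable BB_int
    by (intro integral_mono_AE off) (auto simp: left_diff_distrib intro!: Bochner_Integration.integrable_diff)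
  also have "\<dots> = e - (\<integral>p. indicator (B \<times> B) p * pair_energy p \<partial>(\<mu> \<Otimes>\<^sub>M \<mu>))"
    using ind_int pair_energy_integrable by (simp add: left_diff_distrib e_def)
  finally have "(1 - m\<^sup>2) * (e + 1) \<le> e - (\<integral>p. indicator (B \<times> B) p * pair_energy p \<partial>(\<mu> \<Otimes>\<^sub>M \<mu>))" .
  \<comment> \<open>Conditioning is impossible if the ball has mass 0, but then both sides
    vanish.\<close>
  moreover have "e * m\<^sup>2 \<le> (\<integral>p. indicator (B \<times> B) p * pair_energy p \<partial>(\<mu> \<Otimes>\<^sub>M \<mu>))"
  proof (cases "m = 0")
    case True
    then have "B \<times> B \<in> null_sets (\<mu> \<Otimes>\<^sub>M \<mu>)"
      using BB_m by (simp add: null_sets_def P.emeasure_eq_measure)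
    then have "AE p in \<mu> \<Otimes>\<^sub>M \<mu>. p \<notin> B \<times> B" by (rule AE_not_in)
    then have "AE p in \<mu> \<Otimes>\<^sub>M \<mu>. indicator (B \<times> B) p * pair_energy p = 0"
      by eventually_elim simp
    then have "(\<integral>p. indicator (B \<times> B) p * pair_energy p \<partial>(\<mu> \<Otimes>\<^sub>M \<mu>)) = 0"
      by (rule integral_eq_zero_AE)
    then show ?thesis using True by simp
  next
    case False
    then have "measure \<mu> B > 0" using m01 by (simp add: m_def zero_less_measure_iff)
    from restricted_energy[OF _ this] show ?thesis by (simp add: m_def e_def)
  qed
  \<comment> \<open>The complement costs at least e + 1 per unit mass although it can account for at
    most e (1 - m^2); hence 1 - m^2 \<le> 0.\<close>
  ultimately have "(1 - m\<^sup>2) * (e + 1) \<le> e - e * m\<^sup>2" by simp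
  then have "1 \<le> m\<^sup>2" by (simp add: algebra_simps)
  then have "m = 1" using m01 power2_le_imp_le[of 1 m] by simp
  then have "AE z in \<mu>. z \<in> B"
    by (intro AE_prob_1) (simp add: m_def)
  then have "AE z in \<mu>. norm z \<le> R" by eventually_elim (simp add: B_def)
  then show thesis by (rule that)
qed

lemma eq_constant_eq: "eq_constant s V \<mu> = ereal (interaction + (\<integral>z. Vr z \<partial>\<mu>) / 2)"
proof -
  have "ext_integral \<mu> (\<lambda>z. V z / 2) = ereal (\<integral>z. Vr z / 2 \<partial>\<mu>)"
    by (rule ext_integral_eq_integral)
      (use Vr_integrable V_finite_AE in \<open>auto elim!: eventually_mono\<close>)
  then show ?thesis
    unfolding eq_constant_def energy_eq by simp
qed

end

section \<open>Blow-up and conclusion\<close>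

lemma null_sphere:
  "AE X in (lborel :: 'e::euclidean_space measure). norm (X - a) \<noteq> r"
proof -
  have eq: "{X. norm (X - a) = r} = sphere a r"
    by (auto simp: sphere_def dist_norm norm_minus_commute)
  have "sphere a r \<in> null_sets lborel"
    using negligible_sphere[of a r] by (auto simp: negligible_iff_null_sets null_sets_def)
  then have "AE X in lborel. X \<notin> sphere a r" by (rule AE_not_in)
  then show ?thesis by eventually_elim (use eq in auto)
qed

context riesz_configuration
begin

text \<open>\<open>h\<close> has to agree with \<open>U\<close> only off the finitely many points.
  Their complement is open, so the gradients agree there wherever \<open>U\<close> is
  differentiable, which excludes only a null set.\<close>

lemma dirichlet_energy_eq:
  assumes \<eta>: "\<eta> > 0" and h: "\<And>X. (\<And>i. i \<in> {1..n} \<Longrightarrow> X \<noteq> \<iota> (x i)) \<Longrightarrow> h X = U \<eta> X"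
  shows "dirichlet_energy w h = (\<integral>\<^sup>+ X. ennreal (w X * (norm (U_grad \<eta> X))\<^sup>2) \<partial>lborel)"
proof -
  let ?P = "(\<lambda>i. \<iota> (x i)) ` {1..n}"
  have "AE X in lborel. \<forall>i\<in>{1..n}. norm (X - \<iota> (x i)) \<noteq> \<eta>"
    by (intro AE_finite_allI) (auto simp: null_sphere)
  moreover have "AE X in lborel. \<forall>i\<in>{1..n}. norm (X - \<iota> (x i)) \<noteq> 0"
    by (intro AE_finite_allI null_sphere) auto
  ultimately have "AE X in lborel. w X * (norm (grad h X))\<^sup>2 = w X * (norm (U_grad \<eta> X))\<^sup>2"
    using N_null
  proof eventually_elim
    case (elim X)
    have "(U \<eta> has_derivative (\<lambda>v. v \<bullet> U_grad \<eta> X)) (at X)"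
      using U_deriv[OF \<eta> elim(3)] elim(1) by (simp add: gderiv_def)
    then have "(h has_derivative (\<lambda>v. v \<bullet> U_grad \<eta> X)) (at X)"
    proof (rule has_derivative_transform_within_open)
      show "open (- ?P)" by (intro open_Compl finite_imp_closed) simp
      show "X \<in> - ?P" using elim(2) by auto
      show "U \<eta> Y = h Y" if "Y \<in> - ?P" for Y using that by (intro h[symmetric]) auto
    qed
    then have "grad h X = U_grad \<eta> X" by (intro grad_eq) (simp add: gderiv_def)
    then show ?case by simp
  qed
  then have ae: "AE X in lebesgue. w X * (norm (grad h X))\<^sup>2 = w X * (norm (U_grad \<eta> X))\<^sup>2"
    by (rule AE_completion)
  have "dirichlet_energy w h = (\<integral>\<^sup>+ X. ennreal (w X * (norm (U_grad \<eta> X))\<^sup>2) \<partial>lebesgue)"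
    unfolding dirichlet_energy_def
    by (rule nn_integral_cong_AE, use ae in eventually_elim) (simp only:)
  also have "\<dots> = (\<integral>\<^sup>+ X. ennreal (w X * (norm (U_grad \<eta> X))\<^sup>2) \<partial>lborel)"
    by (rule nn_integral_completion)
  finally show ?thesis .
qed

end

section \<open>Rescaling by n^(1/d)\<close>

locale blow_up = equilibrium \<mu> M s V + riesz_extension w p s \<iota> \<pi> b \<sigma> N
  for \<mu> :: "'a::euclidean_space measure" and M s V
    and w :: "'e::euclidean_space \<Rightarrow> real" and p and \<iota> :: "'a \<Rightarrow> 'e" and \<pi> b \<sigma> N +
  fixes n :: nat and x :: "nat \<Rightarrow> 'a"
  assumes n_ge_1: "n \<ge> 1" and x_inj: "inj_on x {1..n}"
begin

definition \<Lambda> :: real where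
  "\<Lambda> = real n powr (1 / real DIM('a))"

definition x' :: "nat \<Rightarrow> 'a" where
  "x' i = \<Lambda> *\<^sub>R x i"

text \<open>The dilated measure keeps mass 1; the number n of charges stays as an explicit factor in
  the potential.\<close>

definition \<mu>' :: "'a measure" where
  "\<mu>' = distr \<mu> borel (\<lambda>z. \<Lambda> *\<^sub>R z)"

definition h :: "'a \<Rightarrow> real" where
  "h a = (\<integral>z. kernel_radial s (norm (a - z)) \<partial>\<mu>)"

lemma \<Lambda>_pos: "\<Lambda> > 0"
  using n_ge_1 by (simp add: \<Lambda>_def)

lemma blow_up_configuration:
  obtains M' R0 where "riesz_configuration w p s \<iota> \<pi> b \<sigma> N \<mu>' M' R0 n x'"
proof -
  obtain R where R: "AE z in \<mu>. norm z \<le> R" using compact_support by metis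
  define R0 where "R0 = max (max 1 (\<Lambda> * R)) (Max ((\<lambda>i. norm (x' i)) ` {1..n}))"
  \<comment> \<open>Dilation divides densities by the d-th power of \<Lambda>. The sign of
    \<open>M\<close> is not prescribed, hence the maximum with 0.\<close>
  define M' where "M' = max 0 M * \<Lambda> powr (- real DIM('a))"
  have "riesz_configuration w p s \<iota> \<pi> b \<sigma> N \<mu>' M' R0 n x'"
  proof (intro riesz_configuration.intro riesz_configuration_axioms.intro riesz_potential.intro
      riesz_extension_axioms compact_density_measure.intro compact_density_measure_axioms.intro
      bounded_density_measure.intro bounded_density_measure_axioms.intro)
    show "prob_space \<mu>'" unfolding \<mu>'_def by (rule prob_space_distr) simp
    show "sets \<mu>' = sets borel" by (simp add: \<mu>'_def)
    show "(\<integral>\<^sup>+ z. f z \<partial>\<mu>') \<le> ennreal M' * (\<integral>\<^sup>+ z. f z \<partial>lborel)"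
      if [measurable]: "f \<in> borel_measurable borel" for f :: "'a \<Rightarrow> ennreal"
    proof -
      have "(\<integral>\<^sup>+ z. f z \<partial>\<mu>') = (\<integral>\<^sup>+ z. f (\<Lambda> *\<^sub>R z) \<partial>\<mu>)"
        unfolding \<mu>'_def by (subst nn_integral_distr) auto
      also have "\<dots> \<le> ennreal M * (\<integral>\<^sup>+ z. f (\<Lambda> *\<^sub>R z) \<partial>lborel)"
        by (intro density_le) measurable
      also have "\<dots> = ennreal M * (ennreal (\<Lambda> powr (- real DIM('a))) * (\<integral>\<^sup>+ z. f z \<partial>lborel))"
        by (subst nn_integral_lborel_scaleR[OF _ \<Lambda>_pos]) auto
      also have "\<dots> \<le> ennreal (max 0 M) * (ennreal (\<Lambda> powr (- real DIM('a))) * (\<integral>\<^sup>+ z. f z \<partial>lborel))"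
        by (intro mult_right_mono ennreal_leI) auto
      also have "\<dots> = ennreal M' * (\<integral>\<^sup>+ z. f z \<partial>lborel)"
        by (simp add: M'_def ennreal_mult mult.assoc)
      finally show ?thesis .
    qed
    have "AE z in \<mu>. norm (\<Lambda> *\<^sub>R z) \<le> R0"
      using R
    proof eventually_elim
      case (elim z)
      then have "\<Lambda> * norm z \<le> \<Lambda> * R" using \<Lambda>_pos by (intro mult_left_mono) auto
      then show ?case using \<Lambda>_pos by (simp add: R0_def le_max_iff_disj)
    qed
    then show "AE z in \<mu>'. norm z \<le> R0"
      unfolding \<mu>'_def by (subst AE_distr_iff) auto
    show "1 \<le> R0" by (simp add: R0_def)
    show "1 \<le> n" by (rule n_ge_1)
    show "inj_on x' {1..n}"
    proof (rule inj_onI)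
      fix i j assume ij: "i \<in> {1..n}" "j \<in> {1..n}" "x' i = x' j"
      then have "x i = x j" using \<Lambda>_pos by (simp add: x'_def)
      then show "i = j" using ij inj_onD[OF x_inj] by blast
    qed
    show "norm (x' i) \<le> R0" if "i \<in> {1..n}" for i
      using that unfolding R0_def by (intro max.coboundedI2 Max_ge) auto
  qed
  then show thesis by (rule that)
qed

lemma \<Lambda>_powr: "\<Lambda> powr a = real n powr (a / real DIM('a))"
  by (simp add: \<Lambda>_def powr_powr)

lemma kernel_scaled:
  assumes "r > 0 \<or> s \<noteq> 0" "r \<ge> 0"
  shows "kernel_radial s (\<Lambda> * r) = \<Lambda> powr (- s) * kernel_radial s r - (if s = 0 then ln \<Lambda> else 0)"
  using kernel_radial_scale[OF \<Lambda>_pos assms] \<Lambda>_pos by auto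

lemma integral_\<mu>': "f \<in> borel_measurable borel \<Longrightarrow> (\<integral>z. f z \<partial>\<mu>') = (\<integral>z. f (\<Lambda> *\<^sub>R z) \<partial>\<mu>)"
  for f :: "'a \<Rightarrow> real"
  unfolding \<mu>'_def by (rule integral_distr) auto

lemma kernel_emb_integrable: "integrable \<mu> (\<lambda>z. kernel_radial s (norm (X - \<iota> z)))"
proof -
  obtain R where R: "AE z in \<mu>. norm z \<le> R" using compact_support by metis
  interpret Q: riesz_potential w p s \<iota> \<pi> b \<sigma> N \<mu> M "max 1 R"
  proof
    show "AE z in \<mu>. norm z \<le> max 1 R" using R by eventually_elim simp
  qed simp
  show ?thesis by (rule Q.kernel_integrable)
qed

lemma emb_scale: "\<iota> (c *\<^sub>R z) = c *\<^sub>R \<iota> z"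
  by (rule linear_scale[OF linear_emb])

text \<open>Rescaling shifts the logarithmic kernel by the constant ln \<Lambda>. The n shifts from
  the points cancel the shift of the background by neutrality. The points themselves are excluded
  because the kernel has only a default value at 0.\<close>

lemma blown_up_eq:
  assumes X: "\<And>i. i \<in> {1..n} \<Longrightarrow> X \<noteq> \<iota> (x' i)"
  shows "blown_up_potential \<iota> s \<mu> n x X =
    (\<Sum>i\<in>{1..n}. kernel_radial s (norm (X - \<iota> (x' i)))) - real n * (\<integral>z. kernel_radial s (norm (X - \<iota> z)) \<partial>\<mu>')"
proof -
  define Y where "Y = (real n powr (- 1 / real DIM('a))) *\<^sub>R X"
  define l where "l = (if s = 0 then ln \<Lambda> else 0)"
  have inv: "real n powr (- 1 / real DIM('a)) = inverse \<Lambda>"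
    using \<Lambda>_powr[of "- 1"] \<Lambda>_pos by (simp add: powr_minus)
  have XY: "X - \<iota> (\<Lambda> *\<^sub>R z) = \<Lambda> *\<^sub>R (Y - \<iota> z)" for z
    unfolding Y_def inv using \<Lambda>_pos by (simp add: emb_scale scaleR_diff_right)
  then have norm_XY: "norm (X - \<iota> (\<Lambda> *\<^sub>R z)) = \<Lambda> * norm (Y - \<iota> z)" for z
    using \<Lambda>_pos by simp
  have one: "kernel_radial s (norm (X - \<iota> (\<Lambda> *\<^sub>R z))) = \<Lambda> powr (- s) * kernel_radial s (norm (Y - \<iota> z)) - l"
    if "Y - \<iota> z \<noteq> 0" for z
    unfolding norm_XY l_def using that by (intro kernel_scaled) auto
  have pts: "kernel_radial s (norm (X - \<iota> (x' i))) = \<Lambda> powr (- s) * kernel_radial s (norm (Y - \<iota> (x i))) - l"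
    if "i \<in> {1..n}" for i
    unfolding x'_def using X[OF that] XY[of "x i"] by (intro one) (auto simp: x'_def)
  have "(\<integral>z. kernel_radial s (norm (X - \<iota> z)) \<partial>\<mu>') = (\<integral>z. kernel_radial s (norm (X - \<iota> (\<Lambda> *\<^sub>R z))) \<partial>\<mu>)"
    by (rule integral_\<mu>') measurable
  also have "\<dots> = (\<integral>z. \<Lambda> powr (- s) * kernel_radial s (norm (Y - \<iota> z)) - l \<partial>\<mu>)"
  proof (rule integral_cong_AE)
    show "AE z in \<mu>. kernel_radial s (norm (X - \<iota> (\<Lambda> *\<^sub>R z))) = \<Lambda> powr (- s) * kernel_radial s (norm (Y - \<iota> z)) - l"
      using AE_neq[of "\<pi> Y"] by eventually_elim (intro one emb_neq)
  qed measurable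
  also have "\<dots> = \<Lambda> powr (- s) * (\<integral>z. kernel_radial s (norm (Y - \<iota> z)) \<partial>\<mu>) - l"
    using kernel_emb_integrable[of Y] prob_space by (subst Bochner_Integration.integral_diff) auto
  finally have I: "(\<integral>z. kernel_radial s (norm (X - \<iota> z)) \<partial>\<mu>')
      = \<Lambda> powr (- s) * (\<integral>z. kernel_radial s (norm (Y - \<iota> z)) \<partial>\<mu>) - l" .
  have "(\<Sum>i\<in>{1..n}. kernel_radial s (norm (X - \<iota> (x' i))))
      = (\<Sum>i\<in>{1..n}. \<Lambda> powr (- s) * kernel_radial s (norm (Y - \<iota> (x i))) - l)"
    by (intro sum.cong refl pts)
  also have "\<dots> = \<Lambda> powr (- s) * (\<Sum>i\<in>{1..n}. kernel_radial s (norm (Y - \<iota> (x i)))) - real n * l"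
    by (simp add: sum_subtractf sum_distrib_left)
  finally have S: "(\<Sum>i\<in>{1..n}. kernel_radial s (norm (X - \<iota> (x' i))))
      = \<Lambda> powr (- s) * (\<Sum>i\<in>{1..n}. kernel_radial s (norm (Y - \<iota> (x i)))) - real n * l" .
  show ?thesis
    unfolding blown_up_potential_def fluct_potential_def Y_def[symmetric] S I \<Lambda>_powr
    by (simp add: algebra_simps)
qed

text \<open>Applies \<open>energy_limit\<close> in blown-up variables and scales back. The pair sum,
  the potential at the points and the self-energy of \<mu> all carry the factor
  \<open>\<Lambda> powr (- s)\<close> and, for the logarithm, a shift.\<close>

lemma trunc_energy_limit:
  obtains L where
    "((\<lambda>\<eta>. ereal (1 / flux_coefficient) *
      (ereal (1 / real n) * enn2ereal (dirichlet_energy w (trunc_potential \<iota> s \<mu> n x \<eta>))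
        - ereal (flux_coefficient * kernel_radial s \<eta>))) \<longlongrightarrow> ereal L) (at_right 0)"
    "real n powr (1 + s / real DIM('a)) * L - (if s = 0 then real n / real DIM('a) * ln (real n) else 0)
      = (\<Sum>i\<in>{1..n}. \<Sum>j\<in>{1..n} - {i}. kernel_radial s (norm (x i - x j)))
        - 2 * real n * (\<Sum>i\<in>{1..n}. h (x i)) + (real n)\<^sup>2 * interaction"
proof -
  obtain M' R0 where conf: "riesz_configuration w p s \<iota> \<pi> b \<sigma> N \<mu>' M' R0 n x'"
    using blow_up_configuration by metis
  interpret C: riesz_configuration w p s \<iota> \<pi> b \<sigma> N \<mu>' M' R0 n x' by (rule conf)
  have n: "real n > 0" using n_ge_1 by simp
  have energy: "dirichlet_energy w (trunc_potential \<iota> s \<mu> n x \<eta>)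
      = (\<integral>\<^sup>+ X. ennreal (w X * (norm (C.U_grad \<eta> X))\<^sup>2) \<partial>lborel)" if \<eta>: "\<eta> > 0" for \<eta>
  proof (rule C.dirichlet_energy_eq[OF \<eta>])
    fix X assume X: "\<And>i. i \<in> {1..n} \<Longrightarrow> X \<noteq> \<iota> (x' i)"
    have B: "blown_up_potential \<iota> s \<mu> n x X =
        (\<Sum>i\<in>{1..n}. kernel_radial s (norm (X - \<iota> (x' i)))) - real n * (\<integral>z. kernel_radial s (norm (X - \<iota> z)) \<partial>\<mu>')"
      by (rule blown_up_eq) (rule X)
    have "trunc_potential \<iota> s \<mu> n x \<eta> X
        = (\<Sum>i\<in>{1..n}. kernel_radial s (norm (X - \<iota> (x' i))) - trunc_kernel s \<eta> (X - \<iota> (x' i)))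
          - real n * (\<integral>z. kernel_radial s (norm (X - \<iota> z)) \<partial>\<mu>')"
      unfolding trunc_potential_def B sum_subtractf by (simp add: x'_def \<Lambda>_def)
    also have "(\<Sum>i\<in>{1..n}. kernel_radial s (norm (X - \<iota> (x' i))) - trunc_kernel s \<eta> (X - \<iota> (x' i)))
        = (\<Sum>i\<in>{1..n}. trunc_radial s \<eta> (X - \<iota> (x' i)))"
      using X by (intro sum.cong refl)
        (simp add: trunc_kernel_max[OF s_nonneg \<eta>] trunc_radial_def)
    finally show "trunc_potential \<iota> s \<mu> n x \<eta> X = C.U \<eta> X"
      by (simp add: C.U_def C.H_def)
  qed
  have lim: "((\<lambda>\<eta>. ereal (1 / flux_coefficient) *
      (ereal (1 / real n) * enn2ereal (dirichlet_energy w (trunc_potential \<iota> s \<mu> n x \<eta>))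
        - ereal (flux_coefficient * kernel_radial s \<eta>))) \<longlongrightarrow> ereal C.renormalized_energy) (at_right 0)"
    using C.energy_limit
  proof (rule Lim_transform_eventually)
    show "\<forall>\<^sub>F \<eta> in at_right 0. ereal (1 / flux_coefficient) *
      (ereal (1 / real n) * enn2ereal (\<integral>\<^sup>+ X. ennreal (w X * (norm (C.U_grad \<eta> X))\<^sup>2) \<partial>lborel)
        - ereal (flux_coefficient * kernel_radial s \<eta>))
      = ereal (1 / flux_coefficient) *
      (ereal (1 / real n) * enn2ereal (dirichlet_energy w (trunc_potential \<iota> s \<mu> n x \<eta>))
        - ereal (flux_coefficient * kernel_radial s \<eta>))"
      using eventually_at_right_less[of 0] by eventually_elim (simp add: energy)
  qed
  define l where "l = (if s = 0 then ln \<Lambda> else 0)"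
  define S where "S = (\<Sum>i\<in>{1..n}. \<Sum>j\<in>{1..n} - {i}. kernel_radial s (norm (x i - x j)))"
  have diff: "norm (\<Lambda> *\<^sub>R y - \<Lambda> *\<^sub>R z) = \<Lambda> * norm (y - z)" for y z :: 'a
    using \<Lambda>_pos by (simp add: scaleR_diff_right[symmetric])
  have kint: "integrable \<mu> (\<lambda>z. kernel_radial s (norm (a - z)))" for a
    using kernel_emb_integrable[of "\<iota> a"] by (simp add: emb_diff norm_emb)
  have H': "C.H (\<iota> (\<Lambda> *\<^sub>R a)) = \<Lambda> powr (- s) * h a - l" for a
  proof -
    have "C.H (\<iota> (\<Lambda> *\<^sub>R a)) = (\<integral>z. kernel_radial s (norm (\<Lambda> *\<^sub>R a - z)) \<partial>\<mu>')"
      by (simp add: C.H_def emb_diff norm_emb)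
    also have "\<dots> = (\<integral>z. kernel_radial s (norm (\<Lambda> *\<^sub>R a - \<Lambda> *\<^sub>R z)) \<partial>\<mu>)"
      by (rule integral_\<mu>') measurable
    also have "\<dots> = (\<integral>z. \<Lambda> powr (- s) * kernel_radial s (norm (a - z)) - l \<partial>\<mu>)"
    proof (rule integral_cong_AE)
      show "AE z in \<mu>. kernel_radial s (norm (\<Lambda> *\<^sub>R a - \<Lambda> *\<^sub>R z)) = \<Lambda> powr (- s) * kernel_radial s (norm (a - z)) - l"
        using AE_neq[of a] unfolding diff l_def by eventually_elim (intro kernel_scaled, auto)
    qed measurable
    also have "\<dots> = \<Lambda> powr (- s) * h a - l"
      using kint[of a] prob_space by (subst Bochner_Integration.integral_diff) (auto simp: h_def)
    finally show ?thesis .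
  qed
  have h_int: "integrable \<mu> h" and h_val: "(\<integral>z. h z \<partial>\<mu>) = interaction"
  proof -
    have h_eq: "h = (\<lambda>a. \<integral>z. pair_kernel (a, z) \<partial>\<mu>)" by (simp add: h_def pair_kernel_def fun_eq_iff)
    show "integrable \<mu> h" unfolding h_eq by (rule P.integrable_fst'[OF pair_kernel_integrable])
    show "(\<integral>z. h z \<partial>\<mu>) = interaction"
      unfolding h_eq interaction_def by (rule P.integral_fst'[OF pair_kernel_integrable])
  qed
  have I': "(\<integral>z. C.H (\<iota> z) \<partial>\<mu>') = \<Lambda> powr (- s) * interaction - l"
  proof -
    have "(\<integral>z. C.H (\<iota> z) \<partial>\<mu>') = (\<integral>z. C.H (\<iota> (\<Lambda> *\<^sub>R z)) \<partial>\<mu>)"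
      by (rule integral_\<mu>') measurable
    also have "\<dots> = (\<integral>z. \<Lambda> powr (- s) * h z - l \<partial>\<mu>)" by (simp only: H')
    also have "\<dots> = \<Lambda> powr (- s) * interaction - l"
      using h_int prob_space by (subst Bochner_Integration.integral_diff) (auto simp: h_val)
    finally show ?thesis .
  qed
  have S': "(\<Sum>i\<in>{1..n}. \<Sum>j\<in>{1..n} - {i}. kernel_radial s (norm (x' i - x' j)))
      = \<Lambda> powr (- s) * S - real n * (real n - 1) * l"
  proof -
    have "(\<Sum>i\<in>{1..n}. \<Sum>j\<in>{1..n} - {i}. kernel_radial s (norm (x' i - x' j)))
        = (\<Sum>i\<in>{1..n}. \<Sum>j\<in>{1..n} - {i}. \<Lambda> powr (- s) * kernel_radial s (norm (x i - x j)) - l)"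
    proof (intro sum.cong refl)
      fix i j assume "i \<in> {1..n}" "j \<in> {1..n} - {i}"
      then have "x i \<noteq> x j" using x_inj unfolding inj_on_def by blast
      then show "kernel_radial s (norm (x' i - x' j)) = \<Lambda> powr (- s) * kernel_radial s (norm (x i - x j)) - l"
        unfolding x'_def diff l_def by (intro kernel_scaled) auto
    qed
    also have "\<dots> = \<Lambda> powr (- s) * S - real n * (real n - 1) * l"
      using n_ge_1 by (simp add: S_def sum_subtractf sum_distrib_left of_nat_diff)
    finally show ?thesis .
  qed
  have "real n * C.renormalized_energy
      = (\<Lambda> powr (- s) * S - real n * (real n - 1) * l)
        - 2 * real n * (\<Sum>i\<in>{1..n}. \<Lambda> powr (- s) * h (x i) - l)
        + (real n)\<^sup>2 * (\<Lambda> powr (- s) * interaction - l)"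
    unfolding C.renormalized_energy_def S' I' using n by (simp add: x'_def H')
  \<comment> \<open>The shifts add up to -n(n-1) + 2n^2 - n^2 = n times l: only the missing diagonal
    of the pair sum survives. This is the source of the term (n/d) log n.\<close>
  also have "\<dots> = \<Lambda> powr (- s) * (S - 2 * real n * (\<Sum>i\<in>{1..n}. h (x i)) + (real n)\<^sup>2 * interaction) + real n * l"
  proof -
    have "(\<Sum>i\<in>{1..n}. \<Lambda> powr (- s) * h (x i) - l) = \<Lambda> powr (- s) * (\<Sum>i\<in>{1..n}. h (x i)) - real n * l"
      by (simp add: sum_subtractf sum_distrib_left)
    then show ?thesis by (simp only:) (simp add: algebra_simps power2_eq_square)
  qed
  finally have L: "real n * C.renormalized_energy
      = \<Lambda> powr (- s) * (S - 2 * real n * (\<Sum>i\<in>{1..n}. h (x i)) + (real n)\<^sup>2 * interaction) + real n * l" .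
  have "real n powr (1 + s / real DIM('a)) * C.renormalized_energy = \<Lambda> powr s * (real n * C.renormalized_energy)"
    using n by (simp add: \<Lambda>_powr powr_add)
  also have "\<dots> = (\<Lambda> powr s * \<Lambda> powr (- s)) * (S - 2 * real n * (\<Sum>i\<in>{1..n}. h (x i)) + (real n)\<^sup>2 * interaction)
      + \<Lambda> powr s * (real n * l)"
    unfolding L by (simp only: distrib_left mult.assoc)
  also have "\<Lambda> powr s * \<Lambda> powr (- s) = 1"
    using \<Lambda>_pos by (simp add: powr_add[symmetric])
  also have "\<Lambda> powr s * (real n * l) = (if s = 0 then real n / real DIM('a) * ln (real n) else 0)"
    using \<Lambda>_pos n by (simp add: l_def \<Lambda>_def ln_powr)
  finally have "real n powr (1 + s / real DIM('a)) * C.renormalized_energy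
        - (if s = 0 then real n / real DIM('a) * ln (real n) else 0)
      = S - 2 * real n * (\<Sum>i\<in>{1..n}. h (x i)) + (real n)\<^sup>2 * interaction"
    by simp
  with lim show thesis unfolding S_def by (rule that)
qed

lemma eq_potential_eq: "eq_potential s \<mu> a = ereal (h a)"
  unfolding eq_potential_def h_def
proof (rule ext_integral_eq_integral)
  show "integrable \<mu> (\<lambda>z. kernel_radial s (norm (a - z)))"
    using kernel_emb_integrable[of "\<iota> a"] by (simp add: emb_diff norm_emb)
  show "AE z in \<mu>. kernel s (a - z) = ereal (kernel_radial s (norm (a - z)))"
    using AE_neq[of a] by eventually_elim (simp add: kernel_def)
qed

text \<open>Both sides are infinite as soon as one \<open>V (x i)\<close> is.\<close>

lemma hamiltonian_split:
  assumes T: "T = (\<Sum>i\<in>{1..n}. \<Sum>j\<in>{1..n} - {i}. kernel_radial s (norm (x i - x j)))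
        - 2 * real n * (\<Sum>i\<in>{1..n}. h (x i)) + (real n)\<^sup>2 * interaction"
  shows "hamiltonian s V n x = ereal ((real n)\<^sup>2) * mean_field_energy s V \<mu>
         + ereal (2 * real n) * (\<Sum>i\<in>{1..n}. eq_zeta s V \<mu> (x i)) + ereal T"
proof -
  define S where "S = (\<Sum>i\<in>{1..n}. \<Sum>j\<in>{1..n} - {i}. kernel_radial s (norm (x i - x j)))"
  define W where "W = (\<integral>z. Vr z \<partial>\<mu>)"
  have n: "real n > 0" using n_ge_1 by simp
  have "(\<Sum>i\<in>{1..n}. \<Sum>j\<in>{1..n} - {i}. kernel s (x i - x j))
      = (\<Sum>i\<in>{1..n}. \<Sum>j\<in>{1..n} - {i}. ereal (kernel_radial s (norm (x i - x j))))"
  proof (intro sum.cong refl)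
    fix i j assume "i \<in> {1..n}" "j \<in> {1..n} - {i}"
    then have "x i \<noteq> x j" using x_inj unfolding inj_on_def by blast
    then show "kernel s (x i - x j) = ereal (kernel_radial s (norm (x i - x j)))"
      by (simp add: kernel_def)
  qed
  then have ham: "hamiltonian s V n x = ereal S + ereal (real n) * (\<Sum>i\<in>{1..n}. V (x i))"
    by (simp add: hamiltonian_def S_def)
  have zeta: "eq_zeta s V \<mu> (x i) = ereal (h (x i)) + V (x i) / 2 - ereal (interaction + W / 2)" for i
    by (simp add: eq_zeta_def eq_potential_eq eq_constant_eq W_def)
  show ?thesis
  proof (cases "\<exists>i\<in>{1..n}. V (x i) = \<infinity>")
    case True
    then obtain i where i: "i \<in> {1..n}" "V (x i) = \<infinity>" by blast
    have "(\<Sum>i\<in>{1..n}. V (x i)) = \<infinity>"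
      using i by (subst sum_Pinfty) auto
    moreover have "eq_zeta s V \<mu> (x i) = \<infinity>" unfolding zeta using i by simp
    then have "(\<Sum>i\<in>{1..n}. eq_zeta s V \<mu> (x i)) = \<infinity>"
      using i by (subst sum_Pinfty) auto
    ultimately show ?thesis
      unfolding ham energy_eq using n by simp
  next
    case False
    define v where "v i = Vr (x i)" for i
    have v: "V (x i) = ereal (v i)" if "i \<in> {1..n}" for i
      using False that V_not_MInf[of "x i"] by (cases "V (x i)") (auto simp: v_def Vr_def)
    have 1: "(\<Sum>i\<in>{1..n}. V (x i)) = ereal (\<Sum>i\<in>{1..n}. v i)"
      using v by simp
    have "(\<Sum>i\<in>{1..n}. eq_zeta s V \<mu> (x i)) = (\<Sum>i\<in>{1..n}. ereal (h (x i) + v i / 2 - (interaction + W / 2)))"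
      using v by (intro sum.cong refl) (simp add: zeta)
    also have "\<dots> = ereal (\<Sum>i\<in>{1..n}. h (x i) + v i / 2 - (interaction + W / 2))"
      by simp
    also have "(\<Sum>i\<in>{1..n}. h (x i) + v i / 2 - (interaction + W / 2))
        = (\<Sum>i\<in>{1..n}. h (x i)) + (\<Sum>i\<in>{1..n}. v i) / 2 - real n * (interaction + W / 2)"
      by (simp add: sum.distrib sum_subtractf sum_divide_distrib)
    finally have 2: "(\<Sum>i\<in>{1..n}. eq_zeta s V \<mu> (x i))
        = ereal ((\<Sum>i\<in>{1..n}. h (x i)) + (\<Sum>i\<in>{1..n}. v i) / 2 - real n * (interaction + W / 2))" .
    \<comment> \<open>With I the interaction and W the integral of V, the constants cancel: n^2 (I +
      W) - 2 n^2 (I + W/2) + n^2 I = 0. The potentials at the points cancel as well, which leaves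
      the pair sum and n times the sum of V.\<close>
    show ?thesis
      unfolding ham energy_eq 1 2 T S_def[symmetric] W_def[symmetric]
      by (simp add: algebra_simps power2_eq_square)
  qed
qed

text \<open>The parameters c and E stand for the constant and the energy, whose definitions branch
  on the extension; each branch is substituted when the locale is instantiated.\<close>

lemma splitting_formula:
  assumes c: "c = flux_coefficient"
    and E: "\<And>\<eta>. E \<eta> = dirichlet_energy w (trunc_potential \<iota> s \<mu> n x \<eta>)"
  shows "\<exists>L::real.
    ((\<lambda>\<eta>. ereal (1 / c) * (ereal (1 / real n) * enn2ereal (E \<eta>) - ereal (c * kernel_radial s \<eta>)))
      \<longlongrightarrow> ereal L) (at_right 0) \<and>
    (s \<noteq> 0 \<longrightarrow>
       hamiltonian s V n x =
         ereal ((real n)\<^sup>2) * mean_field_energy s V \<mu>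
         + ereal (2 * real n) * (\<Sum>i\<in>{1..n}. eq_zeta s V \<mu> (x i))
         + ereal (real n powr (1 + s / real DIM('a)) * L)) \<and>
    (s = 0 \<longrightarrow>
       hamiltonian s V n x =
         ereal ((real n)\<^sup>2) * mean_field_energy s V \<mu>
         + ereal (2 * real n) * (\<Sum>i\<in>{1..n}. eq_zeta s V \<mu> (x i))
         - ereal (real n / real DIM('a) * ln (real n))
         + ereal (real n * L))"
proof -
  obtain L where lim: "((\<lambda>\<eta>. ereal (1 / flux_coefficient) *
      (ereal (1 / real n) * enn2ereal (dirichlet_energy w (trunc_potential \<iota> s \<mu> n x \<eta>))
        - ereal (flux_coefficient * kernel_radial s \<eta>))) \<longlongrightarrow> ereal L) (at_right 0)"
    and L: "real n powr (1 + s / real DIM('a)) * L - (if s = 0 then real n / real DIM('a) * ln (real n) else 0)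
      = (\<Sum>i\<in>{1..n}. \<Sum>j\<in>{1..n} - {i}. kernel_radial s (norm (x i - x j)))
        - 2 * real n * (\<Sum>i\<in>{1..n}. h (x i)) + (real n)\<^sup>2 * interaction"
    by (rule trunc_energy_limit)
  note split = hamiltonian_split[OF L]
  show ?thesis
  proof (intro exI[of _ L] conjI impI)
    show "((\<lambda>\<eta>. ereal (1 / c) * (ereal (1 / real n) * enn2ereal (E \<eta>) - ereal (c * kernel_radial s \<eta>)))
      \<longlongrightarrow> ereal L) (at_right 0)"
      using lim by (simp only: c E)
    show "hamiltonian s V n x = ereal ((real n)\<^sup>2) * mean_field_energy s V \<mu>
         + ereal (2 * real n) * (\<Sum>i\<in>{1..n}. eq_zeta s V \<mu> (x i))
         + ereal (real n powr (1 + s / real DIM('a)) * L)" if "s \<noteq> 0"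
      using split that by simp
    show "hamiltonian s V n x = ereal ((real n)\<^sup>2) * mean_field_energy s V \<mu>
         + ereal (2 * real n) * (\<Sum>i\<in>{1..n}. eq_zeta s V \<mu> (x i))
         - ereal (real n / real DIM('a) * ln (real n))
         + ereal (real n * L)" if s: "s = 0"
    proof -
      have real: "real n powr (1 + s / real DIM('a)) * L - (if s = 0 then real n / real DIM('a) * ln (real n) else 0)
          = - (real n / real DIM('a) * ln (real n)) + real n * L"
        using s n_ge_1 by simp
      have "A + ereal (- a + c) = A - ereal a + ereal c" for A :: ereal and a c
        by (cases A) auto
      then show ?thesis
        unfolding split real .
    qed
  qed
qed

end

section \<open>From the hypotheses to the two extensions\<close>

lemma has_bounded_density_le:
  fixes \<mu> :: "'a::euclidean_space measure"
  assumes "has_bounded_density \<mu>" and prob: "prob_space \<mu>"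
  obtains M where "bounded_density_measure \<mu> M"
proof -
  obtain \<rho> M where \<rho>[measurable]: "\<rho> \<in> borel_measurable borel"
    and b: "AE z in lborel. 0 \<le> \<rho> z \<and> \<rho> z \<le> M"
    and \<mu>: "\<mu> = density lborel (\<lambda>z. ennreal (\<rho> z))"
    using assms(1) by (auto simp: has_bounded_density_def)
  have "bounded_density_measure \<mu> M"
  proof (intro bounded_density_measure.intro bounded_density_measure_axioms.intro prob)
    show "sets \<mu> = sets borel" by (simp add: \<mu>)
    fix f :: "'a \<Rightarrow> ennreal" assume [measurable]: "f \<in> borel_measurable borel"
    have "(\<integral>\<^sup>+ z. f z \<partial>\<mu>) = (\<integral>\<^sup>+ z. ennreal (\<rho> z) * f z \<partial>lborel)"
      unfolding \<mu> by (rule nn_integral_density) auto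
    also have "\<dots> \<le> (\<integral>\<^sup>+ z. ennreal M * f z \<partial>lborel)"
      by (rule nn_integral_mono_AE, use b in eventually_elim) (auto intro!: mult_right_mono ennreal_leI)
    also have "\<dots> = ennreal M * (\<integral>\<^sup>+ z. f z \<partial>lborel)"
      by (rule nn_integral_cmult) auto
    finally show "(\<integral>\<^sup>+ z. f z \<partial>\<mu>) \<le> ennreal M * (\<integral>\<^sup>+ z. f z \<partial>lborel)" .
  qed
  then show thesis by (rule that)
qed

theorem proposition1p6:
  fixes V :: "'a::euclidean_space \<Rightarrow> ereal"
    and \<mu> :: "'a measure"
    and s :: real
    and n :: nat
    and x :: "nat \<Rightarrow> 'a"
  assumes "admissible_exponent DIM('a) s"
    and "V1 V" and "V2 s V" and "V3 s V"
    and "equilibrium_measure s V \<mu>"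
    and "has_bounded_density \<mu>"
    and "n \<ge> 1"
    and "inj_on x {1..n}"
  shows "\<exists>L::real.
    ((\<lambda>\<eta>. ereal (1 / c_const TYPE('a) s) *
           (ereal (1 / real n) * enn2ereal (trunc_energy s \<mu> n x \<eta>)
            - ereal (c_const TYPE('a) s * kernel_radial s \<eta>))) \<longlongrightarrow> ereal L) (at_right 0) \<and>
    (s \<noteq> 0 \<longrightarrow>
       hamiltonian s V n x =
         ereal ((real n)\<^sup>2) * mean_field_energy s V \<mu>
         + ereal (2 * real n) * (\<Sum>i\<in>{1..n}. eq_zeta s V \<mu> (x i))
         + ereal (real n powr (1 + s / real DIM('a)) * L)) \<and>
    (s = 0 \<longrightarrow>
       hamiltonian s V n x =
         ereal ((real n)\<^sup>2) * mean_field_energy s V \<mu>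
         + ereal (2 * real n) * (\<Sum>i\<in>{1..n}. eq_zeta s V \<mu> (x i))
         - ereal (real n / real DIM('a) * ln (real n))
         + ereal (real n * L))"
proof -
  have "prob_space \<mu>"
    using assms(5) by (simp add: equilibrium_measure_def borel_probability_def)
  then obtain M where M: "bounded_density_measure \<mu> M"
    using has_bounded_density_le[OF assms(6)] by metis
  have d: "1 \<le> real DIM('a)" by (simp add: Suc_leI)
  have s: "0 \<le> s \<and> s < real DIM('a)"
    using assms(1) unfolding admissible_exponent_def
  proof (elim disjE conjE)
    assume "max 0 (real DIM('a) - 2) < s" "s < real DIM('a)"
    then show ?thesis by simp
  next
    assume "DIM('a) \<ge> 3" "s = real DIM('a) - 2"
    moreover from this have "real DIM('a) \<ge> 3" by linarith
    ultimately show ?thesis by linarith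
  qed (use d in linarith)+
  have eq: "equilibrium \<mu> M s V"
    using M s assms(2-5) by (intro equilibrium.intro equilibrium_axioms.intro) auto
  show ?thesis
  proof (cases "ext_dim DIM('a) s = 1")
    case True
    let ?\<gamma> = "s - real DIM('a) + 1"
    have "max 0 (real DIM('a) - 2) < s \<and> s < real DIM('a) \<or> s = 0 \<and> DIM('a) = 1"
      using True unfolding ext_dim_def by (metis zero_neq_one)
    from riesz_extension_half_space[OF this]
    interpret X: riesz_extension "\<lambda>X::'a \<times> real. \<bar>snd X\<bar> powr ?\<gamma>" ?\<gamma> s "\<lambda>z. (z, 0)" fst
      "\<lambda>X. max 1 (\<bar>snd X\<bar> powr (- ((max 0 ?\<gamma> + (1 + ?\<gamma>) / 2) / 2)))"
      "s + 1 - (max 0 ?\<gamma> + (1 + ?\<gamma>) / 2) / 2" "{X. snd X = 0}" .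
    interpret B: blow_up \<mu> M s V "\<lambda>X::'a \<times> real. \<bar>snd X\<bar> powr ?\<gamma>" ?\<gamma> "\<lambda>z. (z, 0)" fst
      "\<lambda>X. max 1 (\<bar>snd X\<bar> powr (- ((max 0 ?\<gamma> + (1 + ?\<gamma>) / 2) / 2)))"
      "s + 1 - (max 0 ?\<gamma> + (1 + ?\<gamma>) / 2) / 2" "{X. snd X = 0}" n x
      by (intro blow_up.intro blow_up_axioms.intro eq X.riesz_extension_axioms assms(7,8))
    show ?thesis
    proof (rule B.splitting_formula)
      show "c_const TYPE('a) s = X.flux_coefficient"
        using True by (simp add: c_const_def ext_weight_exponent_def X.flux_constant_eq)
      show "trunc_energy s \<mu> n x \<eta> = dirichlet_energy (\<lambda>X::'a \<times> real. \<bar>snd X\<bar> powr ?\<gamma>)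
          (trunc_potential (\<lambda>z. (z, 0)) s \<mu> n x \<eta>)" for \<eta>
        using True by (simp add: trunc_energy_def ext_weight_exponent_def)
    qed
  next
    case False
    then have "\<not> (max 0 (real DIM('a) - 2) < s \<and> s < real DIM('a) \<or> s = 0 \<and> DIM('a) = 1)"
      unfolding ext_dim_def by meson
    with assms(1) have "DIM('a) \<ge> 3 \<and> s = real DIM('a) - 2 \<or> s = 0 \<and> DIM('a) = 2"
      unfolding admissible_exponent_def by blast
    \<comment> \<open>The logarithm in dimension 2 also satisfies s = d - 2, so one instance covers
      both remaining cases.\<close>
    then have "DIM('a) \<ge> 2" "s = real DIM('a) - 2" by auto
    from riesz_extension_trivial[OF this]
    interpret X: riesz_extension "\<lambda>X::'a. 1" 0 s "\<lambda>z. z" "\<lambda>X. X" "\<lambda>X. 1" "s + 1" "{}" .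
    interpret B: blow_up \<mu> M s V "\<lambda>X::'a. 1" 0 "\<lambda>z. z" "\<lambda>X. X" "\<lambda>X. 1" "s + 1" "{}" n x
      by (intro blow_up.intro blow_up_axioms.intro eq X.riesz_extension_axioms assms(7,8))
    show ?thesis
    proof (rule B.splitting_formula)
      show "c_const TYPE('a) s = X.flux_coefficient"
        using False by (simp add: c_const_def X.flux_constant_eq)
      show "trunc_energy s \<mu> n x \<eta> = dirichlet_energy (\<lambda>X::'a. 1) (trunc_potential (\<lambda>z. z) s \<mu> n x \<eta>)" for \<eta>
        using False by (simp add: trunc_energy_def)
    qed
  qed
qed

end
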